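(* Work in $\mathsf{ZF}$. Let $U$ be an ultrafilter over a set $I$. Then the following are equivalent: (1) $U$-$\mathsf{AC}_I$ holds. (2) For every structure $M$, the ultrapower ${}^I M/U$ is $\Sigma_2$-elementarily equivalent to $M$. (3) For every family $\{M_i \mid i \in I\}$ of pairwise isomorphic structures with the same language, if $\prod_{i \in I} M_i \neq \emptyset$ then $\prod_{i \in I} M_i/U$ is $\Sigma_1$-elementarily equivalent to $M_i$ for every $i \in I$. (4) For every two structures $M$ and $N$ with the same language, if there are elementary embeddings $j:M \to N$ and $j':N \to M$, then ${}^I M/U$ and ${}^I N/U$ are $\Sigma_2$-elementarily equivalent. (5) For every two families $\{M_i \mid i \in I\}$, $\{N_i \mid i \in I\}$ of structures with the same language, if each $M_i$ is isomorphic to $N_i$ and both $\prod_{i \in I} M_i$ and $\prod_{i \in I} N_i$ are non-empty, then $\prod_{i \in I} M_i/U$ is $\Sigma_1$-elementarily equivalent to $\prod_{i \in I} N_i/U$. (6) For every two families $\{M_i \mid i \in I\}$, $\{N_i \mid i \in I\}$ of structures with the same language, if each $M_i$ is isomorphic to $N_i$ and both $\prod_{i \in I} M_i$ and $\prod_{i \in I} N_i$ are non-empty, then $\prod_{i \in I} M_i/U$ is isomorphic to $\prod_{i \in I} N_i/U$.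
   Context: Everything is in $\mathsf{ZF}$ (no Axiom of Choice). Filters are proper; structures are first-order structures in some language. For an ultrafilter $U$ over $I$ and a family of structures $\{M_i \mid i\in I\}$, the ultraproduct $\prod_{i\in I} M_i/U$ has universe the set of equivalence classes $[f]$ of $f \in \prod_{i\in I} M_i$ under $f \sim g \iff \{i \mid f(i)=g(i)\}\in U$, with relations interpreted by $R([f_0],\dots,[f_n]) \iff \{i \mid M_i\models R(f_0(i),\dots,f_n(i))\}\in U$ (and similarly for constants and functions); when all $M_i = M$ this is the ultrapower ${}^I M/U$. For an ultrafilter $U$ over $I$, $U$-$\mathsf{AC}_I$ is the assertion that for every indexed family $\{A_i \mid i \in I\}$ of non-empty sets there is a function $f$ on $I$ such that $\{i \in I \mid f(i) \in A_i\} \in U$. Two structures are $\Sigma_n$-elementarily equivalent if they satisfy the same $\Sigma_n$ sentences. *)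

theory Defs
  imports Main
begin

text \<open>
  ZF is treated as a first-order theory: a type of class \<open>zf\<close> is (the universe of) a model of ZF,
  and a theorem about all types of that class is, by soundness and completeness, a theorem of ZF.
  Separation and Replacement are the first-order schemas, one instance per formula of the language
  of set theory. They are deliberately not stated for arbitrary HOL predicates: since HOL has a
  choice operator, that would make every model satisfy the Axiom of Choice.
\<close>

class membership =
  fixes mem :: "'a \<Rightarrow> 'a \<Rightarrow> bool"  (infix "\<epsilon>" 50)

datatype zf_formula =
    VMem nat nat
  | VEq nat nat
  | VNeg zf_formula
  | VAnd zf_formula zf_formula
  | VAll nat zf_formula

primrec holds :: "(nat \<Rightarrow> 'a::membership) \<Rightarrow> zf_formula \<Rightarrow> bool" where
  "holds v (VMem m n) \<longleftrightarrow> v m \<epsilon> v n"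
| "holds v (VEq m n) \<longleftrightarrow> v m = v n"
| "holds v (VNeg p) \<longleftrightarrow> \<not> holds v p"
| "holds v (VAnd p q) \<longleftrightarrow> holds v p \<and> holds v q"
| "holds v (VAll n p) \<longleftrightarrow> (\<forall>x. holds (v(n := x)) p)"

class zf = membership +
  assumes extensionality: "(\<And>x. x \<epsilon> a \<longleftrightarrow> x \<epsilon> b) \<Longrightarrow> a = b"
    and foundation: "x \<epsilon> a \<Longrightarrow> \<exists>y. y \<epsilon> a \<and> (\<forall>z. z \<epsilon> y \<longrightarrow> \<not> z \<epsilon> a)"
    and pairing: "\<exists>c. \<forall>x. x \<epsilon> c \<longleftrightarrow> x = a \<or> x = b"
    and union: "\<exists>c. \<forall>x. x \<epsilon> c \<longleftrightarrow> (\<exists>y. y \<epsilon> a \<and> x \<epsilon> y)"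
    and power_set: "\<exists>c. \<forall>x. x \<epsilon> c \<longleftrightarrow> (\<forall>y. y \<epsilon> x \<longrightarrow> y \<epsilon> a)"
    and infinity: "\<exists>w. (\<exists>e. e \<epsilon> w \<and> (\<forall>x. \<not> x \<epsilon> e)) \<and>
      (\<forall>x. x \<epsilon> w \<longrightarrow> (\<exists>y. y \<epsilon> w \<and> (\<forall>z. z \<epsilon> y \<longleftrightarrow> z \<epsilon> x \<or> z = x)))"
    and separation: "\<exists>b. \<forall>x. x \<epsilon> b \<longleftrightarrow> x \<epsilon> a \<and> holds (v(0 := x)) p"
    and replacement: "(\<And>x. x \<epsilon> a \<Longrightarrow> \<exists>!y. holds (v(0 := x, 1 := y)) p) \<Longrightarrow>
      \<exists>b. \<forall>y. y \<epsilon> b \<longleftrightarrow> (\<exists>x. x \<epsilon> a \<and> holds (v(0 := x, 1 := y)) p)"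


section \<open>Set theory inside a model\<close>

text \<open>
  All mathematical objects below (functions, families, languages, structures, formulas, ...) are
  elements of the model. HOL sets only serve as notation for classes definable in the language of
  set theory; \<open>set_of A\<close> is the element with extension \<open>A\<close>, and is only used for classes that ZF
  proves to be sets.
\<close>

definition elts :: "'a::membership \<Rightarrow> 'a set" where
  "elts a = {x. x \<epsilon> a}"

definition set_of :: "'a::membership set \<Rightarrow> 'a" where
  "set_of A = (THE a. elts a = A)"

definition empty :: "'a::membership" where
  "empty = set_of {}"

definition adjoin :: "'a::membership \<Rightarrow> 'a \<Rightarrow> 'a" where
  "adjoin a x = set_of (insert x (elts a))"

definition pair :: "'a::membership \<Rightarrow> 'a \<Rightarrow> 'a"  ("\<langle>_,/ _\<rangle>") where
  "\<langle>x, y\<rangle> = set_of {set_of {x}, set_of {x, y}}"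

definition pfst :: "'a::membership \<Rightarrow> 'a" where
  "pfst p = (THE x. \<exists>y. p = \<langle>x, y\<rangle>)"

definition psnd :: "'a::membership \<Rightarrow> 'a" where
  "psnd p = (THE y. \<exists>x. p = \<langle>x, y\<rangle>)"

definition func_on :: "'a::membership \<Rightarrow> 'a \<Rightarrow> bool" where
  "func_on f a \<longleftrightarrow> (\<forall>p\<in>elts f. \<exists>x y. x \<in> elts a \<and> p = \<langle>x, y\<rangle>) \<and>
     (\<forall>x\<in>elts a. \<exists>!y. \<langle>x, y\<rangle> \<epsilon> f)"

definition app :: "'a::membership \<Rightarrow> 'a \<Rightarrow> 'a"  (infixl "\<cdot>" 90) where
  "f \<cdot> x = (THE y. \<langle>x, y\<rangle> \<epsilon> f)"

definition dom :: "'a::membership \<Rightarrow> 'a" where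
  "dom f = set_of {x. \<exists>y. \<langle>x, y\<rangle> \<epsilon> f}"

definition lam :: "'a::membership \<Rightarrow> ('a \<Rightarrow> 'a) \<Rightarrow> 'a" where
  "lam a F = set_of {\<langle>x, F x\<rangle> | x. x \<in> elts a}"

text \<open>\<open>b \<^bold>^ a\<close> is the set of functions from \<open>a\<close> to \<open>b\<close>; \<open>n\<close>-tuples are functions on \<open>n \<in> \<omega>\<close>.\<close>

definition exponent :: "'a::membership \<Rightarrow> 'a \<Rightarrow> 'a"  (infixr "\<^bold>^" 80) where
  "b \<^bold>^ a = set_of {f. func_on f a \<and> (\<forall>x\<in>elts a. f \<cdot> x \<epsilon> b)}"

definition compose :: "'a::membership \<Rightarrow> 'a \<Rightarrow> 'a"  (infixr "\<odot>" 75) where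
  "g \<odot> f = lam (dom f) (\<lambda>x. g \<cdot> (f \<cdot> x))"

definition omega :: "'a::membership"  ("\<omega>") where
  "\<omega> = set_of {n. \<forall>w. empty \<epsilon> w \<and> (\<forall>k\<in>elts w. adjoin k k \<epsilon> w) \<longrightarrow> n \<epsilon> w}"

primrec numeral_set :: "nat \<Rightarrow> 'a::membership" where
  "numeral_set 0 = empty"
| "numeral_set (Suc n) = adjoin (numeral_set n) (numeral_set n)"


section \<open>Ultrafilters\<close>

definition ultrafilter_over :: "'a::membership \<Rightarrow> 'a \<Rightarrow> bool" where
  "ultrafilter_over I U \<longleftrightarrow>
     (\<forall>X\<in>elts U. elts X \<subseteq> elts I) \<and>
     I \<epsilon> U \<and> \<not> empty \<epsilon> U \<and>
     (\<forall>X\<in>elts U. \<forall>Y. elts X \<subseteq> elts Y \<and> elts Y \<subseteq> elts I \<longrightarrow> Y \<epsilon> U) \<and>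
     (\<forall>X\<in>elts U. \<forall>Y\<in>elts U. set_of (elts X \<inter> elts Y) \<epsilon> U) \<and>
     (\<forall>X. elts X \<subseteq> elts I \<longrightarrow> X \<epsilon> U \<or> set_of (elts I - elts X) \<epsilon> U)"

definition U_many :: "'a::membership \<Rightarrow> 'a \<Rightarrow> ('a \<Rightarrow> bool) \<Rightarrow> bool" where
  "U_many I U P \<longleftrightarrow> set_of {i \<in> elts I. P i} \<epsilon> U"

definition U_AC :: "'a::membership \<Rightarrow> 'a \<Rightarrow> bool" where
  "U_AC I U \<longleftrightarrow> (\<forall>A. func_on A I \<and> (\<forall>i\<in>elts I. A \<cdot> i \<noteq> empty) \<longrightarrow>
     (\<exists>f. func_on f I \<and> U_many I U (\<lambda>i. f \<cdot> i \<epsilon> A \<cdot> i)))"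


section \<open>Languages and structures\<close>

text \<open>
  A language is a pair of arity functions, for relation symbols (arity at least 1) and for
  function symbols; constants are function symbols of arity 0.
\<close>

definition rel_symbols :: "'a::membership \<Rightarrow> 'a" where
  "rel_symbols L = dom (pfst L)"

definition fun_symbols :: "'a::membership \<Rightarrow> 'a" where
  "fun_symbols L = dom (psnd L)"

definition rel_arity :: "'a::membership \<Rightarrow> 'a \<Rightarrow> 'a" where
  "rel_arity L R = pfst L \<cdot> R"

definition fun_arity :: "'a::membership \<Rightarrow> 'a \<Rightarrow> 'a" where
  "fun_arity L F = psnd L \<cdot> F"

definition is_language :: "'a::membership \<Rightarrow> bool" where
  "is_language L \<longleftrightarrow> (\<exists>r f. L = \<langle>r, f\<rangle>) \<and>
     func_on (pfst L) (rel_symbols L) \<and> func_on (psnd L) (fun_symbols L) \<and>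
     (\<forall>R\<in>elts (rel_symbols L). rel_arity L R \<epsilon> \<omega> \<and> rel_arity L R \<noteq> empty) \<and>
     (\<forall>F\<in>elts (fun_symbols L). fun_arity L F \<epsilon> \<omega>)"

text \<open>
  A structure is a triple of a non-empty universe, an interpretation of the relation symbols and
  an interpretation of the function symbols.
\<close>

definition univ :: "'a::membership \<Rightarrow> 'a" where
  "univ M = pfst M"

definition rel_interp :: "'a::membership \<Rightarrow> 'a \<Rightarrow> 'a" where
  "rel_interp M R = pfst (psnd M) \<cdot> R"

definition fun_interp :: "'a::membership \<Rightarrow> 'a \<Rightarrow> 'a" where
  "fun_interp M F = psnd (psnd M) \<cdot> F"

definition is_structure :: "'a::membership \<Rightarrow> 'a \<Rightarrow> bool" where
  "is_structure L M \<longleftrightarrow> (\<exists>A r f. M = \<langle>A, \<langle>r, f\<rangle>\<rangle> \<and> A \<noteq> empty \<and>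
       func_on r (rel_symbols L) \<and> func_on f (fun_symbols L)) \<and>
     (\<forall>R\<in>elts (rel_symbols L). elts (rel_interp M R) \<subseteq> elts (univ M \<^bold>^ rel_arity L R)) \<and>
     (\<forall>F\<in>elts (fun_symbols L). fun_interp M F \<epsilon> univ M \<^bold>^ (univ M \<^bold>^ fun_arity L F))"

definition is_family :: "'a::membership \<Rightarrow> 'a \<Rightarrow> 'a \<Rightarrow> bool" where
  "is_family L I M \<longleftrightarrow> func_on M I \<and> (\<forall>i\<in>elts I. is_structure L (M \<cdot> i))"

definition is_isomorphism :: "'a::membership \<Rightarrow> 'a \<Rightarrow> 'a \<Rightarrow> 'a \<Rightarrow> bool" where
  "is_isomorphism L M N h \<longleftrightarrow> h \<epsilon> univ N \<^bold>^ univ M \<and>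
     (\<forall>b\<in>elts (univ N). \<exists>!a. a \<epsilon> univ M \<and> h \<cdot> a = b) \<and>
     (\<forall>R\<in>elts (rel_symbols L). \<forall>t\<in>elts (univ M \<^bold>^ rel_arity L R).
        t \<epsilon> rel_interp M R \<longleftrightarrow> (h \<odot> t) \<epsilon> rel_interp N R) \<and>
     (\<forall>F\<in>elts (fun_symbols L). \<forall>t\<in>elts (univ M \<^bold>^ fun_arity L F).
        h \<cdot> (fun_interp M F \<cdot> t) = fun_interp N F \<cdot> (h \<odot> t))"

definition isomorphic :: "'a::membership \<Rightarrow> 'a \<Rightarrow> 'a \<Rightarrow> bool" where
  "isomorphic L M N \<longleftrightarrow> (\<exists>h. is_isomorphism L M N h)"


section \<open>Terms and formulas\<close>

text \<open>
  Syntax is coded by sets of the model, so in a model with non-standard \<open>\<omega>\<close> there are non-standard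
  formulas, as it has to be for a statement of ZF about all formulas. Inductively defined sets are
  given as intersections of all sets closed under the formation rules. Variables are the elements
  of \<open>\<omega>\<close>; \<open>X\<close> always is a set of variables.
\<close>

definition tm_var :: "'a::membership \<Rightarrow> 'a" where
  "tm_var x = \<langle>numeral_set 0, x\<rangle>"

definition tm_app :: "'a::membership \<Rightarrow> 'a \<Rightarrow> 'a" where
  "tm_app F t = \<langle>numeral_set 1, \<langle>F, t\<rangle>\<rangle>"

definition terms :: "'a::membership \<Rightarrow> 'a \<Rightarrow> 'a" where
  "terms L X = set_of {t. \<forall>T.
     (\<forall>x\<in>elts X. tm_var x \<epsilon> T) \<and>
     (\<forall>F\<in>elts (fun_symbols L). \<forall>u\<in>elts (T \<^bold>^ fun_arity L F). tm_app F u \<epsilon> T) \<longrightarrow> t \<epsilon> T}"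

definition fm_eq :: "'a::membership \<Rightarrow> 'a \<Rightarrow> 'a" where
  "fm_eq t u = \<langle>numeral_set 0, \<langle>t, u\<rangle>\<rangle>"

definition fm_rel :: "'a::membership \<Rightarrow> 'a \<Rightarrow> 'a" where
  "fm_rel R t = \<langle>numeral_set 1, \<langle>R, t\<rangle>\<rangle>"

definition fm_neg :: "'a::membership \<Rightarrow> 'a" where
  "fm_neg p = \<langle>numeral_set 2, p\<rangle>"

definition fm_and :: "'a::membership \<Rightarrow> 'a \<Rightarrow> 'a" where
  "fm_and p q = \<langle>numeral_set 3, \<langle>p, q\<rangle>\<rangle>"

definition fm_ex :: "'a::membership \<Rightarrow> 'a \<Rightarrow> 'a" where
  "fm_ex x p = \<langle>numeral_set 4, \<langle>x, p\<rangle>\<rangle>"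

definition fm_all :: "'a::membership \<Rightarrow> 'a \<Rightarrow> 'a" where
  "fm_all x p = \<langle>numeral_set 5, \<langle>x, p\<rangle>\<rangle>"

definition is_atomic :: "'a::membership \<Rightarrow> 'a \<Rightarrow> 'a \<Rightarrow> bool" where
  "is_atomic L X p \<longleftrightarrow>
     (\<exists>t\<in>elts (terms L X). \<exists>u\<in>elts (terms L X). p = fm_eq t u) \<or>
     (\<exists>R\<in>elts (rel_symbols L). \<exists>t\<in>elts (terms L X \<^bold>^ rel_arity L R). p = fm_rel R t)"

text \<open>
  \<open>is_formula L X p\<close>: \<open>p\<close> is an \<open>L\<close>-formula all of whose free variables belong to \<open>X\<close>. The
  inductive definition is that of a set of pairs \<open>\<langle>X, p\<rangle>\<close>.
\<close>

definition is_formula :: "'a::membership \<Rightarrow> 'a \<Rightarrow> 'a \<Rightarrow> bool" where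
  "is_formula L X p \<longleftrightarrow> elts X \<subseteq> elts \<omega> \<and> (\<forall>C.
     (\<forall>Y. elts Y \<subseteq> elts \<omega> \<longrightarrow>
        (\<forall>q. is_atomic L Y q \<longrightarrow> \<langle>Y, q\<rangle> \<epsilon> C) \<and>
        (\<forall>q. \<langle>Y, q\<rangle> \<epsilon> C \<longrightarrow> \<langle>Y, fm_neg q\<rangle> \<epsilon> C) \<and>
        (\<forall>q r. \<langle>Y, q\<rangle> \<epsilon> C \<and> \<langle>Y, r\<rangle> \<epsilon> C \<longrightarrow> \<langle>Y, fm_and q r\<rangle> \<epsilon> C) \<and>
        (\<forall>x\<in>elts \<omega>. \<forall>q. \<langle>adjoin Y x, q\<rangle> \<epsilon> C \<longrightarrow>
           \<langle>Y, fm_ex x q\<rangle> \<epsilon> C \<and> \<langle>Y, fm_all x q\<rangle> \<epsilon> C)) \<longrightarrow> \<langle>X, p\<rangle> \<epsilon> C)"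

definition is_quantifier_free :: "'a::membership \<Rightarrow> 'a \<Rightarrow> 'a \<Rightarrow> bool" where
  "is_quantifier_free L X p \<longleftrightarrow> elts X \<subseteq> elts \<omega> \<and> (\<forall>C.
     (\<forall>q. is_atomic L X q \<longrightarrow> q \<epsilon> C) \<and>
     (\<forall>q. q \<epsilon> C \<longrightarrow> fm_neg q \<epsilon> C) \<and>
     (\<forall>q r. q \<epsilon> C \<and> r \<epsilon> C \<longrightarrow> fm_and q r \<epsilon> C) \<longrightarrow> p \<epsilon> C)"

text \<open>
  The prenex hierarchy: \<open>\<Sigma>\<^sub>0 = \<Pi>\<^sub>0\<close> are the quantifier-free formulas; a \<open>\<Sigma>\<close> (\<open>\<Pi>\<close>) formula of level
  \<open>n + 1\<close> is a finite, possibly empty, block of existential (universal) quantifiers followed by a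
  \<open>\<Pi>\<close> (\<open>\<Sigma>\<close>) formula of level \<open>n\<close>. The length of a block is an element of \<open>\<omega>\<close>.
\<close>

fun is_Sigma :: "nat \<Rightarrow> 'a::membership \<Rightarrow> 'a \<Rightarrow> 'a \<Rightarrow> bool"
  and is_Pi :: "nat \<Rightarrow> 'a::membership \<Rightarrow> 'a \<Rightarrow> 'a \<Rightarrow> bool" where
  "is_Sigma 0 L X p \<longleftrightarrow> is_quantifier_free L X p"
| "is_Sigma (Suc n) L X p \<longleftrightarrow> elts X \<subseteq> elts \<omega> \<and> (\<forall>C.
     (\<forall>Y. elts Y \<subseteq> elts \<omega> \<longrightarrow>
        (\<forall>q. is_Pi n L Y q \<longrightarrow> \<langle>Y, q\<rangle> \<epsilon> C) \<and>
        (\<forall>x\<in>elts \<omega>. \<forall>q. \<langle>adjoin Y x, q\<rangle> \<epsilon> C \<longrightarrow> \<langle>Y, fm_ex x q\<rangle> \<epsilon> C)) \<longrightarrow> \<langle>X, p\<rangle> \<epsilon> C)"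
| "is_Pi 0 L X p \<longleftrightarrow> is_quantifier_free L X p"
| "is_Pi (Suc n) L X p \<longleftrightarrow> elts X \<subseteq> elts \<omega> \<and> (\<forall>C.
     (\<forall>Y. elts Y \<subseteq> elts \<omega> \<longrightarrow>
        (\<forall>q. is_Sigma n L Y q \<longrightarrow> \<langle>Y, q\<rangle> \<epsilon> C) \<and>
        (\<forall>x\<in>elts \<omega>. \<forall>q. \<langle>adjoin Y x, q\<rangle> \<epsilon> C \<longrightarrow> \<langle>Y, fm_all x q\<rangle> \<epsilon> C)) \<longrightarrow> \<langle>X, p\<rangle> \<epsilon> C)"


section \<open>Satisfaction\<close>

text \<open>
  An assignment is a function \<open>s\<close> from a set \<open>X\<close> of variables to the universe; it is used
  for formulas whose free variables belong to \<open>X\<close>. \<open>eval L M s\<close> is the function on \<open>terms L X\<close>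
  that evaluates terms.
\<close>

definition update :: "'a::membership \<Rightarrow> 'a \<Rightarrow> 'a \<Rightarrow> 'a" where
  "update s x a = lam (adjoin (dom s) x) (\<lambda>y. if y = x then a else s \<cdot> y)"

definition eval :: "'a::membership \<Rightarrow> 'a \<Rightarrow> 'a \<Rightarrow> 'a" where
  "eval L M s = (THE e. func_on e (terms L (dom s)) \<and>
     (\<forall>x\<in>elts (dom s). e \<cdot> tm_var x = s \<cdot> x) \<and>
     (\<forall>F\<in>elts (fun_symbols L). \<forall>t\<in>elts (terms L (dom s) \<^bold>^ fun_arity L F).
        e \<cdot> tm_app F t = fun_interp M F \<cdot> (e \<odot> t)))"

text \<open>
  \<open>S\<close> is a satisfaction relation for \<open>M\<close> if Tarski's clauses hold for all formulas and assignments.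
  Any two such \<open>S\<close> agree on the relevant pairs \<open>\<langle>p, s\<rangle>\<close>, by induction on formulas.
\<close>

definition is_satisfaction :: "'a::membership \<Rightarrow> 'a \<Rightarrow> 'a \<Rightarrow> bool" where
  "is_satisfaction L M S \<longleftrightarrow> (\<forall>X s. elts X \<subseteq> elts \<omega> \<and> s \<epsilon> univ M \<^bold>^ X \<longrightarrow>
     (\<forall>t\<in>elts (terms L X). \<forall>u\<in>elts (terms L X).
        \<langle>fm_eq t u, s\<rangle> \<epsilon> S \<longleftrightarrow> eval L M s \<cdot> t = eval L M s \<cdot> u) \<and>
     (\<forall>R\<in>elts (rel_symbols L). \<forall>t\<in>elts (terms L X \<^bold>^ rel_arity L R).
        \<langle>fm_rel R t, s\<rangle> \<epsilon> S \<longleftrightarrow> (eval L M s \<odot> t) \<epsilon> rel_interp M R) \<and>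
     (\<forall>p. is_formula L X p \<longrightarrow>
        (\<langle>fm_neg p, s\<rangle> \<epsilon> S \<longleftrightarrow> \<not> \<langle>p, s\<rangle> \<epsilon> S)) \<and>
     (\<forall>p q. is_formula L X p \<and> is_formula L X q \<longrightarrow>
        (\<langle>fm_and p q, s\<rangle> \<epsilon> S \<longleftrightarrow> \<langle>p, s\<rangle> \<epsilon> S \<and> \<langle>q, s\<rangle> \<epsilon> S)) \<and>
     (\<forall>x\<in>elts \<omega>. \<forall>p. is_formula L (adjoin X x) p \<longrightarrow>
        (\<langle>fm_ex x p, s\<rangle> \<epsilon> S \<longleftrightarrow> (\<exists>a\<in>elts (univ M). \<langle>p, update s x a\<rangle> \<epsilon> S)) \<and>
        (\<langle>fm_all x p, s\<rangle> \<epsilon> S \<longleftrightarrow> (\<forall>a\<in>elts (univ M). \<langle>p, update s x a\<rangle> \<epsilon> S))))"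

definition satisfies :: "'a::membership \<Rightarrow> 'a \<Rightarrow> 'a \<Rightarrow> 'a \<Rightarrow> bool" where
  "satisfies L M p s \<longleftrightarrow> (\<exists>S. is_satisfaction L M S \<and> \<langle>p, s\<rangle> \<epsilon> S)"

definition elementary_embedding :: "'a::membership \<Rightarrow> 'a \<Rightarrow> 'a \<Rightarrow> 'a \<Rightarrow> bool" where
  "elementary_embedding L M N j \<longleftrightarrow> j \<epsilon> univ N \<^bold>^ univ M \<and>
     (\<forall>X p. is_formula L X p \<longrightarrow> (\<forall>s\<in>elts (univ M \<^bold>^ X).
        satisfies L M p s \<longleftrightarrow> satisfies L N p (j \<odot> s)))"

text \<open>Sentences are the formulas with free variables in the empty set.\<close>

definition Sigma_equivalent :: "nat \<Rightarrow> 'a::membership \<Rightarrow> 'a \<Rightarrow> 'a \<Rightarrow> bool" where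
  "Sigma_equivalent n L M N \<longleftrightarrow> (\<forall>p. is_Sigma n L empty p \<longrightarrow>
     (satisfies L M p empty \<longleftrightarrow> satisfies L N p empty))"


section \<open>Ultraproducts\<close>

definition product_univ :: "'a::membership \<Rightarrow> 'a \<Rightarrow> 'a" where
  "product_univ I M = set_of {f. func_on f I \<and> (\<forall>i\<in>elts I. f \<cdot> i \<epsilon> univ (M \<cdot> i))}"

definition ultra_class :: "'a::membership \<Rightarrow> 'a \<Rightarrow> 'a \<Rightarrow> 'a \<Rightarrow> 'a" where
  "ultra_class I U M f =
     set_of {g \<in> elts (product_univ I M). U_many I U (\<lambda>i. f \<cdot> i = g \<cdot> i)}"

text \<open>
  In the next three definitions, \<open>g\<close> is a tuple of elements of the product,
  \<open>class_tuple I U M g\<close> is the tuple of their classes and \<open>coordinate g i\<close> the tuple of their values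
  at \<open>i\<close>.
\<close>

definition class_tuple :: "'a::membership \<Rightarrow> 'a \<Rightarrow> 'a \<Rightarrow> 'a \<Rightarrow> 'a" where
  "class_tuple I U M g = lam (dom g) (\<lambda>k. ultra_class I U M (g \<cdot> k))"

definition coordinate :: "'a::membership \<Rightarrow> 'a \<Rightarrow> 'a" where
  "coordinate g i = lam (dom g) (\<lambda>k. g \<cdot> k \<cdot> i)"

definition ultraproduct :: "'a::membership \<Rightarrow> 'a \<Rightarrow> 'a \<Rightarrow> 'a \<Rightarrow> 'a" where
  "ultraproduct L I U M =
     \<langle>set_of {ultra_class I U M f | f. f \<in> elts (product_univ I M)},
      \<langle>lam (rel_symbols L) (\<lambda>R. set_of {class_tuple I U M g | g.
           g \<in> elts (product_univ I M \<^bold>^ rel_arity L R) \<and>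
           U_many I U (\<lambda>i. coordinate g i \<epsilon> rel_interp (M \<cdot> i) R)}),
       lam (fun_symbols L) (\<lambda>F. set_of {\<langle>class_tuple I U M g,
             ultra_class I U M (lam I (\<lambda>i. fun_interp (M \<cdot> i) F \<cdot> coordinate g i))\<rangle> | g.
           g \<in> elts (product_univ I M \<^bold>^ fun_arity L F)})\<rangle>\<rangle>"

definition ultrapower :: "'a::membership \<Rightarrow> 'a \<Rightarrow> 'a \<Rightarrow> 'a \<Rightarrow> 'a" where
  "ultrapower L I U M = ultraproduct L I U (lam I (\<lambda>i. M))"

end

theory Submission
  imports Defs
begin

text \<open>
  Under \<open>U\<close>-AC Los's theorem holds: a witness of an existential formula only has to be chosen
  in \<open>U\<close>-many coordinates. In the same way one chooses isomorphisms between the factors of two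
  families, which gives an isomorphism of the ultraproducts.

  Conversely, let \<open>A\<close> be a family of non-empty sets, and let \<open>W\<close> be a set that contains all elements
  of all \<open>A \<cdot> i\<close> and is closed under pairing. Since \<open>A \<cdot> i \<times> W\<close> is a subset of \<open>W\<close> and contains
  injective images of it, it is equipotent to \<open>W\<close>, for each \<open>i\<close> separately but not uniformly. If
  the sets \<open>{empty} \<union> A \<cdot> i \<times> W\<close> have an ultraproduct with at least two elements, then one of two
  distinct elements avoids \<open>empty\<close> in \<open>U\<close>-many coordinates, and its first components choose from \<open>A\<close>.
  For ultrapowers one codes all these sets into a single structure, an equivalence relation: each
  of them is one class, next to many classes of size \<open>W\<close>. It is elementarily bi-embeddable, by a
  back-and-forth argument, with the relation all of whose classes are copies of \<open>W\<close>, in whose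
  ultrapower no class is a singleton. In the ultrapower of the first structure, a second element
  in the class of the sequence of the points \<open>empty\<close> then yields a choice.
\<close>


section \<open>Definable classes\<close>

text \<open>The formulas of the theorem are elements of the model, possibly non-standard ones.
  Inductions on terms, formulas and lengths of tuples therefore take place inside the model, each
  with a definable hypothesis. Moreover a context may be any set of variables, so assignments may be
  infinite. For the back-and-forth argument a new element thus has to avoid a whole sequence indexed
  by a subset of \<omega>, and it has to be found without choice. This is why \<open>W\<close> is
  made to contain all subsets of \<omega>: Cantor's diagonal set is an explicit new element.

  The point \<open>empty\<close> next to \<open>A \<cdot> i \<times> W\<close> has two tasks. Its
  constant sequence shows that the product is non-empty, which ZF does not give for arbitrary
  non-empty factors; and since it is not a pair, it can be told apart from the other points in every
  coordinate. The levels of the hierarchy come from the two sentences involved: that there are two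
  distinct elements is \<Sigma> of level 1, that some class is a singleton is \<Sigma> of level
  2.\<close>

text \<open>
  Separation and Replacement are only available for formulas of set theory, so every comprehension
  and every induction needs a definability proof. The predicate \<open>dfn P\<close> says that \<open>P\<close> is a
  property of environments which is definable with parameters: the even variables carry the
  environment, the odd ones the parameters. Binders are handled as for de Bruijn indices, so that
  such proofs amount to a syntax-directed application of the rules \<open>dfn_intros\<close>.
\<close>

named_theorems dfn_intros

definition merge :: "(nat \<Rightarrow> 'a) \<Rightarrow> (nat \<Rightarrow> 'a) \<Rightarrow> nat \<Rightarrow> 'a" where
  "merge e w n = (if even n then e (n div 2) else w (n div 2))"

definition dfn :: "((nat \<Rightarrow> 'a::membership) \<Rightarrow> bool) \<Rightarrow> bool" where
  "dfn P \<longleftrightarrow> (\<exists>p w. \<forall>e. P e \<longleftrightarrow> holds (merge e w) p)"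

text \<open>The counterpart of \<open>dfn\<close> for operations: the graph is definable, with the
  value in position 0 and the environment of \<open>t\<close> moved up by one. The language of set
  theory has no function symbols, so operations are handled through their graphs.\<close>

definition tdf :: "((nat \<Rightarrow> 'a::membership) \<Rightarrow> 'a) \<Rightarrow> bool" where
  "tdf t \<longleftrightarrow> dfn (\<lambda>e. e 0 = t (\<lambda>n. e (Suc n)))"

primrec rename :: "(nat \<Rightarrow> nat) \<Rightarrow> zf_formula \<Rightarrow> zf_formula" where
  "rename f (VMem m n) = VMem (f m) (f n)"
| "rename f (VEq m n) = VEq (f m) (f n)"
| "rename f (VNeg p) = VNeg (rename f p)"
| "rename f (VAnd p q) = VAnd (rename f p) (rename f q)"
| "rename f (VAll n p) = VAll (f n) (rename f p)"

text \<open>Injectivity prevents capture: a renamed bound variable never meets the image of another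
  variable.\<close>

lemma holds_rename: "inj f \<Longrightarrow> holds v (rename f p) \<longleftrightarrow> holds (v \<circ> f) p"
proof (induction p arbitrary: v)
  case (VAll n p)
  have "v(f n := x) \<circ> f = (v \<circ> f)(n := x)" for x
    using VAll.prems by (auto simp: fun_eq_iff inj_eq)
  with VAll show ?case by (simp add: comp_def del: fun_upd_apply)
qed auto

text \<open>A change of layout preserves definability if one reindexing \<open>f\<close> works for
  all environments. The new parameters \<open>w'\<close> may depend on the old ones, but not on the
  environment.\<close>

lemma dfn_transform:
  assumes "dfn P" and "inj f" and "\<And>w. \<exists>w'. \<forall>e. merge (g e) w = merge e w' \<circ> f"
  shows "dfn (\<lambda>e. P (g e))"
proof -
  obtain p w where p: "\<And>e. P e \<longleftrightarrow> holds (merge e w) p"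
    using assms(1) unfolding dfn_def by blast
  obtain w' where "\<And>e. merge (g e) w = merge e w' \<circ> f" using assms(3) by blast
  then have "P (g e) \<longleftrightarrow> holds (merge e w') (rename f p)" for e
    using p assms(2) by (simp add: holds_rename)
  then show ?thesis unfolding dfn_def by blast
qed

section \<open>Closure of definable predicates under the logical operations\<close>

lemma dfn_not [dfn_intros]:
  assumes "dfn P"
  shows "dfn (\<lambda>e. \<not> P e)"
proof -
  obtain p w where "\<And>e. P e \<longleftrightarrow> holds (merge e w) p"
    using assms unfolding dfn_def by blast
  then have "\<forall>e. \<not> P e \<longleftrightarrow> holds (merge e w) (VNeg p)" by simp
  then show ?thesis unfolding dfn_def by blast
qed

lemma dfn_conj [dfn_intros]:
  assumes "dfn P" "dfn Q"
  shows "dfn (\<lambda>e. P e \<and> Q e)"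
proof -
  obtain p w where p: "\<And>e. P e \<longleftrightarrow> holds (merge e w) p"
    using assms(1) unfolding dfn_def by blast
  obtain q u where q: "\<And>e. Q e \<longleftrightarrow> holds (merge e u) q"
    using assms(2) unfolding dfn_def by blast
  \<comment> \<open>The parameters of the two formulas are interleaved as \<open>merge w u\<close>:
    entry \<open>k\<close> of \<open>w\<close> becomes variable \<open>2 * (2 * k) + 1\<close>,
    entry \<open>k\<close> of \<open>u\<close> becomes variable
    \<open>2 * (2 * k + 1) + 1\<close>.\<close>
  define f where "f n = (if even n then n else 2 * n - 1)" for n :: nat
  define g where "g n = (if even n then n else 2 * n + 1)" for n :: nat
  have f: "inj f" unfolding f_def inj_def by (auto split: if_splits)
  have g: "inj g" unfolding g_def inj_def by (auto split: if_splits)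
  have merge_odd: "merge e x (2 * k + 1) = x k" for e x :: "nat \<Rightarrow> 'a" and k
    by (simp add: merge_def)
  have "merge e w n = merge e (merge w u) (f n)" for e n
  proof (cases "even n")
    case False
    then obtain k where n: "n = 2 * k + 1" by (elim oddE)
    then have "f n = 2 * (2 * k) + 1" by (simp add: f_def)
    then show ?thesis unfolding n merge_odd by (simp only: merge_odd) (simp add: merge_def)
  qed (simp add: merge_def f_def)
  moreover have "merge e u n = merge e (merge w u) (g n)" for e n
  proof (cases "even n")
    case False
    then obtain k where n: "n = 2 * k + 1" by (elim oddE)
    then have "g n = 2 * (2 * k + 1) + 1" by (simp add: g_def)
    then show ?thesis unfolding n by (simp only: merge_odd)
  qed (simp add: merge_def g_def)
  ultimately have "merge e (merge w u) \<circ> f = merge e w" "merge e (merge w u) \<circ> g = merge e u" for e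
    by auto
  then have "P e \<and> Q e \<longleftrightarrow> holds (merge e (merge w u)) (VAnd (rename f p) (rename g q))" for e
    using p q f g by (simp add: holds_rename)
  then show ?thesis unfolding dfn_def by blast
qed

lemma dfn_all [dfn_intros]:
  assumes "dfn (\<lambda>e. P (\<lambda>n. e (Suc n)) (e 0))"
  shows "dfn (\<lambda>e. \<forall>x. P e x)"
proof -
  obtain p w where p: "\<And>e. P (\<lambda>n. e (Suc n)) (e 0) \<longleftrightarrow> holds (merge e w) p"
    using assms unfolding dfn_def by blast
  \<comment> \<open>The bound value is kept in the first parameter slot, variable 1, which holds a
    dummy until it is quantified. The true parameters move up by one slot, and the rest of the
    environment moves down by one.\<close>
  define f where "f n = (if n = 0 then 1 else if even n then n - 2 else n + 2)" for n :: nat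
  have f: "inj f" unfolding f_def inj_def
    by (auto split: if_splits elim!: evenE) presburger+
  have eq: "merge (case_nat x e) w = (merge e (case_nat undefined w))(1 := x) \<circ> f" for x e
  proof
    fix n
    have "n = 0 \<or> (\<exists>m. n = 2 * Suc m) \<or> (\<exists>m. n = 2 * m + 1)" by presburger
    then show "merge (case_nat x e) w n = ((merge e (case_nat undefined w))(1 := x) \<circ> f) n"
      by (elim disjE exE) (simp_all add: merge_def f_def)
  qed
  have "P e x \<longleftrightarrow> holds ((merge e (case_nat undefined w))(1 := x)) (rename f p)" for e x
    using p[of "case_nat x e"] f eq[of x e] by (simp add: holds_rename)
  then have "(\<forall>x. P e x) \<longleftrightarrow> holds (merge e (case_nat undefined w)) (VAll 1 (rename f p))" for e
    by simp
  then show ?thesis unfolding dfn_def by blast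
qed

lemma dfn_const [dfn_intros]: "dfn (\<lambda>e. c)"
proof (cases c)
  case True
  then have "\<forall>e. c \<longleftrightarrow> holds (merge e undefined) (VEq 0 0)" by simp
  then show ?thesis unfolding dfn_def by blast
next
  case False
  then have "\<forall>e. c \<longleftrightarrow> holds (merge e undefined) (VNeg (VEq 0 0))" by simp
  then show ?thesis unfolding dfn_def by blast
qed

lemma dfn_disj [dfn_intros]: "dfn P \<Longrightarrow> dfn Q \<Longrightarrow> dfn (\<lambda>e. P e \<or> Q e)"
  using dfn_not[OF dfn_conj[OF dfn_not[of P] dfn_not[of Q]]] by simp

lemma dfn_imp [dfn_intros]: "dfn P \<Longrightarrow> dfn Q \<Longrightarrow> dfn (\<lambda>e. P e \<longrightarrow> Q e)"
  unfolding imp_conv_disj by (intro dfn_disj dfn_not)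

lemma dfn_iff [dfn_intros]: "dfn P \<Longrightarrow> dfn Q \<Longrightarrow> dfn (\<lambda>e. P e \<longleftrightarrow> Q e)"
  unfolding iff_conv_conj_imp by (intro dfn_conj dfn_imp)

lemma dfn_ex [dfn_intros]:
  "dfn (\<lambda>e. P (\<lambda>n. e (Suc n)) (e 0)) \<Longrightarrow> dfn (\<lambda>e. \<exists>x. P e x)"
  using dfn_not[OF dfn_all[of "\<lambda>e x. \<not> P e x"]] dfn_not[of "\<lambda>e. P (\<lambda>n. e (Suc n)) (e 0)"] by simp

lemma dfn_var_eq: "dfn (\<lambda>e. e m = e n)"
proof -
  have "e m = e n \<longleftrightarrow> holds (merge e undefined) (VEq (2 * m) (2 * n))" for e :: "nat \<Rightarrow> 'a"
    by (simp add: merge_def)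
  then show ?thesis unfolding dfn_def by blast
qed

lemma dfn_var_mem: "dfn (\<lambda>e. e m \<epsilon> e n)"
proof -
  have "e m \<epsilon> e n \<longleftrightarrow> holds (merge e undefined) (VMem (2 * m) (2 * n))" for e :: "nat \<Rightarrow> 'a"
    by (simp add: merge_def)
  then show ?thesis unfolding dfn_def by blast
qed

lemma tdf_var [dfn_intros]: "tdf (\<lambda>e. e n)"
  unfolding tdf_def by (rule dfn_var_eq)

lemma tdf_const [dfn_intros]: "tdf (\<lambda>e. c)"
proof -
  have "e 0 = c \<longleftrightarrow> holds (merge e (\<lambda>n. c)) (VEq 0 1)" for e :: "nat \<Rightarrow> 'a"
    by (simp add: merge_def)
  then show ?thesis unfolding tdf_def dfn_def by blast
qed

lemma dfn_rename:
  assumes "dfn P" and "inj h"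
  shows "dfn (\<lambda>e. P (\<lambda>n. e (h n)))"
proof (rule dfn_transform[OF assms(1)])
  let ?f = "\<lambda>n::nat. if even n then 2 * h (n div 2) else n"
  show "inj ?f"
  proof (rule injI)
    fix m n assume eq: "?f m = ?f n"
    then have "even m \<longleftrightarrow> even n" by (metis dvd_triv_left)
    then show "m = n"
      using eq injD[OF assms(2), of "m div 2" "n div 2"] by (cases "even n") auto
  qed
  show "\<exists>w'. \<forall>e. merge (\<lambda>n. e (h n)) w = merge e w' \<circ> ?f" for w :: "nat \<Rightarrow> 'a"
    by (rule exI[of _ w]) (auto simp: merge_def fun_eq_iff)
qed

text \<open>A term is eliminated by quantifying over its value. What remains is to rename variables
  past the two new binders, the inner of which is position 0.\<close>

lemma dfn_subst2:
  assumes "dfn (\<lambda>e. P (e 0) (e (Suc 0)))" "tdf s" "tdf t"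
  shows "dfn (\<lambda>e. P (s e) (t e))"
proof -
  have "dfn (\<lambda>e. \<exists>x y. x = s e \<and> y = t e \<and> P x y)"
  proof (intro dfn_ex dfn_conj)
    show "dfn (\<lambda>e. e (Suc 0) = s (\<lambda>n. e (Suc (Suc n))))"
      using dfn_rename[OF assms(2)[unfolded tdf_def], of Suc] by simp
    show "dfn (\<lambda>e. e 0 = t (\<lambda>n. e (Suc (Suc n))))"
      using dfn_rename[OF assms(3)[unfolded tdf_def], of "\<lambda>n. if n = 0 then 0 else Suc n"]
      by (simp add: inj_def)
    show "dfn (\<lambda>e. P (e (Suc 0)) (e 0))"
      using dfn_rename[OF assms(1), of "\<lambda>n. if n = 0 then 1 else if n = 1 then 0 else n",
        OF injI] by (simp split: if_split_asm)
  qed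
  then show ?thesis by simp
qed

lemma dfn_subst3:
  assumes "dfn (\<lambda>e. P (e 0) (e (Suc 0)) (e (Suc (Suc 0))))" "tdf s" "tdf t" "tdf u"
  shows "dfn (\<lambda>e. P (s e) (t e) (u e))"
proof -
  have "dfn (\<lambda>e. \<exists>x y z. x = s e \<and> y = t e \<and> z = u e \<and> P x y z)"
  proof (intro dfn_ex dfn_conj)
    show "dfn (\<lambda>e. e (Suc (Suc 0)) = s (\<lambda>n. e (Suc (Suc (Suc n)))))"
      using dfn_rename[OF assms(2)[unfolded tdf_def], of "\<lambda>n. Suc (Suc n)"] by (simp add: inj_def)
    show "dfn (\<lambda>e. e (Suc 0) = t (\<lambda>n. e (Suc (Suc (Suc n)))))"
      using dfn_rename[OF assms(3)[unfolded tdf_def], of "\<lambda>n. if n = 0 then 1 else Suc (Suc n)"]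
      by (simp add: inj_def)
    show "dfn (\<lambda>e. e 0 = u (\<lambda>n. e (Suc (Suc (Suc n)))))"
      using dfn_rename[OF assms(4)[unfolded tdf_def], of "\<lambda>n. if n = 0 then 0 else Suc (Suc n)"]
      by (simp add: inj_def)
    show "dfn (\<lambda>e. P (e (Suc (Suc 0))) (e (Suc 0)) (e 0))"
      using dfn_rename[OF assms(1), of "\<lambda>n. if n = 0 then Suc (Suc 0) else if n = Suc (Suc 0) then 0 else n"]
      by (simp add: inj_def split: if_split_asm)
  qed
  then show ?thesis by simp
qed

lemma tdf_shift:
  assumes "tdf t"
  shows "tdf (\<lambda>e. t (\<lambda>n. e (Suc n)))"
  using dfn_rename[OF assms[unfolded tdf_def], of "\<lambda>n. if n = 0 then 0 else Suc n"]
  unfolding tdf_def by (simp add: inj_def)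

lemma tdf_subst1:
  assumes "tdf (\<lambda>e. F (e 0))" "tdf t"
  shows "tdf (\<lambda>e. F (t e))"
proof -
  have "dfn (\<lambda>e. e 0 = F (t (\<lambda>n. e (Suc n))))"
  proof (rule dfn_subst2[where P = "\<lambda>x y. x = F y"])
    show "dfn (\<lambda>e. e 0 = F (e (Suc 0)))" using assms(1) by (simp add: tdf_def)
  qed (rule tdf_var tdf_shift[OF assms(2)])+
  then show ?thesis by (simp add: tdf_def)
qed

lemma tdf_subst2:
  assumes "tdf (\<lambda>e. F (e 0) (e (Suc 0)))" "tdf s" "tdf t"
  shows "tdf (\<lambda>e. F (s e) (t e))"
proof -
  have "dfn (\<lambda>e. e 0 = F (s (\<lambda>n. e (Suc n))) (t (\<lambda>n. e (Suc n))))"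
  proof (rule dfn_subst3[where P = "\<lambda>x y z. x = F y z"])
    show "dfn (\<lambda>e. e 0 = F (e (Suc 0)) (e (Suc (Suc 0))))"
      by (rule assms(1)[unfolded tdf_def])
  qed (rule tdf_var tdf_shift[OF assms(2)] tdf_shift[OF assms(3)])+
  then show ?thesis by (simp add: tdf_def)
qed

lemma dfn_eq [dfn_intros]: "tdf s \<Longrightarrow> tdf t \<Longrightarrow> dfn (\<lambda>e. s e = t e)"
  by (rule dfn_subst2[where P = "\<lambda>x y. x = y", OF dfn_var_eq])

lemma dfn_mem [dfn_intros]: "tdf s \<Longrightarrow> tdf t \<Longrightarrow> dfn (\<lambda>e. s e \<epsilon> t e)"
  by (rule dfn_subst2[where P = "\<lambda>x y. x \<epsilon> y", OF dfn_var_mem])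

lemma mem_elts [simp]: "x \<in> elts a \<longleftrightarrow> x \<epsilon> a"
  by (simp add: elts_def)

lemma dfn_mem_elts [dfn_intros]: "tdf s \<Longrightarrow> tdf t \<Longrightarrow> dfn (\<lambda>e. s e \<in> elts (t e))"
  unfolding mem_elts by (rule dfn_mem)

lemma dfn_ball [dfn_intros]:
  assumes "tdf a" "dfn (\<lambda>e. P (\<lambda>n. e (Suc n)) (e 0))"
  shows "dfn (\<lambda>e. \<forall>x\<in>elts (a e). P e x)"
proof -
  have "dfn (\<lambda>e. \<forall>x. x \<epsilon> a e \<longrightarrow> P e x)"
    by (intro dfn_intros tdf_shift[OF assms(1)] assms(2))
  then show ?thesis by (simp add: Ball_def)
qed

lemma dfn_bex [dfn_intros]:
  assumes "tdf a" "dfn (\<lambda>e. P (\<lambda>n. e (Suc n)) (e 0))"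
  shows "dfn (\<lambda>e. \<exists>x\<in>elts (a e). P e x)"
proof -
  have "dfn (\<lambda>e. \<exists>x. x \<epsilon> a e \<and> P e x)"
    by (intro dfn_intros tdf_shift[OF assms(1)] assms(2))
  then show ?thesis by (simp add: Bex_def)
qed

lemma dfn_elts_subset [dfn_intros]:
  assumes "tdf s" "tdf t"
  shows "dfn (\<lambda>e. elts (s e) \<subseteq> elts (t e))"
proof -
  have "dfn (\<lambda>e. \<forall>x\<in>elts (s e). x \<epsilon> t e)"
    by (intro dfn_intros assms tdf_shift[OF assms(2)])
  then show ?thesis by (simp add: subset_iff Ball_def)
qed

text \<open>With uniqueness a description is definable even where it fails: there the predicate is
  the constantly false one, so the value is a single fixed element, which may serve as a
  parameter.\<close>

lemma tdf_The:
  assumes "dfn (\<lambda>e. P (\<lambda>n. e (Suc n)) (e 0))" and unique: "\<And>e x y. P e x \<Longrightarrow> P e y \<Longrightarrow> x = y"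
  shows "tdf (\<lambda>e. THE x. P e x)"
proof -
  have P': "dfn (\<lambda>e. P (\<lambda>n. e (Suc (Suc n))) (e 0))"
    using dfn_rename[OF assms(1), of "\<lambda>n. if n = 0 then 0 else Suc n"] by (simp add: inj_def)
  have "y = (THE x. P e x) \<longleftrightarrow> P e y \<or> \<not> (\<exists>x. P e x) \<and> y = (THE x. False)" for e y
  proof (cases "\<exists>x. P e x")
    case True
    then show ?thesis using unique by (metis theI)
  next
    case False
    then have "P e = (\<lambda>x. False)" by auto
    then show ?thesis by simp
  qed
  then have "tdf (\<lambda>e. THE x. P e x) \<longleftrightarrow> dfn (\<lambda>e. P (\<lambda>n. e (Suc n)) (e 0) \<or>
      \<not> (\<exists>x. P (\<lambda>n. e (Suc n)) x) \<and> e 0 = (THE x. False))"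
    unfolding tdf_def by simp
  also have "\<dots>"
    by (intro dfn_disj dfn_conj dfn_not dfn_ex assms(1) P' dfn_eq tdf_var tdf_const)
  finally show ?thesis .
qed

lemma tdf_if [dfn_intros]:
  assumes "dfn P" "tdf s" "tdf t"
  shows "tdf (\<lambda>e. if P e then s e else t e)"
proof -
  have P: "dfn (\<lambda>e. P (\<lambda>n. e (Suc n)))"
    using dfn_rename[OF assms(1), of Suc] by simp
  have "dfn (\<lambda>e. P (\<lambda>n. e (Suc n)) \<and> e 0 = s (\<lambda>n. e (Suc n)) \<or>
      \<not> P (\<lambda>n. e (Suc n)) \<and> e 0 = t (\<lambda>n. e (Suc n)))"
    using assms(2,3)[unfolded tdf_def] P by (intro dfn_disj dfn_conj dfn_not)
  then show ?thesis
    unfolding tdf_def by (rule back_subst[of dfn]) auto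
qed

section \<open>Separation and Replacement for definable predicates\<close>

lemma separation_dfn:
  fixes a :: "'a::zf"
  assumes "dfn (\<lambda>e. P (e 0))"
  shows "\<exists>b. \<forall>x. x \<epsilon> b \<longleftrightarrow> x \<epsilon> a \<and> P x"
proof -
  obtain p w where p: "\<And>e. P (e 0) \<longleftrightarrow> holds (merge e w) p"
    using assms unfolding dfn_def by blast
  let ?e = "\<lambda>n. undefined"
  have "merge (?e(0 := x)) w = (merge ?e w)(0 := x)" for x
    by (auto simp: merge_def fun_eq_iff elim!: evenE)
  then have "holds ((merge ?e w)(0 := x)) p \<longleftrightarrow> P x" for x
    using p[of "?e(0 := x)"] by simp
  then show ?thesis
    using separation[of a "merge ?e w" p] by blast
qed

lemma replacement_dfn:
  fixes a :: "'a::zf"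
  assumes "dfn (\<lambda>e. P (e 0) (e (Suc 0)))" and ex1: "\<And>x. x \<epsilon> a \<Longrightarrow> \<exists>!y. P x y"
  shows "\<exists>b. \<forall>y. y \<epsilon> b \<longleftrightarrow> (\<exists>x. x \<epsilon> a \<and> P x y)"
proof -
  obtain p w where p: "\<And>e. P (e 0) (e (Suc 0)) \<longleftrightarrow> holds (merge e w) p"
    using assms(1) unfolding dfn_def by blast
  \<comment> \<open>The axiom uses variables 0 and 1, while positions 0 and 1 of an environment are
    variables 0 and 2. Everything else is moved up by two to stay clear of them.\<close>
  define f where "f n = (if n = 0 then 0 else if n = 2 then 1 else n + 2)" for n :: nat
  have f: "inj f" unfolding f_def inj_def by (auto split: if_splits)
  define v where "v n = w ((n - 2) div 2)" for n :: nat
  \<comment> \<open>Environment positions from 2 on are free to choose. Filling them with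
    \<open>w\<close> as well makes the entries for even and odd variables agree with the same
    \<open>v\<close>.\<close>
  let ?e = "\<lambda>x y. \<lambda>n::nat. if n = 0 then x else if n = 1 then y else w n"
  have "v(0 := x, 1 := y) \<circ> f = merge (?e x y) w" for x y
    unfolding v_def merge_def f_def fun_eq_iff by (auto elim!: evenE)
  then have "holds (v(0 := x, 1 := y)) (rename f p) \<longleftrightarrow> P x y" for x y
    unfolding holds_rename[OF f] using p[of "?e x y"] by (simp del: fun_upd_apply)
  then show ?thesis
    using replacement[of a v "rename f p"] ex1 by simp
qed

section \<open>Sets, pairs and functions\<close>

lemma ball_elts [simp]: "(\<forall>x\<in>elts a. P x) \<longleftrightarrow> (\<forall>x. x \<epsilon> a \<longrightarrow> P x)"
  and bex_elts [simp]: "(\<exists>x\<in>elts a. P x) \<longleftrightarrow> (\<exists>x. x \<epsilon> a \<and> P x)"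
  by (simp_all add: Ball_def Bex_def)

lemma elts_subset [simp]: "elts a \<subseteq> elts b \<longleftrightarrow> (\<forall>x. x \<epsilon> a \<longrightarrow> x \<epsilon> b)"
  by (simp add: subset_iff)

lemma tdf_rename:
  assumes "tdf t" "inj h"
  shows "tdf (\<lambda>e. t (\<lambda>n. e (h n)))"
proof -
  have "inj (\<lambda>n. case n of 0 \<Rightarrow> 0 | Suc m \<Rightarrow> Suc (h m))" (is "inj ?k")
  proof (rule injI)
    fix m n assume "?k m = ?k n"
    then show "m = n"
      by (cases m; cases n) (simp_all add: inj_eq[OF assms(2)])
  qed
  from dfn_rename[OF assms(1)[unfolded tdf_def] this] show ?thesis
    unfolding tdf_def by simp
qed

text \<open>Weakening beneath a binder: position 0 stays bound, and all later positions skip one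
  newly introduced variable.\<close>

lemma dfn_rename_under:
  assumes "dfn (\<lambda>e. P (\<lambda>n. e (Suc n)) (e 0))"
  shows "dfn (\<lambda>e. P (\<lambda>n. e (Suc (Suc n))) (e 0))"
  using dfn_rename[OF assms, of "\<lambda>n. if n = 0 then 0 else Suc n"] by (simp add: inj_def)

lemma tdf_rename_under:
  assumes "tdf (\<lambda>e. F (\<lambda>n. e (Suc n)) (e 0))"
  shows "tdf (\<lambda>e. F (\<lambda>n. e (Suc (Suc n))) (e 0))"
  using tdf_rename[OF assms, of "\<lambda>n. if n = 0 then 0 else Suc n"] by (simp add: inj_def)

lemma dfn_ex1 [dfn_intros]:
  assumes "dfn (\<lambda>e. P (\<lambda>n. e (Suc n)) (e 0))"
  shows "dfn (\<lambda>e. \<exists>!x. P e x)"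
  unfolding Ex1_def by (intro dfn_intros assms dfn_rename_under[OF assms])

section \<open>Classes that are sets\<close>

definition small :: "'a::membership set \<Rightarrow> bool" where
  "small A \<longleftrightarrow> (\<exists>a. elts a = A)"

lemma elts_inject: "elts a = elts b \<longleftrightarrow> a = (b::'a::zf)"
  using extensionality[of a b] by (auto simp: set_eq_iff)

lemma set_of_elts [simp]: "set_of (elts a) = (a::'a::zf)"
  unfolding set_of_def by (rule the_equality) (auto simp: elts_inject)

lemma elts_set_of: "small A \<Longrightarrow> elts (set_of A) = (A::'a::zf set)"
  unfolding small_def by auto

lemma mem_set_of: "small A \<Longrightarrow> x \<epsilon> set_of A \<longleftrightarrow> x \<in> (A::'a::zf set)"
  by (metis elts_set_of mem_elts)

lemma set_of_inject: "small A \<Longrightarrow> small B \<Longrightarrow> set_of A = set_of B \<longleftrightarrow> A = (B::'a::zf set)"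
  by (metis elts_set_of)

lemma smallI: "(\<And>x. x \<epsilon> a \<longleftrightarrow> x \<in> A) \<Longrightarrow> small A"
  unfolding small_def by (auto simp: set_eq_iff)

lemma small_elts [simp]: "small (elts a)"
  unfolding small_def by blast

text \<open>Proper classes do no harm here: extensionality provides the uniqueness asked for by
  \<open>tdf_The\<close>, which covers the case that no set has the given extension.\<close>

lemma tdf_set_of [dfn_intros]:
  fixes P :: "(nat \<Rightarrow> 'a::zf) \<Rightarrow> 'a \<Rightarrow> bool"
  assumes "dfn (\<lambda>e. P (\<lambda>n. e (Suc n)) (e 0))"
  shows "tdf (\<lambda>e. set_of {x. P e x})"
proof -
  have "tdf (\<lambda>e. THE a. \<forall>x. x \<epsilon> a \<longleftrightarrow> P e x)"
  proof (rule tdf_The)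
    show "dfn (\<lambda>e. \<forall>x. x \<epsilon> e 0 \<longleftrightarrow> P (\<lambda>n. e (Suc n)) x)"
      by (intro dfn_intros dfn_rename_under[OF assms])
    show "\<And>e x y. \<forall>z. z \<epsilon> x \<longleftrightarrow> P e z \<Longrightarrow> \<forall>z. z \<epsilon> y \<longleftrightarrow> P e z \<Longrightarrow> x = y"
      by (rule extensionality) blast
  qed
  moreover have "(elts a = {x. P e x}) = (\<forall>x. x \<epsilon> a \<longleftrightarrow> P e x)" for a e
    by (simp add: set_eq_iff)
  ultimately show ?thesis unfolding set_of_def by simp
qed

lemma small_Collect:
  fixes a :: "'a::zf"
  assumes "dfn (\<lambda>e. P (e 0))" "\<And>x. P x \<Longrightarrow> x \<epsilon> a"
  shows "small {x. P x}"
proof -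
  obtain b where "\<And>x. x \<epsilon> b \<longleftrightarrow> x \<epsilon> a \<and> P x"
    using separation_dfn[OF assms(1), of a] by blast
  then show ?thesis using assms(2) by (intro smallI[of b]) auto
qed

lemma small_subset:
  fixes a :: "'a::zf"
  assumes "dfn (\<lambda>e. P (e 0))"
  shows "small {x \<in> elts a. P x}"
  by (rule small_Collect[of _ a]) (intro dfn_intros assms, simp)

lemma small_image:
  fixes a :: "'a::zf"
  assumes "tdf (\<lambda>e. F (e 0))"
  shows "small {F x | x. x \<in> elts a}"
proof -
  have "dfn (\<lambda>e. e (Suc 0) = F (e 0))"
    by (intro dfn_eq tdf_var assms)
  then have "dfn (\<lambda>e. e 1 = F (e 0))" by simp
  then have "dfn (\<lambda>e. (\<lambda>x y. y = F x) (e 0) (e (Suc 0)))"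
    by simp
  from replacement_dfn[OF this, of a]
  obtain b where "\<And>y. y \<epsilon> b \<longleftrightarrow> (\<exists>x. x \<epsilon> a \<and> y = F x)" by blast
  then show ?thesis by (intro smallI[of b]) auto
qed

lemma small_empty [simp]: "small ({} :: 'a::zf set)"
proof -
  have "small {x :: 'a. False}" by (rule small_Collect) (intro dfn_intros, simp)
  then show ?thesis by simp
qed

lemma small_doubleton [simp]: "small {x, y :: 'a::zf}"
  using pairing[of x y] unfolding small_def by (auto simp: set_eq_iff)

lemma small_singleton [simp]: "small {x :: 'a::zf}"
  using small_doubleton[of x x] by simp

lemma small_Un [simp]: "small (elts a \<union> elts (b::'a::zf))"
proof -
  obtain c where "\<And>x. x \<epsilon> c \<longleftrightarrow> (\<exists>y. y \<epsilon> set_of {a, b} \<and> x \<epsilon> y)"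
    using union[of "set_of {a, b}"] by blast
  then show ?thesis by (intro smallI[of c]) (auto simp: mem_set_of)
qed

lemma small_insert [simp]: "small (insert x (elts (a::'a::zf)))"
  using small_Un[of "set_of {x}" a] by (simp add: elts_set_of)

lemma not_mem_empty [simp]: "\<not> x \<epsilon> (empty::'a::zf)"
  by (simp add: empty_def mem_set_of)

lemma empty_iff: "(a::'a::zf) = empty \<longleftrightarrow> (\<forall>x. \<not> x \<epsilon> a)"
  by (auto intro: extensionality)

lemma mem_adjoin [simp]: "x \<epsilon> adjoin a y \<longleftrightarrow> x = y \<or> x \<epsilon> (a::'a::zf)"
  by (simp add: adjoin_def mem_set_of)

lemma mem_irrefl [simp]: "\<not> (x::'a::zf) \<epsilon> x"
  using foundation[of x "set_of {x}"] by (auto simp: mem_set_of)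

lemma pair_inject [simp]: "\<langle>a, b\<rangle> = \<langle>c, d :: 'a::zf\<rangle> \<longleftrightarrow> a = c \<and> b = d"
  unfolding pair_def by (auto simp: set_of_inject doubleton_eq_iff)

lemma tdf_insert:
  assumes "tdf s" "tdf t"
  shows "tdf (\<lambda>e. set_of {s e, t e :: 'a::zf})" "tdf (\<lambda>e. set_of {s e})"
    "tdf (\<lambda>e. adjoin (s e) (t e))"
proof -
  have "tdf (\<lambda>e. set_of {x. x = s e \<or> x = t e})"
    by (intro dfn_intros tdf_shift[OF assms(1)] tdf_shift[OF assms(2)])
  moreover have "{x, y} = {z. z = x \<or> z = y}" for x y :: 'a by auto
  ultimately show "tdf (\<lambda>e. set_of {s e, t e})" by simp
  have "tdf (\<lambda>e. set_of {x. x = s e})"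
    by (intro dfn_intros tdf_shift[OF assms(1)])
  then show "tdf (\<lambda>e. set_of {s e})" by simp
  have "tdf (\<lambda>e. set_of {x. x = t e \<or> x \<epsilon> s e})"
    by (intro dfn_intros tdf_shift[OF assms(1)] tdf_shift[OF assms(2)])
  moreover have "insert y (elts a) = {x. x = y \<or> x \<epsilon> a}" for a y :: 'a
    by (simp add: set_eq_iff)
  ultimately show "tdf (\<lambda>e. adjoin (s e) (t e))"
    unfolding adjoin_def by simp
qed

lemma tdf_adjoin [dfn_intros]: "tdf s \<Longrightarrow> tdf t \<Longrightarrow> tdf (\<lambda>e. adjoin (s e) (t e :: 'a::zf))"
  by (rule tdf_insert)

lemma tdf_pair [dfn_intros]: "tdf s \<Longrightarrow> tdf t \<Longrightarrow> tdf (\<lambda>e. \<langle>s e, t e :: 'a::zf\<rangle>)"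
  unfolding pair_def by (intro tdf_insert)

lemma pfst_pair [simp]: "pfst \<langle>x, y :: 'a::zf\<rangle> = x"
  and psnd_pair [simp]: "psnd \<langle>x, y :: 'a::zf\<rangle> = y"
  by (auto simp: pfst_def psnd_def)

lemma tdf_pfst [dfn_intros]: "tdf s \<Longrightarrow> tdf (\<lambda>e. pfst (s e :: 'a::zf))"
  by (rule tdf_subst1[where F = pfst]) (unfold pfst_def, rule tdf_The, intro dfn_intros, auto)

lemma tdf_psnd [dfn_intros]: "tdf s \<Longrightarrow> tdf (\<lambda>e. psnd (s e :: 'a::zf))"
  by (rule tdf_subst1[where F = psnd]) (unfold psnd_def, rule tdf_The, intro dfn_intros, auto)

lemma small_prod: "small {\<langle>x, y\<rangle> | x y. x \<epsilon> a \<and> y \<epsilon> (b :: 'a::zf)}"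
proof -
  \<comment> \<open>The rows of the product, each of them a set by Replacement; the product is their
    union.\<close>
  define c where "c = set_of {set_of {\<langle>x, y\<rangle> | y. y \<in> elts b} | x. x \<in> elts a}"
  have "tdf (\<lambda>e. \<langle>x, e 0\<rangle>)" for x :: 'a by (intro dfn_intros)
  then have 1: "small {\<langle>x, y\<rangle> | y. y \<in> elts b}" for x :: 'a by (rule small_image)
  have "tdf (\<lambda>e. set_of {\<langle>e 0, y\<rangle> | y. y \<in> elts b})"
    by (intro dfn_intros)
  then have 2: "small {set_of {\<langle>x, y\<rangle> | y. y \<in> elts b} | x. x \<in> elts a}" by (rule small_image)
  obtain d where d: "\<And>z. z \<epsilon> d \<longleftrightarrow> (\<exists>y. y \<epsilon> c \<and> z \<epsilon> y)"
    using union[of c] by blast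
  have "z \<epsilon> d \<longleftrightarrow> (\<exists>x y. z = \<langle>x, y\<rangle> \<and> x \<epsilon> a \<and> y \<epsilon> b)" for z
    unfolding d c_def mem_set_of[OF 2] by (auto simp: mem_set_of[OF 1[unfolded mem_elts]])
  then show ?thesis by (intro smallI[of d]) auto
qed

definition times :: "'a::membership \<Rightarrow> 'a \<Rightarrow> 'a" where
  "times a b = set_of {\<langle>x, y\<rangle> | x y. x \<epsilon> a \<and> y \<epsilon> b}"

lemma mem_times: "z \<epsilon> times a b \<longleftrightarrow> (\<exists>x y. z = \<langle>x, y\<rangle> \<and> x \<epsilon> a \<and> y \<epsilon> (b :: 'a::zf))"
  by (simp add: times_def mem_set_of[OF small_prod])

lemma pair_mem_times [simp]: "\<langle>x, y\<rangle> \<epsilon> times a b \<longleftrightarrow> x \<epsilon> a \<and> y \<epsilon> (b :: 'a::zf)"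
  by (auto simp: mem_times)

definition pow :: "'a::membership \<Rightarrow> 'a" where
  "pow a = set_of {x. elts x \<subseteq> elts a}"

lemma mem_pow [simp]: "x \<epsilon> pow a \<longleftrightarrow> elts x \<subseteq> elts (a :: 'a::zf)"
proof -
  obtain c where "\<forall>x. x \<epsilon> c \<longleftrightarrow> (\<forall>y. y \<epsilon> x \<longrightarrow> y \<epsilon> a)" using power_set[of a] by (rule exE)
  then have "small {x. elts x \<subseteq> elts a}" by (intro smallI[of c]) (simp add: subset_iff)
  then show ?thesis by (simp add: pow_def mem_set_of)
qed

lemma tdf_pow [dfn_intros]: "tdf s \<Longrightarrow> tdf (\<lambda>e. pow (s e :: 'a::zf))"
  by (rule tdf_subst1) (unfold pow_def, intro dfn_intros)

text \<open>
  The function application \<open>f \<cdot> x\<close> is not definable at junk arguments, since there the unspecified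
  value of the description operator depends on the set of candidates. The total variant \<open>ap\<close> is.
\<close>

definition ap :: "'a::membership \<Rightarrow> 'a \<Rightarrow> 'a" where
  "ap f x = set_of {z. \<exists>y. (\<forall>y'. \<langle>x, y'\<rangle> \<epsilon> f \<longleftrightarrow> y' = y) \<and> z \<epsilon> y}"

lemma tdf_ap [dfn_intros]: "tdf s \<Longrightarrow> tdf t \<Longrightarrow> tdf (\<lambda>e. ap (s e) (t e :: 'a::zf))"
  by (rule tdf_subst2) (unfold ap_def, intro dfn_intros)

lemma ap_eq:
  assumes "\<And>y'. \<langle>x, y'\<rangle> \<epsilon> f \<longleftrightarrow> y' = (y :: 'a::zf)"
  shows "ap f x = y" "f \<cdot> x = y"
proof -
  have "(\<forall>y'. \<langle>x, y'\<rangle> \<epsilon> f \<longleftrightarrow> y' = z) \<longleftrightarrow> z = y" for z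
    using assms by auto
  then have "{z. \<exists>y. (\<forall>y'. \<langle>x, y'\<rangle> \<epsilon> f \<longleftrightarrow> y' = y) \<and> z \<epsilon> y} = elts y"
    by (simp add: elts_def)
  then show "ap f x = y" by (simp add: ap_def)
  show "f \<cdot> x = y" using assms by (simp add: app_def)
qed

section \<open>Functions and their total application\<close>

lemma dfn_func_on [dfn_intros]: "tdf s \<Longrightarrow> tdf t \<Longrightarrow> dfn (\<lambda>e. func_on (s e) (t e :: 'a::zf))"
  by (rule dfn_subst2) (unfold func_on_def, intro dfn_intros)

lemma func_on_mem:
  assumes "func_on f a" "x \<epsilon> (a :: 'a::zf)"
  shows "\<langle>x, y\<rangle> \<epsilon> f \<longleftrightarrow> y = ap f x"
proof -
  obtain z where z: "\<And>y'. \<langle>x, y'\<rangle> \<epsilon> f \<longleftrightarrow> y' = z"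
    using assms unfolding func_on_def by (metis mem_elts)
  from ap_eq(1)[OF z] z show ?thesis by simp
qed

lemma func_on_iff: "func_on f a \<longleftrightarrow> (\<forall>p. p \<epsilon> f \<longleftrightarrow> (\<exists>x. x \<epsilon> a \<and> p = \<langle>x, ap f x\<rangle>))"
  for a :: "'a::zf"
proof
  assume f: "func_on f a"
  show "\<forall>p. p \<epsilon> f \<longleftrightarrow> (\<exists>x. x \<epsilon> a \<and> p = \<langle>x, ap f x\<rangle>)"
  proof (intro allI iffI)
    fix p assume "p \<epsilon> f"
    moreover then obtain x y where "x \<epsilon> a" "p = \<langle>x, y\<rangle>"
      using f unfolding func_on_def by auto
    ultimately show "\<exists>x. x \<epsilon> a \<and> p = \<langle>x, ap f x\<rangle>"
      using func_on_mem[OF f] by auto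
  qed (use func_on_mem[OF f] in auto)
next
  assume "\<forall>p. p \<epsilon> f \<longleftrightarrow> (\<exists>x. x \<epsilon> a \<and> p = \<langle>x, ap f x\<rangle>)"
  then show "func_on f a" unfolding func_on_def by auto
qed

lemma app_ap: "func_on f a \<Longrightarrow> x \<epsilon> a \<Longrightarrow> f \<cdot> x = ap f (x :: 'a::zf)"
  by (rule ap_eq(2)) (rule func_on_mem)

lemma dom_eq: "func_on f a \<Longrightarrow> dom f = (a :: 'a::zf)"
proof -
  assume "func_on f a"
  then have "{x. \<exists>y. \<langle>x, y\<rangle> \<epsilon> f} = elts a" by (auto simp: func_on_iff)
  then show ?thesis by (simp add: dom_def)
qed

lemma func_ext:
  assumes "func_on f a" "func_on g a" "\<And>x. x \<epsilon> a \<Longrightarrow> ap f x = ap g (x :: 'a::zf)"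
  shows "f = g"
  by (rule extensionality) (use assms in \<open>auto simp: func_on_iff\<close>)

lemma lam_cong: "(\<And>x. x \<epsilon> a \<Longrightarrow> F x = G x) \<Longrightarrow> lam a F = lam (a :: 'a::zf) G"
  unfolding lam_def by (rule arg_cong[where f = set_of]) auto

lemma lam_mem:
  fixes a :: "'a::zf"
  assumes "tdf (\<lambda>e. F (e 0))"
  shows "p \<epsilon> lam a F \<longleftrightarrow> (\<exists>x. x \<epsilon> a \<and> p = \<langle>x, F x\<rangle>)"
proof -
  have "tdf (\<lambda>e. \<langle>e 0, F (e 0)\<rangle>)" by (intro dfn_intros assms)
  from small_image[OF this, of a] show ?thesis by (auto simp: lam_def mem_set_of)
qed

lemma
  fixes a :: "'a::zf"
  assumes "tdf (\<lambda>e. F (e 0))"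
  shows func_on_lam: "func_on (lam a F) a"
    and ap_lam: "x \<epsilon> a \<Longrightarrow> ap (lam a F) x = F x"
    and app_lam: "x \<epsilon> a \<Longrightarrow> lam a F \<cdot> x = F x"
    and dom_lam: "dom (lam a F) = a"
proof -
  show 1: "func_on (lam a F) a"
    unfolding func_on_def by (auto simp: lam_mem[OF assms])
  show 2: "ap (lam a F) x = F x" if "x \<epsilon> a" for x
    by (rule ap_eq(1)) (use that in \<open>auto simp: lam_mem[OF assms]\<close>)
  show "lam a F \<cdot> x = F x" if "x \<epsilon> a" for x
    using app_ap[OF 1] 2 that by simp
  show "dom (lam a F) = a" by (rule dom_eq[OF 1])
qed

lemma tdf_lam [dfn_intros]:
  fixes a :: "(nat \<Rightarrow> 'a::zf) \<Rightarrow> 'a"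
  assumes "tdf a" "tdf (\<lambda>e. F (\<lambda>n. e (Suc n)) (e 0))"
  shows "tdf (\<lambda>e. lam (a e) (F e))"
  unfolding lam_def
  by (intro dfn_intros tdf_rename_under[OF assms(2)] tdf_shift[OF tdf_shift[OF assms(1)]])

lemma tdf_dom [dfn_intros]: "tdf s \<Longrightarrow> tdf (\<lambda>e. dom (s e :: 'a::zf))"
  by (rule tdf_subst1) (unfold dom_def, intro dfn_intros)

text \<open>On functions with domain \<open>a\<close> both kinds of application agree, so the set
  can be described by \<open>ap\<close> and becomes a definable operation of \<open>a\<close> and
  \<open>b\<close>.\<close>

lemma exponent_eq:
  "b \<^bold>^ a = set_of {f. func_on f a \<and> (\<forall>x\<in>elts a. ap f x \<epsilon> (b :: 'a::zf))}"
proof -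
  have "{f. func_on f a \<and> (\<forall>x\<in>elts a. f \<cdot> x \<epsilon> b)} =
      {f. func_on f a \<and> (\<forall>x\<in>elts a. ap f x \<epsilon> b)}"
    by (auto simp: app_ap)
  then show ?thesis unfolding exponent_def by simp
qed

lemma mem_exponent: "f \<epsilon> b \<^bold>^ a \<longleftrightarrow> func_on f a \<and> (\<forall>x. x \<epsilon> a \<longrightarrow> ap f x \<epsilon> (b :: 'a::zf))"
proof -
  have "small {f. func_on f a \<and> (\<forall>x\<in>elts a. ap f x \<epsilon> b)}"
  proof (rule small_Collect[of _ "pow (times a b)"])
    show "dfn (\<lambda>e. func_on (e 0) a \<and> (\<forall>x\<in>elts a. ap (e 0) x \<epsilon> b))" by (intro dfn_intros)
  qed (auto simp: func_on_iff)
  then show ?thesis by (simp add: exponent_eq mem_set_of)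
qed

lemma tdf_exponent [dfn_intros]:
  "tdf s \<Longrightarrow> tdf t \<Longrightarrow> tdf (\<lambda>e. s e \<^bold>^ (t e :: 'a::zf))"
  by (rule tdf_subst2) (unfold exponent_eq, intro dfn_intros)

lemma lam_mem_exponent:
  "tdf (\<lambda>e. F (e 0)) \<Longrightarrow> (\<And>x. x \<epsilon> a \<Longrightarrow> F x \<epsilon> b) \<Longrightarrow> lam a F \<epsilon> b \<^bold>^ (a :: 'a::zf)"
  by (simp add: mem_exponent func_on_lam ap_lam)

lemma compose_eq:
  assumes "func_on f a" "func_on g b" "\<And>x. x \<epsilon> a \<Longrightarrow> ap f x \<epsilon> (b :: 'a::zf)"
  shows "g \<odot> f = lam a (\<lambda>x. ap g (ap f x))"
  unfolding compose_def dom_eq[OF assms(1)]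
  by (rule lam_cong) (use assms in \<open>simp add: app_ap\<close>)

lemma
  assumes "f \<epsilon> b \<^bold>^ a" "g \<epsilon> c \<^bold>^ (b :: 'a::zf)"
  shows compose_mem: "g \<odot> f \<epsilon> c \<^bold>^ a"
    and ap_compose: "x \<epsilon> a \<Longrightarrow> ap (g \<odot> f) x = ap g (ap f x)"
proof -
  have "tdf (\<lambda>e. ap g (ap f (e 0)))" by (intro dfn_intros)
  moreover have "g \<odot> f = lam a (\<lambda>x. ap g (ap f x))"
    using assms by (intro compose_eq[of f a g b]) (auto simp: mem_exponent)
  ultimately show "g \<odot> f \<epsilon> c \<^bold>^ a" "x \<epsilon> a \<Longrightarrow> ap (g \<odot> f) x = ap g (ap f x)"
    using assms by (auto simp: mem_exponent func_on_lam ap_lam)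
qed

section \<open>The natural numbers\<close>

text \<open>The axiom of infinity supplies one inductive set, and this bounds the intersection of
  all of them.\<close>

lemma mem_omega_iff:
  "n \<epsilon> \<omega> \<longleftrightarrow> (\<forall>w. empty \<epsilon> w \<and> (\<forall>k\<in>elts w. adjoin k k \<epsilon> w) \<longrightarrow> n \<epsilon> (w :: 'a::zf))"
proof -
  obtain w :: 'a where "\<exists>e. e \<epsilon> w \<and> (\<forall>x. \<not> x \<epsilon> e)"
    and step: "\<forall>x. x \<epsilon> w \<longrightarrow> (\<exists>y. y \<epsilon> w \<and> (\<forall>z. z \<epsilon> y \<longleftrightarrow> z \<epsilon> x \<or> z = x))"
    using infinity by blast
  then have 0: "empty \<epsilon> w" by (metis empty_iff)
  have 1: "adjoin k k \<epsilon> w" if k: "k \<epsilon> w" for k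
  proof -
    obtain y where "y \<epsilon> w" "\<forall>z. z \<epsilon> y \<longleftrightarrow> z \<epsilon> k \<or> z = k"
      using step[rule_format, OF k] by (elim exE conjE)
    then have "y = adjoin k k" by (intro extensionality) auto
    with \<open>y \<epsilon> w\<close> show ?thesis by simp
  qed
  have "small {n. \<forall>w. empty \<epsilon> w \<and> (\<forall>k\<in>elts w. adjoin k k \<epsilon> w) \<longrightarrow> n \<epsilon> (w :: 'a)}"
    by (rule small_Collect[of _ w]) (intro dfn_intros, use 0 1 in auto)
  then show ?thesis unfolding omega_def by (simp add: mem_set_of)
qed

lemma empty_omega [simp]: "(empty :: 'a::zf) \<epsilon> \<omega>"
  by (simp add: mem_omega_iff)

lemma adjoin_omega [simp]: "n \<epsilon> \<omega> \<Longrightarrow> adjoin n (n :: 'a::zf) \<epsilon> \<omega>"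
  by (auto simp: mem_omega_iff)

lemma omega_induct:
  fixes n :: "'a::zf"
  assumes "n \<epsilon> \<omega>" "dfn (\<lambda>e. P (e 0))" "P empty"
    and "\<And>k. k \<epsilon> \<omega> \<Longrightarrow> P k \<Longrightarrow> P (adjoin k k)"
  shows "P n"
proof -
  have "small {k \<in> elts \<omega>. P k}" by (rule small_subset[OF assms(2)])
  then have "k \<epsilon> set_of {k \<in> elts \<omega>. P k} \<longleftrightarrow> k \<epsilon> \<omega> \<and> P k" for k
    by (simp add: mem_set_of)
  with assms show ?thesis
    using assms(1)[unfolded mem_omega_iff, rule_format, of "set_of {k \<in> elts \<omega>. P k}"] by simp
qed

lemma omega_cases: "n \<epsilon> \<omega> \<Longrightarrow> n = empty \<or> (\<exists>k. k \<epsilon> \<omega> \<and> n = adjoin k (k :: 'a::zf))"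
  by (erule omega_induct) (intro dfn_intros, auto)

text \<open>Otherwise \<open>k\<close> and \<open>l\<close> would be elements of each other, and the
  set of the two would violate foundation.\<close>

lemma adjoin_self_inject [simp]: "adjoin k k = adjoin l l \<longleftrightarrow> k = (l :: 'a::zf)"
proof
  assume eq: "adjoin k k = adjoin l l"
  have "k \<epsilon> adjoin l l" "l \<epsilon> adjoin k k" using eq by (metis mem_adjoin)+
  show "k = l"
  proof (rule ccontr)
    assume "k \<noteq> l"
    then have kl: "k \<epsilon> l" "l \<epsilon> k" using \<open>k \<epsilon> adjoin l l\<close> \<open>l \<epsilon> adjoin k k\<close> by auto
    then show False using foundation[of k "set_of {k, l}"] by (auto simp: mem_set_of)
  qed
qed simp

lemma adjoin_not_empty [simp]: "adjoin k x \<noteq> (empty :: 'a::zf)" "empty \<noteq> adjoin k (x :: 'a::zf)"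
  by (metis mem_adjoin not_mem_empty)+

lemma numeral_omega [simp]: "(numeral_set n :: 'a::zf) \<epsilon> \<omega>"
  by (induction n) auto

lemma numeral_inject [simp]: "numeral_set m = (numeral_set n :: 'a::zf) \<longleftrightarrow> m = n"
proof (induction m arbitrary: n)
  case 0 then show ?case by (cases n) auto
next
  case (Suc m) then show ?case by (cases n) auto
qed

section \<open>Recursion and closure\<close>

lemma func_on_adjoin:
  fixes f :: "'a::zf"
  assumes f: "func_on f a" and x: "\<not> x \<epsilon> a"
  shows "func_on (adjoin f \<langle>x, y\<rangle>) (adjoin a x)"
    and "ap (adjoin f \<langle>x, y\<rangle>) x = y"
    and "z \<epsilon> a \<Longrightarrow> ap (adjoin f \<langle>x, y\<rangle>) z = ap f z"
proof -
  note mem = f[unfolded func_on_iff, rule_format]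
  show 1: "ap (adjoin f \<langle>x, y\<rangle>) x = y"
    by (rule ap_eq(1)) (use x in \<open>auto simp: mem\<close>)
  show 2: "ap (adjoin f \<langle>x, y\<rangle>) z = ap f z" if "z \<epsilon> a" for z
    by (rule ap_eq(1)) (use x that in \<open>auto simp: mem\<close>)
  show "func_on (adjoin f \<langle>x, y\<rangle>) (adjoin a x)"
    unfolding func_on_iff by (auto simp: mem 1 2)
qed

text \<open>A finite attempt at the recursion that ends with value \<open>y\<close> at
  \<open>n\<close>. Its domain is the successor of \<open>n\<close>, so that \<open>n\<close> itself
  is included.\<close>

definition approx :: "('a::zf \<Rightarrow> 'a) \<Rightarrow> 'a \<Rightarrow> 'a \<Rightarrow> 'a \<Rightarrow> bool" where
  "approx G a n y \<longleftrightarrow> (\<exists>g. func_on g (adjoin n n) \<and> ap g empty = a \<and>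
     (\<forall>k\<in>elts n. ap g (adjoin k k) = G (ap g k)) \<and> ap g n = y)"

lemma approx_0: "approx G a empty y \<longleftrightarrow> y = a"
proof -
  have "func_on (empty :: 'a) empty" by (simp add: func_on_iff)
  from func_on_adjoin(1,2)[OF this, of empty a] show ?thesis
    unfolding approx_def by auto
qed

lemma empty_mem_adjoin: "n \<epsilon> \<omega> \<Longrightarrow> (empty :: 'a::zf) \<epsilon> adjoin n n"
  by (erule omega_induct) (intro dfn_intros, auto)

lemma omega_mem_adjoin: "n \<epsilon> \<omega> \<Longrightarrow> k \<epsilon> n \<Longrightarrow> adjoin k (k :: 'a::zf) \<epsilon> adjoin n n"
proof -
  assume "n \<epsilon> \<omega>"
  then have "\<forall>k\<in>elts n. adjoin k k \<epsilon> adjoin n n"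
    by (rule omega_induct) (intro dfn_intros, auto)
  then show "k \<epsilon> n \<Longrightarrow> adjoin k k \<epsilon> adjoin n n" by simp
qed

text \<open>Attempts are shortened by restriction and prolonged by one pair, so existence and
  uniqueness of the value pass from \<open>n\<close> to its successor.\<close>

lemma approx_Suc:
  assumes n: "n \<epsilon> \<omega>"
  shows "approx G a (adjoin n n) y \<longleftrightarrow> (\<exists>z. approx G a n z \<and> y = G z)"
proof
  let ?n = "adjoin n n"
  assume "approx G a ?n y"
  then obtain g where g: "func_on g (adjoin ?n ?n)" "ap g empty = a"
    "\<And>k. k \<epsilon> ?n \<Longrightarrow> ap g (adjoin k k) = G (ap g k)" "ap g ?n = y"
    unfolding approx_def ball_elts by blast
  define h where "h = lam ?n (ap g)"
  have t: "tdf (\<lambda>e. ap g (e 0))" by (intro dfn_intros)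
  have "func_on h ?n" unfolding h_def by (rule func_on_lam[OF t])
  moreover have hg: "ap h k = ap g k" if "k \<epsilon> ?n" for k
    unfolding h_def by (rule ap_lam[OF t that])
  moreover have "ap h (adjoin k k) = G (ap h k)" if "k \<epsilon> n" for k
    using hg[OF omega_mem_adjoin[OF n that]] hg[of k] g(3)[of k] that by simp
  ultimately have "approx G a n (ap g n)"
    unfolding approx_def using hg[OF empty_mem_adjoin[OF n]] g(2)
    by (intro exI[of _ h]) (simp add: hg)
  then show "\<exists>z. approx G a n z \<and> y = G z" using g(3)[of n] g(4) by auto
next
  let ?n = "adjoin n n"
  assume "\<exists>z. approx G a n z \<and> y = G z"
  then obtain g where g: "func_on g ?n" "ap g empty = a"
    "\<And>k. k \<epsilon> n \<Longrightarrow> ap g (adjoin k k) = G (ap g k)" "y = G (ap g n)"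
    unfolding approx_def ball_elts by blast
  let ?h = "adjoin g \<langle>?n, y\<rangle>"
  note h = func_on_adjoin[OF g(1) mem_irrefl, where y = y]
  show "approx G a ?n y"
    unfolding approx_def
  proof (intro exI[of _ ?h] conjI ballI)
    show "func_on ?h (adjoin ?n ?n)" "ap ?h ?n = y" by (rule h)+
    show "ap ?h empty = a" using h(3)[OF empty_mem_adjoin[OF n]] g(2) by simp
    fix k assume "k \<in> elts ?n"
    then consider "k \<epsilon> n" | "k = n" by auto
    then show "ap ?h (adjoin k k) = G (ap ?h k)"
    proof cases
      case 1
      then show ?thesis using h(3)[OF omega_mem_adjoin[OF n 1]] h(3)[of k] g(3)[OF 1] by simp
    next
      case 2
      then show ?thesis using h(2) h(3)[of n] g(4) by simp
    qed
  qed
qed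

lemma omega_recursion:
  fixes a :: "'a::zf"
  assumes G: "tdf (\<lambda>e. G (e 0))"
  obtains f where "func_on f \<omega>" "ap f empty = a"
    "\<And>n. n \<epsilon> \<omega> \<Longrightarrow> ap f (adjoin n n) = G (ap f n)"
proof -
  have dfn: "dfn (\<lambda>e. approx G a (e 0) (e (Suc 0)))"
    unfolding approx_def by (intro dfn_intros tdf_subst1[OF G])
  have ex1: "\<exists>!y. approx G a n y" if "n \<epsilon> \<omega>" for n
    using that
  proof (rule omega_induct)
    show "dfn (\<lambda>e. \<exists>!y. approx G a (e 0) y)" by (intro dfn_intros dfn_subst2[OF dfn])
  qed (auto simp: approx_0 approx_Suc)
  \<comment> \<open>The unique value is recovered as the set of its own elements, which makes
    \<open>F\<close> a definable operation on all arguments.\<close>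
  define F where "F n = set_of {z. \<exists>y. approx G a n y \<and> z \<epsilon> y}" for n
  have F: "approx G a n y \<longleftrightarrow> y = F n" if n: "n \<epsilon> \<omega>" for n y
  proof -
    obtain y' where y': "\<And>y. approx G a n y \<longleftrightarrow> y = y'" using ex1[OF n] by auto
    then have "F n = set_of (elts y')" unfolding F_def by (simp add: elts_def)
    then show ?thesis using y' by simp
  qed
  have tF: "tdf (\<lambda>e. F (e 0))" unfolding F_def by (intro dfn_intros dfn_subst2[OF dfn])
  show ?thesis
  proof (rule that[of "lam \<omega> F"])
    show "func_on (lam \<omega> F) \<omega>" by (rule func_on_lam[OF tF])
    show "ap (lam \<omega> F) empty = a"
      using approx_0[of G a] F[of empty] by (auto simp: ap_lam[OF tF])
    show "ap (lam \<omega> F) (adjoin n n) = G (ap (lam \<omega> F) n)" if "n \<epsilon> \<omega>" for n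
      using approx_Suc[OF that, of G a] F[OF that] F[of "adjoin n n"] that
      by (auto simp: ap_lam[OF tF])
  qed
qed

text \<open>\<open>W\<close> is the union of \<omega> levels over \<open>a\<close> and \<omega>,
  each adding all subsets of the one before. The levels form a chain, so the entries and indices of
  a tuple of length in \<omega> all lie in one level; its pairs lie two levels higher and the tuple
  itself one more. Such a set bounds the syntax of a language, and later it provides the large
  classes.\<close>

lemma ex_pairing_closed:
  fixes a :: "'a::zf"
  obtains W where "\<And>x. x \<epsilon> a \<Longrightarrow> x \<epsilon> W" "\<And>x. x \<epsilon> \<omega> \<Longrightarrow> x \<epsilon> W"
    "\<And>x y. x \<epsilon> W \<Longrightarrow> y \<epsilon> W \<Longrightarrow> \<langle>x, y\<rangle> \<epsilon> W"
    "\<And>n u. n \<epsilon> \<omega> \<Longrightarrow> u \<epsilon> W \<^bold>^ n \<Longrightarrow> u \<epsilon> W"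
proof -
  define a' where "a' = set_of (elts a \<union> elts \<omega>)"
  have a': "x \<epsilon> a' \<longleftrightarrow> x \<epsilon> a \<or> x \<epsilon> \<omega>" for x by (simp add: a'_def mem_set_of)
  \<comment> \<open>The old level is kept explicitly, because \<open>a\<close> need not be
    transitive and its elements need not be subsets of it.\<close>
  define G where "G y = set_of (elts y \<union> elts (pow y))" for y :: 'a
  have G_mem: "x \<epsilon> G y \<longleftrightarrow> x \<epsilon> y \<or> elts x \<subseteq> elts y" for x y
    by (simp add: G_def mem_set_of)
  have "tdf (\<lambda>e. set_of {x. x \<epsilon> e 0 \<or> x \<epsilon> pow (e 0 :: 'a)})" by (intro dfn_intros)
  moreover have "G y = set_of {x. x \<epsilon> y \<or> x \<epsilon> pow y}" for y
    unfolding G_def by (rule arg_cong[where f = set_of]) auto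
  ultimately have G: "tdf (\<lambda>e. G (e 0))" by simp
  obtain f where f: "func_on f \<omega>" "ap f empty = a'"
    "\<And>n. n \<epsilon> \<omega> \<Longrightarrow> ap f (adjoin n n) = G (ap f n)"
    using omega_recursion[OF G] by blast
  have "tdf (\<lambda>e. ap f (e 0))" by (intro dfn_intros)
  from small_image[OF this, of \<omega>]
  obtain c where c: "\<And>y. y \<epsilon> c \<longleftrightarrow> (\<exists>n. y = ap f n \<and> n \<epsilon> \<omega>)"
    unfolding small_def by (auto simp: set_eq_iff)
  obtain W where "\<And>x. x \<epsilon> W \<longleftrightarrow> (\<exists>y. y \<epsilon> c \<and> x \<epsilon> y)" using union[of c] by blast
  then have W: "x \<epsilon> W \<longleftrightarrow> (\<exists>n. n \<epsilon> \<omega> \<and> x \<epsilon> ap f n)" for x using c by auto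
  \<comment> \<open>Any two levels are comparable. The induction on \<open>m\<close> splits
    \<open>n\<close> into zero and successor and uses that \<open>G\<close> is monotone, so the
    order of \<omega> does not enter.\<close>
  let ?Q = "\<lambda>x y. elts x \<subseteq> elts y \<or> elts y \<subseteq> elts x"
  let ?P = "\<lambda>m n. ?Q (ap f m) (ap f n)"
  have "\<forall>n\<in>elts \<omega>. ?P m n" if "m \<epsilon> \<omega>" for m
    using that
  proof (rule omega_induct)
    show "dfn (\<lambda>e. \<forall>n\<in>elts \<omega>. ?P (e 0) n)" by (intro dfn_intros)
    have "elts a' \<subseteq> elts (ap f n)" if "n \<epsilon> \<omega>" for n
      using that
    proof (rule omega_induct)
      show "dfn (\<lambda>e. elts a' \<subseteq> elts (ap f (e 0)))" by (intro dfn_intros)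
    qed (auto simp: f G_mem)
    then have base: "elts (ap f empty) \<subseteq> elts (ap f n)" if "n \<epsilon> \<omega>" for n
      using that f(2) by simp
    then show "\<forall>n\<in>elts \<omega>. ?P empty n" by simp
    fix k assume k: "k \<epsilon> \<omega>" "\<forall>n\<in>elts \<omega>. ?P k n"
    show "\<forall>n\<in>elts \<omega>. ?P (adjoin k k) n"
    proof
      fix n :: 'a assume "n \<in> elts \<omega>"
      then have "n \<epsilon> \<omega>" by simp
      from omega_cases[OF this] consider "n = empty" | m where "m \<epsilon> \<omega>" "n = adjoin m m"
        by blast
      then show "?P (adjoin k k) n"
      proof cases
        case 1
        then show ?thesis using base k(1) by simp
      next
        case 2
        moreover have "?P k m" using k 2 by simp
        moreover have "elts (G x) \<subseteq> elts (G y)" if "elts x \<subseteq> elts y" for x y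
          using that by (auto simp: G_mem)
        ultimately have "?Q (G (ap f k)) (G (ap f m))" by blast
        then show ?thesis using f(3)[OF k(1)] f(3)[OF 2(1)] 2(2) by simp
      qed
    qed
  qed
  then have dir: "?P m n" if "m \<epsilon> \<omega>" "n \<epsilon> \<omega>" for m n using that by simp
  have dir2: "\<exists>k. k \<epsilon> \<omega> \<and> x \<epsilon> ap f k \<and> y \<epsilon> ap f k" if xy: "x \<epsilon> W" "y \<epsilon> W" for x y
  proof -
    obtain m n where mn: "m \<epsilon> \<omega>" "x \<epsilon> ap f m" "n \<epsilon> \<omega>" "y \<epsilon> ap f n"
      using xy W by auto
    show ?thesis using dir[OF mn(1,3)] mn unfolding elts_subset by blast
  qed
  have up: "x \<epsilon> ap f n \<Longrightarrow> n \<epsilon> \<omega> \<Longrightarrow> x \<epsilon> ap f (adjoin n n)" for x n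
    by (simp add: f G_mem)
  have sub: "x \<epsilon> ap f (adjoin n n)" if "n \<epsilon> \<omega>" "elts x \<subseteq> elts (ap f n)" for x n
    using that by (simp add: f G_mem)
  have pair_up: "\<langle>x, y\<rangle> \<epsilon> ap f (adjoin (adjoin n n) (adjoin n n))"
    if "n \<epsilon> \<omega>" "x \<epsilon> ap f n" "y \<epsilon> ap f n" for x y n
  proof -
    have "set_of {x} \<epsilon> ap f (adjoin n n)" "set_of {x, y} \<epsilon> ap f (adjoin n n)"
      using that by (auto intro!: sub simp: elts_set_of)
    then show ?thesis unfolding pair_def
      using that by (intro sub) (auto simp: elts_set_of)
  qed
  show ?thesis
  proof (rule that[of W])
    show "x \<epsilon> W" if "x \<epsilon> a" for x
      unfolding W by (rule exI[of _ empty]) (simp add: f a' that)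
    show omW: "x \<epsilon> W" if "x \<epsilon> \<omega>" for x
      unfolding W by (rule exI[of _ empty]) (simp add: f a' that)
    show "\<langle>x, y\<rangle> \<epsilon> W" if "x \<epsilon> W" "y \<epsilon> W" for x y
      using dir2[OF that] pair_up W by (meson adjoin_omega)
    fix n u assume n: "n \<epsilon> \<omega>" and u: "u \<epsilon> W \<^bold>^ n"
    \<comment> \<open>The tuple \<open>u\<close> stays fixed and the induction runs over its initial
      segments. The indices \<open>k\<close> are included because they occur in the pairs that make
      up \<open>u\<close>.\<close>
    have "(\<forall>k\<in>elts n. ap u k \<epsilon> W) \<longrightarrow>
      (\<exists>m\<in>elts \<omega>. \<forall>k\<in>elts n. k \<epsilon> ap f m \<and> ap u k \<epsilon> ap f m)"
      using n
    proof (rule omega_induct)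
      show "dfn (\<lambda>e. (\<forall>k\<in>elts (e 0). ap u k \<epsilon> W) \<longrightarrow>
        (\<exists>m\<in>elts \<omega>. \<forall>k\<in>elts (e 0). k \<epsilon> ap f m \<and> ap u k \<epsilon> ap f m))"
        by (intro dfn_intros)
      show "(\<forall>k\<in>elts empty. ap u k \<epsilon> W) \<longrightarrow>
        (\<exists>m\<in>elts \<omega>. \<forall>k\<in>elts empty. k \<epsilon> ap f m \<and> ap u k \<epsilon> ap f m)"
        by (auto intro: empty_omega)
      fix n :: 'a assume n: "n \<epsilon> \<omega>" and IH: "(\<forall>k\<in>elts n. ap u k \<epsilon> W) \<longrightarrow>
        (\<exists>m\<in>elts \<omega>. \<forall>k\<in>elts n. k \<epsilon> ap f m \<and> ap u k \<epsilon> ap f m)"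
      show "(\<forall>k\<in>elts (adjoin n n). ap u k \<epsilon> W) \<longrightarrow>
        (\<exists>m\<in>elts \<omega>. \<forall>k\<in>elts (adjoin n n). k \<epsilon> ap f m \<and> ap u k \<epsilon> ap f m)"
      proof
        assume "\<forall>k\<in>elts (adjoin n n). ap u k \<epsilon> W"
        then obtain m where m: "m \<epsilon> \<omega>" "\<And>k. k \<epsilon> n \<Longrightarrow> k \<epsilon> ap f m \<and> ap u k \<epsilon> ap f m"
          and "ap u n \<epsilon> W" using IH by auto
        then obtain l where l: "l \<epsilon> \<omega>" "n \<epsilon> ap f l" "ap u n \<epsilon> ap f l"
          using dir2 omW[OF n] by blast
        obtain j where "j \<epsilon> \<omega>" "elts (ap f m) \<subseteq> elts (ap f j)" "elts (ap f l) \<subseteq> elts (ap f j)"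
          using dir[OF m(1) l(1)] m(1) l(1) by blast
        then have "\<forall>k\<in>elts (adjoin n n). k \<epsilon> ap f j \<and> ap u k \<epsilon> ap f j"
          using m l by auto
        then show "\<exists>m\<in>elts \<omega>. \<forall>k\<in>elts (adjoin n n). k \<epsilon> ap f m \<and> ap u k \<epsilon> ap f m"
          using \<open>j \<epsilon> \<omega>\<close> unfolding bex_elts by blast
      qed
    qed
    then obtain m where m: "m \<epsilon> \<omega>" "\<And>k. k \<epsilon> n \<Longrightarrow> k \<epsilon> ap f m \<and> ap u k \<epsilon> ap f m"
      using u by (auto simp: mem_exponent)
    let ?m = "adjoin (adjoin m m) (adjoin m m)"
    have "elts u \<subseteq> elts (ap f ?m)"
    proof
      fix p assume "p \<in> elts u"
      then obtain k where "k \<epsilon> n" "p = \<langle>k, ap u k\<rangle>"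
        using u by (auto simp: mem_exponent func_on_iff)
      then show "p \<in> elts (ap f ?m)" using pair_up m by simp
    qed
    from sub[OF _ this] show "u \<epsilon> W" unfolding W using m(1) by (meson adjoin_omega)
  qed
qed

text \<open>Knaster-Tarski inside the model: \<open>T\<close> is the intersection of all subsets of
  \<open>B\<close> that are closed under the operator. The bound turns the intersection into a set,
  and definability allows Separation to form it.\<close>

lemma ex_lfp:
  fixes B :: "'a::zf"
  assumes dfn: "dfn (\<lambda>e. \<Phi> (e 0) (e (Suc 0)))"
    and mono: "\<And>S T x. elts S \<subseteq> elts T \<Longrightarrow> \<Phi> S x \<Longrightarrow> \<Phi> T x"
    and bound: "\<And>S x. elts S \<subseteq> elts B \<Longrightarrow> \<Phi> S x \<Longrightarrow> x \<epsilon> B"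
  obtains T where "\<And>x. x \<epsilon> T \<longleftrightarrow> \<Phi> T x" "elts T \<subseteq> elts B"
proof -
  let ?Q = "\<lambda>x. x \<epsilon> B \<and> (\<forall>S. elts S \<subseteq> elts B \<and> (\<forall>y. \<Phi> S y \<longrightarrow> y \<epsilon> S) \<longrightarrow> x \<epsilon> S)"
  have "dfn (\<lambda>e. ?Q (e 0))" by (intro dfn_intros dfn_subst2[OF dfn])
  from separation_dfn[OF this, of B]
  obtain T where T: "\<And>x. x \<epsilon> T \<longleftrightarrow> ?Q x" by blast
  have TB: "elts T \<subseteq> elts B" using T by auto
  have pre: "x \<epsilon> T" if x: "\<Phi> T x" for x
    unfolding T
  proof (intro conjI allI impI)
    show "x \<epsilon> B" by (rule bound[OF TB x])
    fix S assume S: "elts S \<subseteq> elts B \<and> (\<forall>y. \<Phi> S y \<longrightarrow> y \<epsilon> S)"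
    then have "elts T \<subseteq> elts S" using T by auto
    from mono[OF this x] show "x \<epsilon> S" using S by blast
  qed
  have post: "\<Phi> T x" if x: "x \<epsilon> T" for x
  proof -
    \<comment> \<open>The part of \<open>T\<close> that is generated from \<open>T\<close> is again
      closed under the operator, hence all of \<open>T\<close> by leastness.\<close>
    have "dfn (\<lambda>e. \<Phi> T (e 0))" by (intro dfn_subst2[OF dfn] dfn_intros)
    from separation_dfn[OF this, of T]
    obtain S where S: "\<And>x. x \<epsilon> S \<longleftrightarrow> x \<epsilon> T \<and> \<Phi> T x" by blast
    then have "elts S \<subseteq> elts T" by auto
    then have "\<forall>y. \<Phi> S y \<longrightarrow> y \<epsilon> S" using S mono pre by blast
    moreover have "elts S \<subseteq> elts B" using S TB by auto
    ultimately have "x \<epsilon> S" using x T by blast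
    then show ?thesis using S by blast
  qed
  show ?thesis using that[of T] TB pre post by blast
qed

lemma exponentD:
  assumes "f \<epsilon> b \<^bold>^ (a :: 'a::zf)"
  shows exponent_func: "func_on f a" and exponent_dom: "dom f = a"
    and exponent_ap: "x \<epsilon> a \<Longrightarrow> ap f x \<epsilon> b" and exponent_app: "x \<epsilon> a \<Longrightarrow> f \<cdot> x = ap f x"
  using assms by (auto simp: mem_exponent intro: dom_eq app_ap)

section \<open>Terms and their values\<close>

lemma tdf_codes [dfn_intros]:
  "tdf s \<Longrightarrow> tdf (\<lambda>e. tm_var (s e :: 'a::zf))"
  "tdf s \<Longrightarrow> tdf t \<Longrightarrow> tdf (\<lambda>e. tm_app (s e) (t e :: 'a::zf))"
  "tdf s \<Longrightarrow> tdf t \<Longrightarrow> tdf (\<lambda>e. fm_eq (s e) (t e :: 'a::zf))"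
  "tdf s \<Longrightarrow> tdf t \<Longrightarrow> tdf (\<lambda>e. fm_rel (s e) (t e :: 'a::zf))"
  "tdf s \<Longrightarrow> tdf (\<lambda>e. fm_neg (s e :: 'a::zf))"
  "tdf s \<Longrightarrow> tdf t \<Longrightarrow> tdf (\<lambda>e. fm_and (s e) (t e :: 'a::zf))"
  "tdf s \<Longrightarrow> tdf t \<Longrightarrow> tdf (\<lambda>e. fm_ex (s e) (t e :: 'a::zf))"
  "tdf s \<Longrightarrow> tdf t \<Longrightarrow> tdf (\<lambda>e. fm_all (s e) (t e :: 'a::zf))"
  unfolding tm_var_def tm_app_def fm_eq_def fm_rel_def fm_neg_def fm_and_def fm_ex_def fm_all_def
  by (intro dfn_intros; assumption)+

lemma tm_inject [simp]:
  "tm_var x = tm_var (y :: 'a::zf) \<longleftrightarrow> x = y"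
  "tm_app F t = tm_app G (u :: 'a::zf) \<longleftrightarrow> F = G \<and> t = u"
  "tm_var x \<noteq> tm_app G (u :: 'a::zf)" "tm_app G (u :: 'a::zf) \<noteq> tm_var x"
  by (auto simp: tm_var_def tm_app_def simp del: numeral_set.simps)

lemma fm_inject [simp]:
  "fm_eq t u = fm_eq t' (u' :: 'a::zf) \<longleftrightarrow> t = t' \<and> u = u'"
  "fm_rel R u = fm_rel R' (u' :: 'a::zf) \<longleftrightarrow> R = R' \<and> u = u'"
  "fm_neg p = fm_neg (p' :: 'a::zf) \<longleftrightarrow> p = p'"
  "fm_and p q = fm_and p' (q' :: 'a::zf) \<longleftrightarrow> p = p' \<and> q = q'"
  "fm_ex x p = fm_ex x' (p' :: 'a::zf) \<longleftrightarrow> x = x' \<and> p = p'"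
  "fm_all x p = fm_all x' (p' :: 'a::zf) \<longleftrightarrow> x = x' \<and> p = p'"
  by (auto simp: fm_eq_def fm_rel_def fm_neg_def fm_and_def fm_ex_def fm_all_def
      simp del: numeral_set.simps)

lemma fm_distinct:
  fixes a b a' b' :: "'a::zf"
  shows "fm_eq a b \<noteq> fm_rel a' b'" "fm_eq a b \<noteq> fm_neg a'" "fm_eq a b \<noteq> fm_and a' b'"
    "fm_eq a b \<noteq> fm_ex a' b'" "fm_eq a b \<noteq> fm_all a' b'"
    "fm_rel a b \<noteq> fm_neg a'" "fm_rel a b \<noteq> fm_and a' b'"
    "fm_rel a b \<noteq> fm_ex a' b'" "fm_rel a b \<noteq> fm_all a' b'"
    "fm_neg a \<noteq> fm_and a' b'" "fm_neg a \<noteq> fm_ex a' b'" "fm_neg a \<noteq> fm_all a' b'"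
    "fm_and a b \<noteq> fm_ex a' b'" "fm_and a b \<noteq> fm_all a' b'" "fm_ex a b \<noteq> fm_all a' b'"
  by (auto simp: fm_eq_def fm_rel_def fm_neg_def fm_and_def fm_ex_def fm_all_def
      simp del: numeral_set.simps)

lemmas fm_distinct' [simp] = fm_distinct fm_distinct[symmetric]

text \<open>
  Definable variants of the arities and interpretations. They agree with the original ones on the
  symbols of the language.
\<close>

definition rar :: "'a::zf \<Rightarrow> 'a \<Rightarrow> 'a" where
  "rar L R = ap (pfst L) R"

definition far :: "'a::zf \<Rightarrow> 'a \<Rightarrow> 'a" where
  "far L F = ap (psnd L) F"

definition RI :: "'a::zf \<Rightarrow> 'a \<Rightarrow> 'a" where
  "RI M R = ap (pfst (psnd M)) R"

definition FI :: "'a::zf \<Rightarrow> 'a \<Rightarrow> 'a" where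
  "FI M F = ap (psnd (psnd M)) F"

lemma tdf_interp [dfn_intros]:
  "tdf s \<Longrightarrow> tdf (\<lambda>e. rar L (s e))" "tdf s \<Longrightarrow> tdf (\<lambda>e. far L (s e))"
  "tdf s \<Longrightarrow> tdf t \<Longrightarrow> tdf (\<lambda>e. RI (s e) (t e))" "tdf s \<Longrightarrow> tdf t \<Longrightarrow> tdf (\<lambda>e. FI (s e) (t e))"
  "tdf t \<Longrightarrow> tdf (\<lambda>e. univ (t e))"
  unfolding rar_def far_def RI_def FI_def univ_def by (intro dfn_intros; assumption)+

locale lang =
  fixes L :: "'a::zf"
  assumes L: "is_language L"
begin

abbreviation "Rs \<equiv> rel_symbols L"
abbreviation "Fs \<equiv> fun_symbols L"

lemma arity_eq: "R \<epsilon> Rs \<Longrightarrow> rel_arity L R = rar L R" "F \<epsilon> Fs \<Longrightarrow> fun_arity L F = far L F"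
  using L unfolding is_language_def rel_arity_def fun_arity_def rar_def far_def
  by (auto simp: app_ap)

lemma arity_omega: "R \<epsilon> Rs \<Longrightarrow> rar L R \<epsilon> \<omega>" "F \<epsilon> Fs \<Longrightarrow> far L F \<epsilon> \<omega>"
  using L arity_eq unfolding is_language_def by auto

lemma terms_eq: "terms L X = set_of {t. \<forall>T.
     (\<forall>x\<in>elts X. tm_var x \<epsilon> T) \<and>
     (\<forall>F\<in>elts Fs. \<forall>u\<in>elts (T \<^bold>^ far L F). tm_app F u \<epsilon> T) \<longrightarrow> t \<epsilon> T}"
  unfolding terms_def by (simp add: arity_eq)

lemma tdf_terms [dfn_intros]: "tdf s \<Longrightarrow> tdf (\<lambda>e. terms L (s e))"
  by (rule tdf_subst1) (unfold terms_eq, intro dfn_intros)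

lemma pairing_closed_terms:
  assumes "\<And>x. x \<epsilon> Fs \<Longrightarrow> x \<epsilon> W" "\<And>x. x \<epsilon> \<omega> \<Longrightarrow> x \<epsilon> W"
    "\<And>x y. x \<epsilon> W \<Longrightarrow> y \<epsilon> W \<Longrightarrow> \<langle>x, y\<rangle> \<epsilon> W"
    "\<And>n u. n \<epsilon> \<omega> \<Longrightarrow> u \<epsilon> W \<^bold>^ n \<Longrightarrow> u \<epsilon> W"
  shows "x \<epsilon> W \<Longrightarrow> tm_var x \<epsilon> W" and "F \<epsilon> Fs \<Longrightarrow> u \<epsilon> W \<^bold>^ far L F \<Longrightarrow> tm_app F u \<epsilon> W"
proof -
  have num: "numeral_set n \<epsilon> W" for n by (rule assms(2)) (rule numeral_omega)
  show "x \<epsilon> W \<Longrightarrow> tm_var x \<epsilon> W" unfolding tm_var_def by (rule assms(3)[OF num])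
  show "F \<epsilon> Fs \<Longrightarrow> u \<epsilon> W \<^bold>^ far L F \<Longrightarrow> tm_app F u \<epsilon> W"
    unfolding tm_app_def by (intro assms(3) num assms(1) assms(4)[OF arity_omega(2)])
qed

text \<open>The intersection in the definition of \<open>terms\<close> is a set because at least one
  closed set exists, namely any set that contains the variables and symbols and is closed under
  pairs and finite tuples.\<close>

lemma mem_terms: "t \<epsilon> terms L X \<longleftrightarrow> (\<forall>T. (\<forall>x. x \<epsilon> X \<longrightarrow> tm_var x \<epsilon> T) \<and>
     (\<forall>F u. F \<epsilon> Fs \<longrightarrow> u \<epsilon> T \<^bold>^ far L F \<longrightarrow> tm_app F u \<epsilon> T) \<longrightarrow> t \<epsilon> T)"
proof -
  obtain W where W: "\<And>x. x \<epsilon> set_of (elts X \<union> elts Fs) \<Longrightarrow> x \<epsilon> W" "\<And>x. x \<epsilon> \<omega> \<Longrightarrow> x \<epsilon> W"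
    "\<And>x y. x \<epsilon> W \<Longrightarrow> y \<epsilon> W \<Longrightarrow> \<langle>x, y\<rangle> \<epsilon> W"
    "\<And>n u. n \<epsilon> \<omega> \<Longrightarrow> u \<epsilon> W \<^bold>^ n \<Longrightarrow> u \<epsilon> W"
    using ex_pairing_closed[of "set_of (elts X \<union> elts Fs)"] by blast
  have "x \<epsilon> Fs \<Longrightarrow> x \<epsilon> W" "x \<epsilon> X \<Longrightarrow> x \<epsilon> W" for x using W(1) by (auto simp: mem_set_of)
  note W' = pairing_closed_terms[OF this(1) W(2-4), simplified] this(2)
  have "small {t. \<forall>T.
     (\<forall>x\<in>elts X. tm_var x \<epsilon> T) \<and>
     (\<forall>F\<in>elts Fs. \<forall>u\<in>elts (T \<^bold>^ far L F). tm_app F u \<epsilon> T) \<longrightarrow> t \<epsilon> T}"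
  proof (rule small_Collect)
    show "dfn (\<lambda>e. \<forall>T. (\<forall>x\<in>elts X. tm_var x \<epsilon> T) \<and>
     (\<forall>F\<in>elts Fs. \<forall>u\<in>elts (T \<^bold>^ far L F). tm_app F u \<epsilon> T) \<longrightarrow> e 0 \<epsilon> T)"
      by (intro dfn_intros)
    fix t assume "\<forall>T. (\<forall>x\<in>elts X. tm_var x \<epsilon> T) \<and>
     (\<forall>F\<in>elts Fs. \<forall>u\<in>elts (T \<^bold>^ far L F). tm_app F u \<epsilon> T) \<longrightarrow> t \<epsilon> T"
    then show "t \<epsilon> W" using W' by simp
  qed
  then show ?thesis by (simp add: terms_eq mem_set_of)
qed

lemma terms_var: "x \<epsilon> X \<Longrightarrow> tm_var x \<epsilon> terms L X"
  unfolding mem_terms by blast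

lemma terms_app:
  assumes F: "F \<epsilon> Fs" and u: "u \<epsilon> terms L X \<^bold>^ far L F"
  shows "tm_app F u \<epsilon> terms L X"
  unfolding mem_terms
proof (intro allI impI, elim conjE)
  fix T assume T: "\<forall>x. x \<epsilon> X \<longrightarrow> tm_var x \<epsilon> T"
    "\<forall>F u. F \<epsilon> Fs \<longrightarrow> u \<epsilon> T \<^bold>^ far L F \<longrightarrow> tm_app F u \<epsilon> T"
  then have "t \<epsilon> T" if "t \<epsilon> terms L X" for t using that unfolding mem_terms by blast
  then have "u \<epsilon> T \<^bold>^ far L F" using u by (simp add: mem_exponent)
  then show "tm_app F u \<epsilon> T" using T F by blast
qed

lemma terms_induct [consumes 1, case_names dfn var app]:
  assumes t: "t \<epsilon> terms L X" and dfn: "dfn (\<lambda>e. P (e 0))"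
    and var: "\<And>x. x \<epsilon> X \<Longrightarrow> P (tm_var x)"
    and app: "\<And>F u. F \<epsilon> Fs \<Longrightarrow> u \<epsilon> terms L X \<^bold>^ far L F \<Longrightarrow>
      (\<And>k. k \<epsilon> far L F \<Longrightarrow> P (ap u k)) \<Longrightarrow> P (tm_app F u)"
  shows "P t"
proof -
  obtain T where T: "\<And>t. t \<epsilon> T \<longleftrightarrow> t \<epsilon> terms L X \<and> P t"
    using separation_dfn[OF dfn, of "terms L X"] by blast
  have "t \<epsilon> T"
  proof (rule t[unfolded mem_terms, rule_format], intro conjI allI impI)
    fix F u assume "F \<epsilon> Fs" "u \<epsilon> T \<^bold>^ far L F"
    then show "tm_app F u \<epsilon> T" using app[of F u] terms_app[of F u X]
      by (simp add: T mem_exponent)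
  qed (simp add: T var terms_var)
  then show ?thesis by (simp add: T)
qed

text \<open>The description used in \<open>eval\<close>, with \<open>ap\<close> for application and
  an explicit \<open>lam\<close> for composition; in this form it is definable.\<close>

definition is_val :: "'a \<Rightarrow> 'a \<Rightarrow> 'a \<Rightarrow> bool" where
  "is_val M s e \<longleftrightarrow> func_on e (terms L (dom s)) \<and>
     (\<forall>x\<in>elts (dom s). ap e (tm_var x) = ap s x) \<and>
     (\<forall>F\<in>elts Fs. \<forall>t\<in>elts (terms L (dom s) \<^bold>^ far L F).
        ap e (tm_app F t) = ap (FI M F) (lam (far L F) (\<lambda>k. ap e (ap t k))))"

lemma dfn_is_val [dfn_intros]: "tdf s \<Longrightarrow> tdf t \<Longrightarrow> tdf u \<Longrightarrow> dfn (\<lambda>e. is_val (s e) (t e) (u e))"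
  by (rule dfn_subst3) (unfold is_val_def, intro dfn_intros)

lemma structure_facts:
  assumes "is_structure L M"
  shows univ_not_empty: "\<exists>a. a \<epsilon> univ M"
    and rel_interp_eq: "R \<epsilon> Rs \<Longrightarrow> rel_interp M R = RI M R"
    and fun_interp_eq: "F \<epsilon> Fs \<Longrightarrow> fun_interp M F = FI M F"
    and FI_mem: "F \<epsilon> Fs \<Longrightarrow> FI M F \<epsilon> univ M \<^bold>^ (univ M \<^bold>^ far L F)"
proof -
  obtain A r f where M: "M = \<langle>A, \<langle>r, f\<rangle>\<rangle>" "A \<noteq> empty" "func_on r Rs" "func_on f Fs"
    using assms unfolding is_structure_def by blast
  show "\<exists>a. a \<epsilon> univ M" using M by (auto simp: univ_def empty_iff)
  show 1: "rel_interp M R = RI M R" if "R \<epsilon> Rs" for R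
    using M that by (simp add: rel_interp_def RI_def app_ap)
  show 2: "fun_interp M F = FI M F" if "F \<epsilon> Fs" for F
    using M that by (simp add: fun_interp_def FI_def app_ap)
  show "F \<epsilon> Fs \<Longrightarrow> FI M F \<epsilon> univ M \<^bold>^ (univ M \<^bold>^ far L F)"
    using assms 1 2 unfolding is_structure_def by (auto simp: arity_eq)
qed

text \<open>Recursion on terms. The graph of the evaluation is a fixed point of the operator that
  pairs a compound term with the value of its function symbol as soon as all arguments are paired
  with values. By the injectivity of the codes only one clause applies to each term, and induction
  on terms shows that the value exists and is unique.\<close>

lemma ex_is_val:
  assumes M: "is_structure L M" and s: "s \<epsilon> univ M \<^bold>^ X"
  obtains e where "is_val M s e" "e \<epsilon> univ M \<^bold>^ terms L X"
proof -
  let ?A = "univ M" and ?T = "terms L X"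
  define \<Phi> where "\<Phi> S q \<longleftrightarrow> (\<exists>x. x \<epsilon> X \<and> q = \<langle>tm_var x, ap s x\<rangle>) \<or>
    (\<exists>F u v. F \<epsilon> Fs \<and> u \<epsilon> ?T \<^bold>^ far L F \<and> v \<epsilon> ?A \<^bold>^ far L F \<and>
      (\<forall>k\<in>elts (far L F). \<langle>ap u k, ap v k\<rangle> \<epsilon> S) \<and> q = \<langle>tm_app F u, ap (FI M F) v\<rangle>)" for S q
  have "dfn (\<lambda>e. \<Phi> (e 0) (e (Suc 0)))" unfolding \<Phi>_def by (intro dfn_intros)
  moreover have "\<Phi> S' q" if "elts S \<subseteq> elts S'" "\<Phi> S q" for S S' q
    using that unfolding \<Phi>_def ball_elts elts_subset by blast
  moreover have "q \<epsilon> times ?T ?A" if "\<Phi> S q" for S q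
    using that exponent_ap[OF s] terms_var terms_app exponent_ap[OF FI_mem[OF M]]
    unfolding \<Phi>_def by (elim disjE exE conjE) simp_all
  ultimately obtain e where e: "\<And>q. q \<epsilon> e \<longleftrightarrow> \<Phi> e q" and "elts e \<subseteq> elts (times ?T ?A)"
    using ex_lfp[of \<Phi> "times ?T ?A"] by blast
  then have sub: "q \<epsilon> e \<Longrightarrow> \<exists>t a. q = \<langle>t, a\<rangle> \<and> t \<epsilon> ?T \<and> a \<epsilon> ?A" for q
    by (auto simp: mem_times)
  have sub2: "t \<epsilon> ?T" "a \<epsilon> ?A" if "\<langle>t, a\<rangle> \<epsilon> e" for t a
    using sub[OF that] by simp_all
  have e_var: "\<langle>tm_var x, a\<rangle> \<epsilon> e \<longleftrightarrow> a = ap s x" if "x \<epsilon> X" for x a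
    by (subst e, unfold \<Phi>_def) (use that in auto)
  have e_app: "\<langle>tm_app F u, a\<rangle> \<epsilon> e \<longleftrightarrow> u \<epsilon> ?T \<^bold>^ far L F \<and> (\<exists>v. v \<epsilon> ?A \<^bold>^ far L F \<and>
      (\<forall>k. k \<epsilon> far L F \<longrightarrow> \<langle>ap u k, ap v k\<rangle> \<epsilon> e) \<and> a = ap (FI M F) v)" if "F \<epsilon> Fs" for F u a
    by (subst e, unfold \<Phi>_def) (use that in auto)
  have key: "\<langle>tm_app F u, a\<rangle> \<epsilon> e \<longleftrightarrow> a = ap (FI M F) (lam (far L F) (\<lambda>k. ap e (ap u k)))"
    if F: "F \<epsilon> Fs" and u: "u \<epsilon> ?T \<^bold>^ far L F"
      and IH: "\<And>k. k \<epsilon> far L F \<Longrightarrow> \<exists>!b. \<langle>ap u k, b\<rangle> \<epsilon> e" for F u a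
  proof -
    have iff: "\<langle>ap u k, b\<rangle> \<epsilon> e \<longleftrightarrow> b = ap e (ap u k)" if "k \<epsilon> far L F" for k b
    proof -
      have "\<exists>c. \<forall>b. \<langle>ap u k, b\<rangle> \<epsilon> e \<longleftrightarrow> b = c" using IH[OF that] by metis
      then obtain c where "\<And>b. \<langle>ap u k, b\<rangle> \<epsilon> e \<longleftrightarrow> b = c" by blast
      then show ?thesis using ap_eq(1) by metis
    qed
    \<comment> \<open>Since the arguments have unique values by hypothesis, the tuple of values is
      defined rather than chosen.\<close>
    let ?v = "lam (far L F) (\<lambda>k. ap e (ap u k))"
    have t: "tdf (\<lambda>n. ap e (ap u (n 0)))" by (intro dfn_intros)
    have v: "?v \<epsilon> ?A \<^bold>^ far L F"
    proof (rule lam_mem_exponent[OF t])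
      show "ap e (ap u k) \<epsilon> ?A" if "k \<epsilon> far L F" for k
        using iff[OF that, of "ap e (ap u k)"] sub2 by blast
    qed
    show ?thesis
    proof
      assume "\<langle>tm_app F u, a\<rangle> \<epsilon> e"
      then obtain v where v': "v \<epsilon> ?A \<^bold>^ far L F" "a = ap (FI M F) v"
        "\<And>k. k \<epsilon> far L F \<Longrightarrow> \<langle>ap u k, ap v k\<rangle> \<epsilon> e" unfolding e_app[OF F] by blast
      have "v = ?v"
        by (rule func_ext[of _ "far L F"]) (use v' v iff in \<open>auto simp: mem_exponent ap_lam[OF t]\<close>)
      then show "a = ap (FI M F) ?v" using v'(2) by simp
    next
      assume "a = ap (FI M F) ?v"
      then show "\<langle>tm_app F u, a\<rangle> \<epsilon> e"
        unfolding e_app[OF F] using u v iff by (intro conjI exI[of _ ?v]) (auto simp: ap_lam[OF t])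
    qed
  qed
  have ex1: "\<exists>!a. \<langle>t, a\<rangle> \<epsilon> e" if "t \<epsilon> ?T" for t
    using that
  proof (induction rule: terms_induct)
    case dfn
    show ?case by (intro dfn_intros)
  next
    case (var x)
    then show ?case by (simp add: e_var)
  next
    case (app F u)
    then show ?case by (simp add: key)
  qed
  have e_func: "func_on e ?T"
    unfolding func_on_def using sub ex1 unfolding ball_elts mem_elts by blast
  have e_ap: "a = ap e t" if "\<langle>t, a\<rangle> \<epsilon> e" for t a
    using that sub2 func_on_mem[OF e_func] by blast
  have "e \<epsilon> ?A \<^bold>^ ?T"
    using e_func sub2 func_on_mem[OF e_func] unfolding mem_exponent by blast
  moreover have "is_val M s e"
    unfolding is_val_def
  proof (intro conjI)
    have X: "dom s = X" using s by (auto simp: mem_exponent intro: dom_eq)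
    show "func_on e (terms L (dom s))" using e_func X by simp
    show "\<forall>x\<in>elts (dom s). ap e (tm_var x) = ap s x"
      using e_var e_ap X by (metis mem_elts)
    show "\<forall>F\<in>elts Fs. \<forall>t\<in>elts (terms L (dom s) \<^bold>^ far L F).
        ap e (tm_app F t) = ap (FI M F) (lam (far L F) (\<lambda>k. ap e (ap t k)))"
    proof (intro ballI)
      fix F u assume "F \<in> elts Fs" "u \<in> elts (terms L (dom s) \<^bold>^ far L F)"
      then show "ap e (tm_app F u) = ap (FI M F) (lam (far L F) (\<lambda>k. ap e (ap u k)))"
        using X ex1 by (intro e_ap[symmetric] iffD2[OF key]) (auto simp: mem_exponent)
    qed
  qed
  ultimately show ?thesis using that by blast
qed

lemma is_val_unique:
  assumes "is_val M s e" "is_val M s e'"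
  shows "e = e'"
proof (rule func_ext)
  show "func_on e (terms L (dom s))" "func_on e' (terms L (dom s))"
    using assms by (auto simp: is_val_def)
  show "ap e t = ap e' t" if "t \<epsilon> terms L (dom s)" for t
    using that
  proof (induction rule: terms_induct)
    case dfn
    show ?case by (intro dfn_intros)
  next
    case (var x)
    then show ?case using assms by (simp add: is_val_def)
  next
    case (app F u)
    then have "lam (far L F) (\<lambda>k. ap e (ap u k)) = lam (far L F) (\<lambda>k. ap e' (ap u k))"
      by (intro lam_cong)
    then show ?case using app assms by (simp add: is_val_def)
  qed
qed

lemma eval_spec:
  assumes M: "is_structure L M" and s: "s \<epsilon> univ M \<^bold>^ X"
  shows is_val_eval: "is_val M s (eval L M s)"
    and eval_mem: "eval L M s \<epsilon> univ M \<^bold>^ terms L X"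
proof -
  let ?T = "terms L X"
  obtain e where e: "is_val M s e" "e \<epsilon> univ M \<^bold>^ ?T" by (rule ex_is_val[OF M s])
  have X: "dom s = X" "func_on s X" using s by (auto simp: mem_exponent intro: dom_eq)
  define Q where "Q e \<longleftrightarrow> func_on e ?T \<and>
     (\<forall>x\<in>elts X. e \<cdot> tm_var x = s \<cdot> x) \<and>
     (\<forall>F\<in>elts Fs. \<forall>t\<in>elts (?T \<^bold>^ fun_arity L F).
        e \<cdot> tm_app F t = fun_interp M F \<cdot> (e \<odot> t))" for e
  have comp: "e' \<odot> u = lam (far L F) (\<lambda>k. ap e' (ap u k))"
    if "func_on e' ?T" "u \<epsilon> ?T \<^bold>^ far L F" for e' u F
    using that by (intro compose_eq) (auto simp: mem_exponent)
  have comp_mem: "e \<odot> u \<epsilon> univ M \<^bold>^ far L F" if "u \<epsilon> ?T \<^bold>^ far L F" for u F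
    using compose_mem[OF that e(2)] .
  have ef: "func_on e ?T" using e by (simp add: mem_exponent)
  have FI_ap: "fun_interp M F \<cdot> (e \<odot> u) = ap (FI M F) (e \<odot> u)"
    if "F \<epsilon> Fs" "u \<epsilon> ?T \<^bold>^ far L F" for F u
    using that FI_mem[OF M that(1)] comp_mem[OF that(2)] fun_interp_eq[OF M that(1)]
    by (auto simp: mem_exponent[of "FI M F"] intro: app_ap)
  have Qe: "Q e"
    unfolding Q_def
    using e(1) ef X FI_ap comp[OF ef]
    by (auto simp: is_val_def arity_eq app_ap terms_var terms_app)
  \<comment> \<open>The description itself uses application with junk values. The induction is
    therefore run on an equation between \<open>ap\<close> terms, with \<open>e\<close> and
    \<open>e'\<close> as parameters.\<close>
  moreover have "e' = e" if Q: "Q e'" for e'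
  proof (rule func_ext)
    show e': "func_on e' ?T" "func_on e ?T" using Q ef by (auto simp: Q_def)
    show "ap e' t = ap e t" if "t \<epsilon> ?T" for t
      using that
    proof (induction rule: terms_induct)
      case dfn
      show ?case by (intro dfn_intros)
    next
      case (var x)
      then show ?case using Q Qe e' by (simp add: Q_def app_ap terms_var)
    next
      case (app F u)
      then have "lam (far L F) (\<lambda>k. ap e' (ap u k)) = lam (far L F) (\<lambda>k. ap e (ap u k))"
        by (intro lam_cong)
      then have "e' \<odot> u = e \<odot> u" using comp app e' by simp
      then show ?case using app Q Qe e' by (simp add: Q_def app_ap terms_app arity_eq)
    qed
  qed
  ultimately have "(THE e. Q e) = e" by (intro the_equality)
  then have "eval L M s = e" unfolding eval_def Q_def X by simp
  then show "is_val M s (eval L M s)" "eval L M s \<epsilon> univ M \<^bold>^ ?T" using e by auto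
qed

text \<open>A definable version of \<open>eval L M s \<cdot> t\<close>, total in all arguments.\<close>

definition val :: "'a \<Rightarrow> 'a \<Rightarrow> 'a \<Rightarrow> 'a" where
  "val M s t = set_of {z. \<exists>e. is_val M s e \<and> z \<epsilon> ap e t}"

lemma tdf_val [dfn_intros]: "tdf s \<Longrightarrow> tdf t \<Longrightarrow> tdf u \<Longrightarrow> tdf (\<lambda>e. val (s e) (t e) (u e))"
  unfolding val_def by (intro dfn_intros; erule tdf_shift[OF tdf_shift])

context
  fixes M s X
  assumes M: "is_structure L M" and s: "s \<epsilon> univ M \<^bold>^ X"
begin

lemma val_eval: "val M s t = ap (eval L M s) t"
proof -
  have "{z. \<exists>e. is_val M s e \<and> z \<epsilon> ap e t} = elts (ap (eval L M s) t)"
    using is_val_unique is_val_eval[OF M s] by (auto simp: elts_def)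
  then show ?thesis by (simp add: val_def)
qed

lemma eval_app: "t \<epsilon> terms L X \<Longrightarrow> eval L M s \<cdot> t = val M s t"
  using eval_mem[OF M s] by (auto simp: val_eval mem_exponent intro: app_ap)

lemma val_mem: "t \<epsilon> terms L X \<Longrightarrow> val M s t \<epsilon> univ M"
  using eval_mem[OF M s] by (simp add: val_eval mem_exponent)

lemma eval_compose: "u \<epsilon> terms L X \<^bold>^ n \<Longrightarrow> eval L M s \<odot> u = lam n (\<lambda>k. val M s (ap u k))"
  using eval_mem[OF M s] unfolding val_eval by (intro compose_eq) (auto simp: mem_exponent)

lemma val_var: "x \<epsilon> X \<Longrightarrow> val M s (tm_var x) = ap s x"
  using is_val_eval[OF M s] exponent_dom[OF s] by (simp add: val_eval is_val_def)

lemma val_app: "F \<epsilon> Fs \<Longrightarrow> u \<epsilon> terms L X \<^bold>^ far L F \<Longrightarrow>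
    val M s (tm_app F u) = ap (FI M F) (lam (far L F) (\<lambda>k. val M s (ap u k)))"
  using is_val_eval[OF M s] exponent_dom[OF s] by (simp add: val_eval is_val_def)

end

end

section \<open>Formulas and satisfaction\<close>

declare numeral_set.simps [simp del]

text \<open>The definable variant of \<open>update\<close>; the two agree on assignments.\<close>

definition upd :: "'a::zf \<Rightarrow> 'a \<Rightarrow> 'a \<Rightarrow> 'a" where
  "upd s x a = lam (adjoin (dom s) x) (\<lambda>y. if y = x then a else ap s y)"

lemma tdf_upd [dfn_intros]:
  "tdf s \<Longrightarrow> tdf t \<Longrightarrow> tdf u \<Longrightarrow> tdf (\<lambda>e. upd (s e) (t e) (u e))"
  unfolding upd_def by (intro dfn_intros; (assumption | erule tdf_shift))

lemma
  assumes s: "s \<epsilon> A \<^bold>^ (X :: 'a::zf)"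
  shows update_eq: "update s x a = upd s x a"
    and upd_mem: "a \<epsilon> A \<Longrightarrow> upd s x a \<epsilon> A \<^bold>^ adjoin X x"
    and ap_upd: "y = x \<or> y \<epsilon> X \<Longrightarrow> ap (upd s x a) y = (if y = x then a else ap s y)"
proof -
  have t: "tdf (\<lambda>e. if e 0 = x then a else ap s (e 0))" by (intro dfn_intros)
  show "update s x a = upd s x a"
    unfolding update_def upd_def exponent_dom[OF s]
    by (rule lam_cong) (auto simp: exponent_app[OF s])
  show "upd s x a \<epsilon> A \<^bold>^ adjoin X x" if "a \<epsilon> A"
    unfolding upd_def exponent_dom[OF s]
    by (rule lam_mem_exponent[OF t]) (use that exponent_ap[OF s] in auto)
  show "ap (upd s x a) y = (if y = x then a else ap s y)" if "y = x \<or> y \<epsilon> X"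
    unfolding upd_def exponent_dom[OF s] using that by (subst ap_lam[OF t]) auto
qed

context lang
begin

section \<open>The internal syntax of formulas\<close>

lemma is_atomic_iff: "is_atomic L X p \<longleftrightarrow>
    (\<exists>t u. t \<epsilon> terms L X \<and> u \<epsilon> terms L X \<and> p = fm_eq t u) \<or>
    (\<exists>R t. R \<epsilon> Rs \<and> t \<epsilon> terms L X \<^bold>^ rar L R \<and> p = fm_rel R t)"
  unfolding is_atomic_def bex_elts by (simp add: arity_eq cong: conj_cong)

lemma is_atomic_simps [simp]:
  "\<not> is_atomic L X (fm_neg p)" "\<not> is_atomic L X (fm_and p q)"
  "\<not> is_atomic L X (fm_ex x p)" "\<not> is_atomic L X (fm_all x p)"
  by (auto simp: is_atomic_iff)

lemma dfn_is_atomic [dfn_intros]: "tdf s \<Longrightarrow> tdf t \<Longrightarrow> dfn (\<lambda>e. is_atomic L (s e) (t e))"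
  by (rule dfn_subst2) (unfold is_atomic_iff, intro dfn_intros)

definition fm_closed :: "'a \<Rightarrow> bool" where
  "fm_closed C \<longleftrightarrow> (\<forall>Y. elts Y \<subseteq> elts \<omega> \<longrightarrow>
        (\<forall>q. is_atomic L Y q \<longrightarrow> \<langle>Y, q\<rangle> \<epsilon> C) \<and>
        (\<forall>q. \<langle>Y, q\<rangle> \<epsilon> C \<longrightarrow> \<langle>Y, fm_neg q\<rangle> \<epsilon> C) \<and>
        (\<forall>q r. \<langle>Y, q\<rangle> \<epsilon> C \<and> \<langle>Y, r\<rangle> \<epsilon> C \<longrightarrow> \<langle>Y, fm_and q r\<rangle> \<epsilon> C) \<and>
        (\<forall>x\<in>elts \<omega>. \<forall>q. \<langle>adjoin Y x, q\<rangle> \<epsilon> C \<longrightarrow>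
           \<langle>Y, fm_ex x q\<rangle> \<epsilon> C \<and> \<langle>Y, fm_all x q\<rangle> \<epsilon> C))"

lemma is_formula_iff:
  "is_formula L X p \<longleftrightarrow> elts X \<subseteq> elts \<omega> \<and> (\<forall>C. fm_closed C \<longrightarrow> \<langle>X, p\<rangle> \<epsilon> C)"
  unfolding is_formula_def fm_closed_def ..

lemma dfn_is_formula [dfn_intros]: "tdf s \<Longrightarrow> tdf t \<Longrightarrow> dfn (\<lambda>e. is_formula L (s e) (t e))"
  by (rule dfn_subst2) (unfold is_formula_def, intro dfn_intros)

lemma formula_vars: "is_formula L X p \<Longrightarrow> elts X \<subseteq> elts \<omega>"
  by (simp add: is_formula_iff)

lemma formula_atomic: "elts X \<subseteq> elts \<omega> \<Longrightarrow> is_atomic L X p \<Longrightarrow> is_formula L X p"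
  unfolding is_formula_iff fm_closed_def by blast

lemma formula_neg: "is_formula L X p \<Longrightarrow> is_formula L X (fm_neg p)"
  unfolding is_formula_iff fm_closed_def by blast

lemma formula_and: "is_formula L X p \<Longrightarrow> is_formula L X q \<Longrightarrow> is_formula L X (fm_and p q)"
  unfolding is_formula_iff fm_closed_def by blast

lemma
  assumes p: "is_formula L (adjoin X x) p"
  shows formula_ex: "is_formula L X (fm_ex x p)" and formula_all: "is_formula L X (fm_all x p)"
proof -
  have x: "x \<in> elts \<omega>" and X: "elts X \<subseteq> elts \<omega>" using formula_vars[OF p] by auto
  show "is_formula L X (fm_ex x p)" "is_formula L X (fm_all x p)"
    using p X x unfolding is_formula_iff fm_closed_def by blast+
qed

text \<open>\<open>is_formula\<close> quantifies over all closed sets, so a single closed set bounds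
  the class of formulas. The product of the power set of \<omega> with a set closed under pairs and
  finite tuples is closed under all formation rules.\<close>

lemma formula_bound:
  obtains W where "\<And>X p. is_formula L X p \<Longrightarrow> p \<epsilon> W"
proof -
  obtain W where W: "\<And>x. x \<epsilon> set_of (elts Rs \<union> elts Fs) \<Longrightarrow> x \<epsilon> W"
    and W\<omega>: "\<And>x. x \<epsilon> \<omega> \<Longrightarrow> x \<epsilon> W"
    and Wp: "\<And>x y. x \<epsilon> W \<Longrightarrow> y \<epsilon> W \<Longrightarrow> \<langle>x, y\<rangle> \<epsilon> W"
    and Wt: "\<And>n u. n \<epsilon> \<omega> \<Longrightarrow> u \<epsilon> W \<^bold>^ n \<Longrightarrow> u \<epsilon> W"
    using ex_pairing_closed[of "set_of (elts Rs \<union> elts Fs)"] by blast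
  have F: "x \<epsilon> Fs \<Longrightarrow> x \<epsilon> W" and R: "x \<epsilon> Rs \<Longrightarrow> x \<epsilon> W" for x
    using W[of x] by (auto simp: mem_set_of)
  note closed = pairing_closed_terms[OF F W\<omega> Wp Wt]
  have num: "numeral_set n \<epsilon> W" for n by (rule W\<omega>) (rule numeral_omega)
  \<comment> \<open>\<open>W\<close> is itself one of the closed sets whose intersection is the set
    of terms.\<close>
  have tm: "t \<epsilon> W" if "elts Y \<subseteq> elts \<omega>" "t \<epsilon> terms L Y" for Y t
    using that(2)[unfolded mem_terms, rule_format, of W] closed that(1) W\<omega> by simp
  have code: "\<langle>numeral_set n, \<langle>x, y\<rangle>\<rangle> \<epsilon> W" if "x \<epsilon> W" "y \<epsilon> W" for n x y
    by (intro Wp num that)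
  have "fm_closed (times (pow \<omega>) W)"
    unfolding fm_closed_def pair_mem_times mem_pow mem_elts ball_elts
  proof (intro allI impI conjI; (elim conjE)?)
    fix Y q assume Y: "elts Y \<subseteq> elts \<omega>" and "is_atomic L Y q"
    then consider t u where "t \<epsilon> terms L Y" "u \<epsilon> terms L Y" "q = fm_eq t u" |
      R t where "R \<epsilon> Rs" "t \<epsilon> terms L Y \<^bold>^ rar L R" "q = fm_rel R t"
      unfolding is_atomic_iff by blast
    then show "q \<epsilon> W"
    proof cases
      case 1
      then show ?thesis using tm[OF Y] code unfolding fm_eq_def by blast
    next
      case 2
      then have "t \<epsilon> W \<^bold>^ rar L R" using tm[OF Y] by (simp add: mem_exponent)
      then have "t \<epsilon> W" by (rule Wt[OF arity_omega(1)[OF 2(1)]])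
      then show ?thesis using 2 R code unfolding fm_rel_def by blast
    qed
  qed (unfold fm_neg_def fm_and_def fm_ex_def fm_all_def, (blast intro: code Wp num W\<omega>)+)
  then have "\<langle>X, p\<rangle> \<epsilon> times (pow \<omega>) W" if "is_formula L X p" for X p
    using that unfolding is_formula_iff by blast
  then show ?thesis using that[of W] by simp
qed

lemma formula_set:
  obtains C where "\<And>X p. \<langle>X, p\<rangle> \<epsilon> C \<longleftrightarrow> is_formula L X p"
proof -
  obtain W where W: "\<And>X p. is_formula L X p \<Longrightarrow> p \<epsilon> W" using formula_bound by blast
  have "dfn (\<lambda>e. \<exists>X p. e 0 = \<langle>X, p\<rangle> \<and> is_formula L X p)" by (intro dfn_intros)
  from separation_dfn[OF this, of "times (pow \<omega>) W"]
  obtain C where "\<And>z. z \<epsilon> C \<longleftrightarrow> z \<epsilon> times (pow \<omega>) W \<and> (\<exists>X p. z = \<langle>X, p\<rangle> \<and> is_formula L X p)"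
    by blast
  then have "\<langle>X, p\<rangle> \<epsilon> C \<longleftrightarrow> is_formula L X p" for X p
    using W formula_vars by auto
  then show ?thesis using that by blast
qed

text \<open>The context is part of the induction, because the body of a quantified formula lives in
  a larger context.\<close>

lemma formula_induct [consumes 1, case_names dfn atomic neg conj ex all]:
  assumes p: "is_formula L X p" and dfn: "dfn (\<lambda>e. P (e 0) (e (Suc 0)))"
    and atomic: "\<And>X p. elts X \<subseteq> elts \<omega> \<Longrightarrow> is_atomic L X p \<Longrightarrow> P X p"
    and neg: "\<And>X p. is_formula L X p \<Longrightarrow> P X p \<Longrightarrow> P X (fm_neg p)"
    and conj: "\<And>X p q. is_formula L X p \<Longrightarrow> is_formula L X q \<Longrightarrow> P X p \<Longrightarrow> P X q \<Longrightarrow>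
      P X (fm_and p q)"
    and ex: "\<And>X x p. x \<epsilon> \<omega> \<Longrightarrow> is_formula L (adjoin X x) p \<Longrightarrow> P (adjoin X x) p \<Longrightarrow> P X (fm_ex x p)"
    and all: "\<And>X x p. x \<epsilon> \<omega> \<Longrightarrow> is_formula L (adjoin X x) p \<Longrightarrow> P (adjoin X x) p \<Longrightarrow> P X (fm_all x p)"
  shows "P X p"
proof -
  obtain C where C: "\<And>X p. \<langle>X, p\<rangle> \<epsilon> C \<longleftrightarrow> is_formula L X p" using formula_set by blast
  have "dfn (\<lambda>e. \<exists>X p. e 0 = \<langle>X, p\<rangle> \<and> P X p)" by (intro dfn_intros dfn_subst2[OF dfn])
  from separation_dfn[OF this, of C]
  obtain D where "\<And>z. z \<epsilon> D \<longleftrightarrow> z \<epsilon> C \<and> (\<exists>X p. z = \<langle>X, p\<rangle> \<and> P X p)" by blast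
  then have D: "\<langle>X, p\<rangle> \<epsilon> D \<longleftrightarrow> is_formula L X p \<and> P X p" for X p using C by auto
  have "fm_closed D"
    unfolding fm_closed_def D ball_elts mem_elts
  proof (intro allI impI conjI; (elim conjE)?)
    fix Y q assume "elts Y \<subseteq> elts \<omega>" "is_atomic L Y q"
    then show "is_formula L Y q" "P Y q" by (rule formula_atomic, rule atomic)
  qed (blast intro: neg conj ex all formula_neg formula_and formula_ex formula_all)+
  then have "\<langle>X, p\<rangle> \<epsilon> D" using p by (simp add: is_formula_iff)
  then show ?thesis by (simp add: D)
qed

lemma formula_quantifier_free:
  assumes "is_quantifier_free L X p"
  shows "is_formula L X p"
proof -
  obtain W where W: "\<And>X p. is_formula L X p \<Longrightarrow> p \<epsilon> W" using formula_bound by blast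
  have "dfn (\<lambda>e. is_formula L X (e 0))" by (intro dfn_intros)
  from separation_dfn[OF this, of W]
  obtain C where C: "\<And>p. p \<epsilon> C \<longleftrightarrow> is_formula L X p" using W by blast
  have X: "elts X \<subseteq> elts \<omega>" using assms unfolding is_quantifier_free_def by blast
  have "p \<epsilon> C"
    using assms unfolding is_quantifier_free_def C
    using C formula_atomic[OF X] formula_neg formula_and by blast
  then show ?thesis by (simp add: C)
qed

text \<open>The level of the hierarchy is an external number, so the outer induction is one of HOL;
  only the blocks of quantifiers within a level are internal.\<close>

lemma formula_Sigma_Pi:
  "(is_Sigma n L X p \<longrightarrow> is_formula L X p) \<and> (is_Pi n L X p \<longrightarrow> is_formula L X p)"
proof (induction n arbitrary: X p)
  case 0
  show ?case using formula_quantifier_free by simp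
next
  case (Suc n)
  obtain C where C: "\<And>X p. \<langle>X, p\<rangle> \<epsilon> C \<longleftrightarrow> is_formula L X p" using formula_set by blast
  have "\<langle>X, p\<rangle> \<epsilon> C" if p: "is_Sigma (Suc n) L X p" for X p
    using p unfolding is_Sigma.simps
    by (elim conjE allE[of _ C]) (use Suc C formula_ex in blast)
  moreover have "\<langle>X, p\<rangle> \<epsilon> C" if p: "is_Pi (Suc n) L X p" for X p
    using p unfolding is_Pi.simps
    by (elim conjE allE[of _ C]) (use Suc C formula_all in blast)
  ultimately show ?case unfolding C by blast
qed

section \<open>Satisfaction relations\<close>

definition sat_at :: "'a \<Rightarrow> 'a \<Rightarrow> 'a \<Rightarrow> bool" where
  "sat_at M s q \<longleftrightarrow> (\<exists>t u. q = fm_eq t u \<and> val M s t = val M s u) \<or>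
     (\<exists>R t. q = fm_rel R t \<and> lam (dom t) (\<lambda>k. val M s (ap t k)) \<epsilon> RI M R)"

lemma dfn_sat_at [dfn_intros]: "tdf s \<Longrightarrow> tdf t \<Longrightarrow> tdf u \<Longrightarrow> dfn (\<lambda>e. sat_at (s e) (t e) (u e))"
  by (rule dfn_subst3) (unfold sat_at_def, intro dfn_intros)

lemma sat_at_eq [simp]: "sat_at M s (fm_eq t u) \<longleftrightarrow> val M s t = val M s u"
  and sat_at_rel: "t \<epsilon> B \<^bold>^ n \<Longrightarrow> sat_at M s (fm_rel R t) \<longleftrightarrow> lam n (\<lambda>k. val M s (ap t k)) \<epsilon> RI M R"
  by (auto simp: sat_at_def exponent_dom)

text \<open>Tarski's clauses once more, with the atomic ones merged into \<open>sat_at\<close> and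
  all operations replaced by definable variants. Without this, satisfaction could not occur in
  comprehensions or inductions.\<close>

definition sat_rel :: "'a \<Rightarrow> 'a \<Rightarrow> bool" where
  "sat_rel M S \<longleftrightarrow> (\<forall>X s. elts X \<subseteq> elts \<omega> \<and> s \<epsilon> univ M \<^bold>^ X \<longrightarrow>
     (\<forall>p. is_atomic L X p \<longrightarrow> (\<langle>p, s\<rangle> \<epsilon> S \<longleftrightarrow> sat_at M s p)) \<and>
     (\<forall>p. is_formula L X p \<longrightarrow>
        (\<langle>fm_neg p, s\<rangle> \<epsilon> S \<longleftrightarrow> \<not> \<langle>p, s\<rangle> \<epsilon> S)) \<and>
     (\<forall>p q. is_formula L X p \<and> is_formula L X q \<longrightarrow>
        (\<langle>fm_and p q, s\<rangle> \<epsilon> S \<longleftrightarrow> \<langle>p, s\<rangle> \<epsilon> S \<and> \<langle>q, s\<rangle> \<epsilon> S)) \<and>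
     (\<forall>x\<in>elts \<omega>. \<forall>p. is_formula L (adjoin X x) p \<longrightarrow>
        (\<langle>fm_ex x p, s\<rangle> \<epsilon> S \<longleftrightarrow> (\<exists>a\<in>elts (univ M). \<langle>p, upd s x a\<rangle> \<epsilon> S)) \<and>
        (\<langle>fm_all x p, s\<rangle> \<epsilon> S \<longleftrightarrow> (\<forall>a\<in>elts (univ M). \<langle>p, upd s x a\<rangle> \<epsilon> S))))"

lemma dfn_sat_rel [dfn_intros]: "tdf s \<Longrightarrow> tdf t \<Longrightarrow> dfn (\<lambda>e. sat_rel (s e) (t e))"
  by (rule dfn_subst2) (unfold sat_rel_def, intro dfn_intros)

lemma is_satisfaction_iff:
  assumes M: "is_structure L M"
  shows "is_satisfaction L M S \<longleftrightarrow> sat_rel M S"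
proof -
  have 1: "(\<forall>t\<in>elts (terms L X). \<forall>u\<in>elts (terms L X).
        \<langle>fm_eq t u, s\<rangle> \<epsilon> S \<longleftrightarrow> eval L M s \<cdot> t = eval L M s \<cdot> u) \<and>
     (\<forall>R\<in>elts (rel_symbols L). \<forall>t\<in>elts (terms L X \<^bold>^ rel_arity L R).
        \<langle>fm_rel R t, s\<rangle> \<epsilon> S \<longleftrightarrow> (eval L M s \<odot> t) \<epsilon> rel_interp M R) \<longleftrightarrow>
     (\<forall>p. is_atomic L X p \<longrightarrow> (\<langle>p, s\<rangle> \<epsilon> S \<longleftrightarrow> sat_at M s p))"
    if s: "s \<epsilon> univ M \<^bold>^ X" for X s
  proof -
    have "(\<forall>p. is_atomic L X p \<longrightarrow> (\<langle>p, s\<rangle> \<epsilon> S \<longleftrightarrow> sat_at M s p)) \<longleftrightarrow>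
      (\<forall>t\<in>elts (terms L X). \<forall>u\<in>elts (terms L X).
        \<langle>fm_eq t u, s\<rangle> \<epsilon> S \<longleftrightarrow> sat_at M s (fm_eq t u)) \<and>
      (\<forall>R\<in>elts Rs. \<forall>t\<in>elts (terms L X \<^bold>^ rar L R). \<langle>fm_rel R t, s\<rangle> \<epsilon> S \<longleftrightarrow> sat_at M s (fm_rel R t))"
      unfolding is_atomic_iff ball_elts by blast
    also have "\<dots> \<longleftrightarrow> (\<forall>t\<in>elts (terms L X). \<forall>u\<in>elts (terms L X).
        \<langle>fm_eq t u, s\<rangle> \<epsilon> S \<longleftrightarrow> eval L M s \<cdot> t = eval L M s \<cdot> u) \<and>
      (\<forall>R\<in>elts (rel_symbols L). \<forall>t\<in>elts (terms L X \<^bold>^ rel_arity L R).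
        \<langle>fm_rel R t, s\<rangle> \<epsilon> S \<longleftrightarrow> (eval L M s \<odot> t) \<epsilon> rel_interp M R)"
      by (simp add: eval_app[OF M s] arity_eq sat_at_rel eval_compose[OF M s] rel_interp_eq[OF M])
    finally show ?thesis by simp
  qed
  have 2: "update s x a = upd s x a" if "s \<epsilon> univ M \<^bold>^ X" for X s x a
    using update_eq[OF that] .
  show ?thesis
    unfolding is_satisfaction_def sat_rel_def
  proof (intro iff_allI imp_cong refl, elim conjE)
    fix X s assume "s \<epsilon> univ M \<^bold>^ X"
    note s = 1[OF this] 2[OF this]
    show "(\<forall>t\<in>elts (terms L X). \<forall>u\<in>elts (terms L X).
        \<langle>fm_eq t u, s\<rangle> \<epsilon> S \<longleftrightarrow> eval L M s \<cdot> t = eval L M s \<cdot> u) \<and>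
     (\<forall>R\<in>elts (rel_symbols L). \<forall>t\<in>elts (terms L X \<^bold>^ rel_arity L R).
        \<langle>fm_rel R t, s\<rangle> \<epsilon> S \<longleftrightarrow> (eval L M s \<odot> t) \<epsilon> rel_interp M R) \<and> c1 \<and> c2 \<and>
     (\<forall>x\<in>elts \<omega>. \<forall>p. is_formula L (adjoin X x) p \<longrightarrow>
        (\<langle>fm_ex x p, s\<rangle> \<epsilon> S \<longleftrightarrow> (\<exists>a\<in>elts (univ M). \<langle>p, update s x a\<rangle> \<epsilon> S)) \<and>
        (\<langle>fm_all x p, s\<rangle> \<epsilon> S \<longleftrightarrow> (\<forall>a\<in>elts (univ M). \<langle>p, update s x a\<rangle> \<epsilon> S))) \<longleftrightarrow>
     (\<forall>p. is_atomic L X p \<longrightarrow> (\<langle>p, s\<rangle> \<epsilon> S \<longleftrightarrow> sat_at M s p)) \<and> c1 \<and> c2 \<and>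
     (\<forall>x\<in>elts \<omega>. \<forall>p. is_formula L (adjoin X x) p \<longrightarrow>
        (\<langle>fm_ex x p, s\<rangle> \<epsilon> S \<longleftrightarrow> (\<exists>a\<in>elts (univ M). \<langle>p, upd s x a\<rangle> \<epsilon> S)) \<and>
        (\<langle>fm_all x p, s\<rangle> \<epsilon> S \<longleftrightarrow> (\<forall>a\<in>elts (univ M). \<langle>p, upd s x a\<rangle> \<epsilon> S)))" for c1 c2
      unfolding s(1)[symmetric] s(2) conj_assoc ..
  qed
qed


lemma sat_rel_D:
  assumes "sat_rel M S" "elts X \<subseteq> elts \<omega>" "s \<epsilon> univ M \<^bold>^ X"
  shows sat_rel_atomic: "is_atomic L X p \<Longrightarrow> \<langle>p, s\<rangle> \<epsilon> S \<longleftrightarrow> sat_at M s p"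
    and sat_rel_neg: "is_formula L X p \<Longrightarrow> \<langle>fm_neg p, s\<rangle> \<epsilon> S \<longleftrightarrow> \<not> \<langle>p, s\<rangle> \<epsilon> S"
    and sat_rel_and: "is_formula L X p \<Longrightarrow> is_formula L X q \<Longrightarrow>
      \<langle>fm_and p q, s\<rangle> \<epsilon> S \<longleftrightarrow> \<langle>p, s\<rangle> \<epsilon> S \<and> \<langle>q, s\<rangle> \<epsilon> S"
    and sat_rel_ex: "x \<epsilon> \<omega> \<Longrightarrow> is_formula L (adjoin X x) p \<Longrightarrow>
      \<langle>fm_ex x p, s\<rangle> \<epsilon> S \<longleftrightarrow> (\<exists>a. a \<epsilon> univ M \<and> \<langle>p, upd s x a\<rangle> \<epsilon> S)"
    and sat_rel_all: "x \<epsilon> \<omega> \<Longrightarrow> is_formula L (adjoin X x) p \<Longrightarrow>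
      \<langle>fm_all x p, s\<rangle> \<epsilon> S \<longleftrightarrow> (\<forall>a. a \<epsilon> univ M \<longrightarrow> \<langle>p, upd s x a\<rangle> \<epsilon> S)"
proof -
  note c = assms(1)[unfolded sat_rel_def, THEN spec, THEN spec, THEN mp, OF conjI[OF assms(2,3)],
      unfolded ball_elts bex_elts]
  show "is_atomic L X p \<Longrightarrow> \<langle>p, s\<rangle> \<epsilon> S \<longleftrightarrow> sat_at M s p"
    by (rule c[THEN conjunct1, rule_format])
  show "is_formula L X p \<Longrightarrow> \<langle>fm_neg p, s\<rangle> \<epsilon> S \<longleftrightarrow> \<not> \<langle>p, s\<rangle> \<epsilon> S"
    by (rule c[THEN conjunct2, THEN conjunct1, rule_format])
  show "is_formula L X p \<Longrightarrow> is_formula L X q \<Longrightarrow>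
      \<langle>fm_and p q, s\<rangle> \<epsilon> S \<longleftrightarrow> \<langle>p, s\<rangle> \<epsilon> S \<and> \<langle>q, s\<rangle> \<epsilon> S"
    by (rule c[THEN conjunct2, THEN conjunct2, THEN conjunct1, rule_format, OF conjI])
  note d = c[THEN conjunct2, THEN conjunct2, THEN conjunct2, rule_format]
  show "x \<epsilon> \<omega> \<Longrightarrow> is_formula L (adjoin X x) p \<Longrightarrow>
      \<langle>fm_ex x p, s\<rangle> \<epsilon> S \<longleftrightarrow> (\<exists>a. a \<epsilon> univ M \<and> \<langle>p, upd s x a\<rangle> \<epsilon> S)"
    by (rule d[THEN conjunct1])
  show "x \<epsilon> \<omega> \<Longrightarrow> is_formula L (adjoin X x) p \<Longrightarrow>
      \<langle>fm_all x p, s\<rangle> \<epsilon> S \<longleftrightarrow> (\<forall>a. a \<epsilon> univ M \<longrightarrow> \<langle>p, upd s x a\<rangle> \<epsilon> S)"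
    by (rule d[THEN conjunct2])
qed

definition ext :: "'a \<Rightarrow> 'a \<Rightarrow> ('a \<Rightarrow> bool) \<Rightarrow> 'a" where
  "ext A X P = set_of {s. s \<epsilon> A \<^bold>^ X \<and> P s}"

lemma mem_ext:
  assumes "dfn (\<lambda>e. P (e 0))"
  shows "s \<epsilon> ext A X P \<longleftrightarrow> s \<epsilon> A \<^bold>^ X \<and> P s"
proof -
  have "small {s \<in> elts (A \<^bold>^ X). P s}" by (rule small_subset[OF assms])
  then show ?thesis by (simp add: ext_def mem_set_of)
qed

lemma tdf_ext [dfn_intros]:
  assumes "tdf s" "tdf t" "dfn (\<lambda>e. P (\<lambda>n. e (Suc n)) (e 0))"
  shows "tdf (\<lambda>e. ext (s e) (t e) (P e))"
  unfolding ext_def by (intro dfn_intros tdf_shift[OF assms(1)] tdf_shift[OF assms(2)] assms(3))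

text \<open>
  Satisfaction is obtained from the least relation \<open>T\<close> between formulas in context and sets of
  assignments that is closed under Tarski's clauses; it is functional by induction on formulas.
\<close>

lemma ex_sat_rel: "\<exists>S. sat_rel M S"
proof -
  let ?A = "univ M"
  obtain C where C: "\<And>X p. \<langle>X, p\<rangle> \<epsilon> C \<longleftrightarrow> is_formula L X p" using formula_set by blast
  obtain W where W: "\<And>X p. is_formula L X p \<Longrightarrow> p \<epsilon> W" using formula_bound by blast
  \<comment> \<open>Every assignment on a set of variables is a subset of the product of \<omega>
    with the universe, whatever its context. This bounds all sets of assignments at once.\<close>
  define PF where "PF = pow (times \<omega> ?A)"
  have PF: "s \<epsilon> PF" if "elts X \<subseteq> elts \<omega>" "s \<epsilon> ?A \<^bold>^ X" for X s
    using that by (auto simp: PF_def mem_exponent func_on_iff)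
  have ext_PF: "ext ?A X P \<epsilon> pow PF" if "elts X \<subseteq> elts \<omega>" "dfn (\<lambda>e. P (e 0))" for X P
    using PF[OF that(1)] by (simp add: mem_ext[OF that(2)])
  have dA: "dfn (\<lambda>e. sat_at M (e 0) q)" for q by (intro dfn_intros)
  have dN: "dfn (\<lambda>e. \<not> e 0 \<epsilon> v)" for v :: 'a by (intro dfn_intros)
  have dC: "dfn (\<lambda>e. e 0 \<epsilon> v \<and> e 0 \<epsilon> w)" for v w :: 'a by (intro dfn_intros)
  have dE: "dfn (\<lambda>e. \<exists>a\<in>elts ?A. upd (e 0) x a \<epsilon> v)" for v x by (intro dfn_intros)
  have dU: "dfn (\<lambda>e. \<forall>a\<in>elts ?A. upd (e 0) x a \<epsilon> v)" for v x by (intro dfn_intros)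
  define \<Phi> where "\<Phi> S z \<longleftrightarrow>
    (\<exists>X q. elts X \<subseteq> elts \<omega> \<and> is_atomic L X q \<and> z = \<langle>\<langle>X, q\<rangle>, ext ?A X (\<lambda>s. sat_at M s q)\<rangle>) \<or>
    (\<exists>X q v. \<langle>\<langle>X, q\<rangle>, v\<rangle> \<epsilon> S \<and> z = \<langle>\<langle>X, fm_neg q\<rangle>, ext ?A X (\<lambda>s. \<not> s \<epsilon> v)\<rangle>) \<or>
    (\<exists>X q r v w. \<langle>\<langle>X, q\<rangle>, v\<rangle> \<epsilon> S \<and> \<langle>\<langle>X, r\<rangle>, w\<rangle> \<epsilon> S \<and>
      z = \<langle>\<langle>X, fm_and q r\<rangle>, ext ?A X (\<lambda>s. s \<epsilon> v \<and> s \<epsilon> w)\<rangle>) \<or>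
    (\<exists>X x q v. \<langle>\<langle>adjoin X x, q\<rangle>, v\<rangle> \<epsilon> S \<and>
      z = \<langle>\<langle>X, fm_ex x q\<rangle>, ext ?A X (\<lambda>s. \<exists>a\<in>elts ?A. upd s x a \<epsilon> v)\<rangle>) \<or>
    (\<exists>X x q v. \<langle>\<langle>adjoin X x, q\<rangle>, v\<rangle> \<epsilon> S \<and>
      z = \<langle>\<langle>X, fm_all x q\<rangle>, ext ?A X (\<lambda>s. \<forall>a\<in>elts ?A. upd s x a \<epsilon> v)\<rangle>)" for S z
  have "dfn (\<lambda>e. \<Phi> (e 0) (e (Suc 0)))" unfolding \<Phi>_def by (intro dfn_intros)
  moreover have "\<Phi> S' q" if "elts S \<subseteq> elts S'" "\<Phi> S q" for S S' q
    using that unfolding \<Phi>_def elts_subset by blast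
  moreover have "z \<epsilon> times C (pow PF)" if S: "elts S \<subseteq> elts (times C (pow PF))" and z: "\<Phi> S z" for S z
  proof -
    have S': "is_formula L X q" if "\<langle>\<langle>X, q\<rangle>, v\<rangle> \<epsilon> S" for X q v
      using that S C by fastforce
    have sub: "elts X \<subseteq> elts \<omega>" if "is_formula L X q \<or> is_formula L (adjoin X x) q" for X q x
      using that formula_vars[of X q] formula_vars[of "adjoin X x" q] by auto
    show ?thesis
      using z unfolding \<Phi>_def
    proof (elim disjE exE conjE, goal_cases)
      case (1 X q)
      then show ?case using ext_PF[OF _ dA] C formula_atomic by (simp del: mem_pow elts_subset)
    next
      case (2 X q v)
      have "elts X \<subseteq> elts \<omega>" using S'[OF 2(1)] sub by blast
      then show ?case
        unfolding 2(2) using S'[OF 2(1)] ext_PF[OF _ dN] C formula_neg unfolding pair_mem_times by blast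
    next
      case (3 X q r v w)
      have "elts X \<subseteq> elts \<omega>" using S'[OF 3(1)] sub by blast
      then show ?case
        unfolding 3(3) using S'[OF 3(1)] S'[OF 3(2)] ext_PF[OF _ dC] C formula_and
        unfolding pair_mem_times by blast
    next
      case (4 X x q v)
      have "elts X \<subseteq> elts \<omega>" using S'[OF 4(1)] sub by blast
      then show ?case
        unfolding 4(2) using S'[OF 4(1)] ext_PF[OF _ dE] C formula_ex unfolding pair_mem_times by blast
    next
      case (5 X x q v)
      have "elts X \<subseteq> elts \<omega>" using S'[OF 5(1)] sub by blast
      then show ?case
        unfolding 5(2) using S'[OF 5(1)] ext_PF[OF _ dU] C formula_all unfolding pair_mem_times by blast
    qed
  qed
  ultimately obtain T where T: "\<And>z. z \<epsilon> T \<longleftrightarrow> \<Phi> T z" and TB: "elts T \<subseteq> elts (times C (pow PF))"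
    using ex_lfp[of \<Phi> "times C (pow PF)"] by blast
  have T_atomic: "\<langle>\<langle>X, q\<rangle>, v\<rangle> \<epsilon> T \<longleftrightarrow> v = ext ?A X (\<lambda>s. sat_at M s q)"
    if "elts X \<subseteq> elts \<omega>" "is_atomic L X q" for X q v
    by (subst T, unfold \<Phi>_def) (use that in auto)
  have T_neg: "\<langle>\<langle>X, fm_neg q\<rangle>, v\<rangle> \<epsilon> T \<longleftrightarrow>
      (\<exists>w. \<langle>\<langle>X, q\<rangle>, w\<rangle> \<epsilon> T \<and> v = ext ?A X (\<lambda>s. \<not> s \<epsilon> w))" for X q v
    by (subst T, unfold \<Phi>_def) (auto; blast)
  have T_and: "\<langle>\<langle>X, fm_and q r\<rangle>, v\<rangle> \<epsilon> T \<longleftrightarrow>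
      (\<exists>w u. \<langle>\<langle>X, q\<rangle>, w\<rangle> \<epsilon> T \<and> \<langle>\<langle>X, r\<rangle>, u\<rangle> \<epsilon> T \<and> v = ext ?A X (\<lambda>s. s \<epsilon> w \<and> s \<epsilon> u))" for X q r v
    by (subst T, unfold \<Phi>_def) (auto; blast)
  have T_ex: "\<langle>\<langle>X, fm_ex x q\<rangle>, v\<rangle> \<epsilon> T \<longleftrightarrow>
      (\<exists>w. \<langle>\<langle>adjoin X x, q\<rangle>, w\<rangle> \<epsilon> T \<and> v = ext ?A X (\<lambda>s. \<exists>a\<in>elts ?A. upd s x a \<epsilon> w))" for X x q v
    by (subst T, unfold \<Phi>_def) (auto; blast)
  have T_all: "\<langle>\<langle>X, fm_all x q\<rangle>, v\<rangle> \<epsilon> T \<longleftrightarrow>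
      (\<exists>w. \<langle>\<langle>adjoin X x, q\<rangle>, w\<rangle> \<epsilon> T \<and> v = ext ?A X (\<lambda>s. \<forall>a\<in>elts ?A. upd s x a \<epsilon> w))" for X x q v
    by (subst T, unfold \<Phi>_def) (auto; blast)
  have ex1: "\<exists>!v. \<langle>\<langle>X, p\<rangle>, v\<rangle> \<epsilon> T" if "is_formula L X p" for X p
    using that
  proof (induction rule: formula_induct)
    case dfn
    show ?case by (intro dfn_intros)
  next
    case (atomic X p)
    then show ?case by (simp add: T_atomic)
  next
    case (neg X p)
    then show ?case unfolding T_neg by (elim ex1E) (rule ex1I, blast+)
  next
    case (conj X p q)
    then show ?case unfolding T_and by (elim ex1E) (rule ex1I, blast+)
  next
    case (ex X x p)
    then show ?case unfolding T_ex by (elim ex1E) (rule ex1I, blast+)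
  next
    case (all X x p)
    then show ?case unfolding T_all by (elim ex1E) (rule ex1I, blast+)
  qed
  \<comment> \<open>\<open>V\<close> is a function of HOL and serves as notation only: the values
    are unique, and the set \<open>S\<close> below is separated by means of \<open>T\<close>, not of
    \<open>V\<close>.\<close>
  have "\<forall>X p. \<exists>v. is_formula L X p \<longrightarrow> (\<forall>v'. \<langle>\<langle>X, p\<rangle>, v'\<rangle> \<epsilon> T \<longleftrightarrow> v' = v)"
    using ex1 by metis
  then obtain V where V: "\<And>X p v. is_formula L X p \<Longrightarrow> \<langle>\<langle>X, p\<rangle>, v\<rangle> \<epsilon> T \<longleftrightarrow> v = V X p"
    by metis
  \<comment> \<open>The context is recovered as the domain of the assignment, so one code that is a
    formula in several contexts causes no confusion.\<close>
  have "dfn (\<lambda>e. \<exists>p s v. e 0 = \<langle>p, s\<rangle> \<and> \<langle>\<langle>dom s, p\<rangle>, v\<rangle> \<epsilon> T \<and> s \<epsilon> v)"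
    by (intro dfn_intros)
  from separation_dfn[OF this, of "times W PF"]
  obtain S where "\<And>z. z \<epsilon> S \<longleftrightarrow> z \<epsilon> times W PF \<and>
      (\<exists>p s v. z = \<langle>p, s\<rangle> \<and> \<langle>\<langle>dom s, p\<rangle>, v\<rangle> \<epsilon> T \<and> s \<epsilon> v)" by blast
  then have S: "\<langle>p, s\<rangle> \<epsilon> S \<longleftrightarrow> s \<epsilon> V X p"
    if "is_formula L X p" "s \<epsilon> ?A \<^bold>^ X" for X p s
    using that PF[OF formula_vars that(2)] W V exponent_dom[OF that(2)] by auto
  have "sat_rel M S"
    unfolding sat_rel_def ball_elts bex_elts mem_elts
  proof (intro allI impI conjI; (elim conjE)?)
    fix X s assume X: "elts X \<subseteq> elts \<omega>" and s: "s \<epsilon> ?A \<^bold>^ X"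
    show "\<langle>p, s\<rangle> \<epsilon> S \<longleftrightarrow> sat_at M s p" if p: "is_atomic L X p" for p
      using S[OF formula_atomic[OF X p] s] V[OF formula_atomic[OF X p]] T_atomic[OF X p] s
        mem_ext[OF dA] by metis
    show "\<langle>fm_neg p, s\<rangle> \<epsilon> S \<longleftrightarrow> \<not> \<langle>p, s\<rangle> \<epsilon> S" if p: "is_formula L X p" for p
      using S[OF p s] S[OF formula_neg[OF p] s] V[OF p] V[OF formula_neg[OF p]]
        T_neg[of X p] s mem_ext[OF dN] by metis
    show "\<langle>fm_and p q, s\<rangle> \<epsilon> S \<longleftrightarrow> \<langle>p, s\<rangle> \<epsilon> S \<and> \<langle>q, s\<rangle> \<epsilon> S"
      if p: "is_formula L X p" and q: "is_formula L X q" for p q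
    proof -
      have "V X (fm_and p q) = ext ?A X (\<lambda>s. s \<epsilon> V X p \<and> s \<epsilon> V X q)"
        using T_and[of X p q "V X (fm_and p q)"]
        unfolding V[OF p] V[OF q] V[OF formula_and[OF p q]] by simp
      then show ?thesis
        using S[OF p s] S[OF q s] S[OF formula_and[OF p q] s] s mem_ext[OF dC] by simp
    qed
    fix x p assume p: "is_formula L (adjoin X x) p"
    have V1: "\<langle>p, upd s x a\<rangle> \<epsilon> S \<longleftrightarrow> upd s x a \<epsilon> V (adjoin X x) p" if "a \<epsilon> ?A" for a
      by (rule S[OF p upd_mem[OF s that]])
    have "V X (fm_ex x p) = ext ?A X (\<lambda>s. \<exists>a\<in>elts ?A. upd s x a \<epsilon> V (adjoin X x) p)"
      using T_ex[of X x p "V X (fm_ex x p)"] unfolding V[OF p] V[OF formula_ex[OF p]] by simp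
    then have "s \<epsilon> V X (fm_ex x p) \<longleftrightarrow> (\<exists>a\<in>elts ?A. upd s x a \<epsilon> V (adjoin X x) p)"
      using mem_ext[OF dE] s by simp
    then show "\<langle>fm_ex x p, s\<rangle> \<epsilon> S \<longleftrightarrow> (\<exists>a. a \<epsilon> ?A \<and> \<langle>p, upd s x a\<rangle> \<epsilon> S)"
      using S[OF formula_ex[OF p] s] V1 by auto
    have "V X (fm_all x p) = ext ?A X (\<lambda>s. \<forall>a\<in>elts ?A. upd s x a \<epsilon> V (adjoin X x) p)"
      using T_all[of X x p "V X (fm_all x p)"] unfolding V[OF p] V[OF formula_all[OF p]] by simp
    then have "s \<epsilon> V X (fm_all x p) \<longleftrightarrow> (\<forall>a\<in>elts ?A. upd s x a \<epsilon> V (adjoin X x) p)"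
      using mem_ext[OF dU] s by simp
    then show "\<langle>fm_all x p, s\<rangle> \<epsilon> S \<longleftrightarrow> (\<forall>a. a \<epsilon> ?A \<longrightarrow> \<langle>p, upd s x a\<rangle> \<epsilon> S)"
      using S[OF formula_all[OF p] s] V1 by auto
  qed
  then show ?thesis by blast
qed

text \<open>\<open>R\<close> is a back-and-forth system, and the hypotheses \<open>forw\<close> and
  \<open>backw\<close> are exactly what the quantifier steps consume. The system relates total
  assignments on a common context, which may be infinite, and it has to be definable since the
  induction is internal.\<close>

lemma sat_rel_back_and_forth:
  assumes S: "sat_rel M S" and S': "sat_rel N S'"
    and dfn: "dfn (\<lambda>e. R (e 0) (e (Suc 0)))"
    and atomic: "\<And>X s t p. elts X \<subseteq> elts \<omega> \<Longrightarrow> s \<epsilon> univ M \<^bold>^ X \<Longrightarrow> t \<epsilon> univ N \<^bold>^ X \<Longrightarrow> R s t \<Longrightarrow>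
      is_atomic L X p \<Longrightarrow> sat_at M s p \<longleftrightarrow> sat_at N t p"
    and forw: "\<And>X s t x a. elts X \<subseteq> elts \<omega> \<Longrightarrow> s \<epsilon> univ M \<^bold>^ X \<Longrightarrow> t \<epsilon> univ N \<^bold>^ X \<Longrightarrow> R s t \<Longrightarrow>
      x \<epsilon> \<omega> \<Longrightarrow> a \<epsilon> univ M \<Longrightarrow> \<exists>b. b \<epsilon> univ N \<and> R (upd s x a) (upd t x b)"
    and backw: "\<And>X s t x b. elts X \<subseteq> elts \<omega> \<Longrightarrow> s \<epsilon> univ M \<^bold>^ X \<Longrightarrow> t \<epsilon> univ N \<^bold>^ X \<Longrightarrow> R s t \<Longrightarrow>
      x \<epsilon> \<omega> \<Longrightarrow> b \<epsilon> univ N \<Longrightarrow> \<exists>a. a \<epsilon> univ M \<and> R (upd s x a) (upd t x b)"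
    and p: "is_formula L X p"
  shows "\<forall>s t. s \<epsilon> univ M \<^bold>^ X \<and> t \<epsilon> univ N \<^bold>^ X \<and> R s t \<longrightarrow> (\<langle>p, s\<rangle> \<epsilon> S \<longleftrightarrow> \<langle>p, t\<rangle> \<epsilon> S')"
  using p
proof (induction rule: formula_induct)
  case dfn
  show ?case by (intro dfn_intros dfn_subst2[OF assms(3)])
next
  case (atomic X p)
  then show ?case using sat_rel_atomic[OF S] sat_rel_atomic[OF S'] assms(4) by blast
next
  case (neg X p)
  then show ?case using sat_rel_neg[OF S] sat_rel_neg[OF S'] formula_vars by blast
next
  case (conj X p q)
  then show ?case using sat_rel_and[OF S] sat_rel_and[OF S'] formula_vars by blast
next
  case (ex X x p)
  have X: "elts X \<subseteq> elts \<omega>" using formula_vars[OF ex(2)] by simp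
  show ?case
  proof (intro allI impI, elim conjE)
    fix s t assume s: "s \<epsilon> univ M \<^bold>^ X" and t: "t \<epsilon> univ N \<^bold>^ X" and R: "R s t"
    have "\<langle>p, upd s x a\<rangle> \<epsilon> S \<longleftrightarrow> \<langle>p, upd t x b\<rangle> \<epsilon> S'"
      if "a \<epsilon> univ M" "b \<epsilon> univ N" "R (upd s x a) (upd t x b)" for a b
      using ex(3) upd_mem[OF s that(1)] upd_mem[OF t that(2)] that(3) by blast
    then show "\<langle>fm_ex x p, s\<rangle> \<epsilon> S \<longleftrightarrow> \<langle>fm_ex x p, t\<rangle> \<epsilon> S'"
      unfolding sat_rel_ex[OF S X s ex(1,2)] sat_rel_ex[OF S' X t ex(1,2)]
      using forw[OF X s t R ex(1)] backw[OF X s t R ex(1)] by blast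
  qed
next
  case (all X x p)
  have X: "elts X \<subseteq> elts \<omega>" using formula_vars[OF all(2)] by simp
  show ?case
  proof (intro allI impI, elim conjE)
    fix s t assume s: "s \<epsilon> univ M \<^bold>^ X" and t: "t \<epsilon> univ N \<^bold>^ X" and R: "R s t"
    have "\<langle>p, upd s x a\<rangle> \<epsilon> S \<longleftrightarrow> \<langle>p, upd t x b\<rangle> \<epsilon> S'"
      if "a \<epsilon> univ M" "b \<epsilon> univ N" "R (upd s x a) (upd t x b)" for a b
      using all(3) upd_mem[OF s that(1)] upd_mem[OF t that(2)] that(3) by blast
    then show "\<langle>fm_all x p, s\<rangle> \<epsilon> S \<longleftrightarrow> \<langle>fm_all x p, t\<rangle> \<epsilon> S'"
      unfolding sat_rel_all[OF S X s all(1,2)] sat_rel_all[OF S' X t all(1,2)]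
      using forw[OF X s t R all(1)] backw[OF X s t R all(1)] by blast
  qed
qed

text \<open>Equality of assignments is a back-and-forth system between a structure and
  itself.\<close>

lemma sat_rel_unique:
  assumes "sat_rel M S" "sat_rel M S'" "is_formula L X p" "s \<epsilon> univ M \<^bold>^ X"
  shows "\<langle>p, s\<rangle> \<epsilon> S \<longleftrightarrow> \<langle>p, s\<rangle> \<epsilon> S'"
proof -
  have "dfn (\<lambda>e::nat \<Rightarrow> 'a. e 0 = e (Suc 0))" by (intro dfn_intros)
  from sat_rel_back_and_forth[where R = "(=)", OF assms(1,2) this _ _ _ assms(3)] assms(4)
  show ?thesis by blast
qed

text \<open>A definable version of \<open>satisfies L\<close>.\<close>

definition sat :: "'a \<Rightarrow> 'a \<Rightarrow> 'a \<Rightarrow> bool" where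
  "sat M p s \<longleftrightarrow> (\<exists>S. sat_rel M S \<and> \<langle>p, s\<rangle> \<epsilon> S)"

lemma dfn_sat [dfn_intros]: "tdf s \<Longrightarrow> tdf t \<Longrightarrow> tdf u \<Longrightarrow> dfn (\<lambda>e. sat (s e) (t e) (u e))"
  by (rule dfn_subst3) (unfold sat_def, intro dfn_intros)

lemma satisfies_sat: "is_structure L M \<Longrightarrow> satisfies L M p s \<longleftrightarrow> sat M p s"
  by (simp add: satisfies_def sat_def is_satisfaction_iff)

lemma sat_iff:
  assumes "sat_rel M S" "is_formula L X p" "s \<epsilon> univ M \<^bold>^ X"
  shows "sat M p s \<longleftrightarrow> \<langle>p, s\<rangle> \<epsilon> S"
  unfolding sat_def using assms sat_rel_unique by blast

lemma sat_clauses: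
  assumes s: "s \<epsilon> univ M \<^bold>^ X"
  shows sat_atomic: "elts X \<subseteq> elts \<omega> \<Longrightarrow> is_atomic L X p \<Longrightarrow> sat M p s \<longleftrightarrow> sat_at M s p"
    and sat_neg: "is_formula L X p \<Longrightarrow> sat M (fm_neg p) s \<longleftrightarrow> \<not> sat M p s"
    and sat_and: "is_formula L X p \<Longrightarrow> is_formula L X q \<Longrightarrow>
      sat M (fm_and p q) s \<longleftrightarrow> sat M p s \<and> sat M q s"
    and sat_ex: "is_formula L (adjoin X x) p \<Longrightarrow>
      sat M (fm_ex x p) s \<longleftrightarrow> (\<exists>a. a \<epsilon> univ M \<and> sat M p (upd s x a))"
    and sat_all: "is_formula L (adjoin X x) p \<Longrightarrow>
      sat M (fm_all x p) s \<longleftrightarrow> (\<forall>a. a \<epsilon> univ M \<longrightarrow> sat M p (upd s x a))"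
proof -
  obtain S where S: "sat_rel M S" using ex_sat_rel by blast
  note iff = sat_iff[OF S]
  show "elts X \<subseteq> elts \<omega> \<Longrightarrow> is_atomic L X p \<Longrightarrow> sat M p s \<longleftrightarrow> sat_at M s p"
    using iff[OF formula_atomic s] sat_rel_atomic[OF S _ s] by blast
  show "is_formula L X p \<Longrightarrow> sat M (fm_neg p) s \<longleftrightarrow> \<not> sat M p s"
    using iff[OF _ s] sat_rel_neg[OF S formula_vars s] formula_neg by blast
  show "is_formula L X p \<Longrightarrow> is_formula L X q \<Longrightarrow>
      sat M (fm_and p q) s \<longleftrightarrow> sat M p s \<and> sat M q s"
    using iff[OF _ s] sat_rel_and[OF S formula_vars s] formula_and by blast
  assume p: "is_formula L (adjoin X x) p"
  then have X: "elts X \<subseteq> elts \<omega>" and x: "x \<epsilon> \<omega>" using formula_vars by auto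
  show "sat M (fm_ex x p) s \<longleftrightarrow> (\<exists>a. a \<epsilon> univ M \<and> sat M p (upd s x a))"
    unfolding iff[OF formula_ex[OF p] s] sat_rel_ex[OF S X s x p] using iff[OF p upd_mem[OF s]] by blast
  show "sat M (fm_all x p) s \<longleftrightarrow> (\<forall>a. a \<epsilon> univ M \<longrightarrow> sat M p (upd s x a))"
    unfolding iff[OF formula_all[OF p] s] sat_rel_all[OF S X s x p] using iff[OF p upd_mem[OF s]] by blast
qed

lemma back_and_forth:
  assumes "dfn (\<lambda>e. R (e 0) (e (Suc 0)))"
    and "\<And>X s t p. elts X \<subseteq> elts \<omega> \<Longrightarrow> s \<epsilon> univ M \<^bold>^ X \<Longrightarrow> t \<epsilon> univ N \<^bold>^ X \<Longrightarrow> R s t \<Longrightarrow>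
      is_atomic L X p \<Longrightarrow> sat_at M s p \<longleftrightarrow> sat_at N t p"
    and "\<And>X s t x a. elts X \<subseteq> elts \<omega> \<Longrightarrow> s \<epsilon> univ M \<^bold>^ X \<Longrightarrow> t \<epsilon> univ N \<^bold>^ X \<Longrightarrow> R s t \<Longrightarrow>
      x \<epsilon> \<omega> \<Longrightarrow> a \<epsilon> univ M \<Longrightarrow> \<exists>b. b \<epsilon> univ N \<and> R (upd s x a) (upd t x b)"
    and "\<And>X s t x b. elts X \<subseteq> elts \<omega> \<Longrightarrow> s \<epsilon> univ M \<^bold>^ X \<Longrightarrow> t \<epsilon> univ N \<^bold>^ X \<Longrightarrow> R s t \<Longrightarrow>
      x \<epsilon> \<omega> \<Longrightarrow> b \<epsilon> univ N \<Longrightarrow> \<exists>a. a \<epsilon> univ M \<and> R (upd s x a) (upd t x b)"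
    and p: "is_formula L X p" "s \<epsilon> univ M \<^bold>^ X" "t \<epsilon> univ N \<^bold>^ X" "R s t"
  shows "sat M p s \<longleftrightarrow> sat N p t"
proof -
  obtain S S' where S: "sat_rel M S" "sat_rel N S'" using ex_sat_rel by blast
  have "\<forall>s t. s \<epsilon> univ M \<^bold>^ X \<and> t \<epsilon> univ N \<^bold>^ X \<and> R s t \<longrightarrow> (\<langle>p, s\<rangle> \<epsilon> S \<longleftrightarrow> \<langle>p, t\<rangle> \<epsilon> S')"
    by (rule sat_rel_back_and_forth[where R = R, OF S assms(1) _ _ _ p(1)]) (rule assms; assumption)+
  then show ?thesis
    using p(2-) sat_iff[OF S(1) p(1,2)] sat_iff[OF S(2) p(1,3)] by blast
qed

text \<open>The graph of composition with \<open>h\<close> is a back-and-forth system: going forth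
  uses the image of the new element, going back its preimage. Injectivity of \<open>h\<close> serves
  the atomic equations.\<close>

lemma isomorphism_sat:
  assumes M: "is_structure L M" and N: "is_structure L N" and h: "is_isomorphism L M N h"
    and p: "is_formula L X p" and s: "s \<epsilon> univ M \<^bold>^ X"
  shows "sat M p s \<longleftrightarrow> sat N p (h \<odot> s)"
proof -
  have hf: "h \<epsilon> univ N \<^bold>^ univ M"
    and bijection: "\<And>b. b \<epsilon> univ N \<Longrightarrow> \<exists>!a. a \<epsilon> univ M \<and> h \<cdot> a = b"
    and rel: "\<And>R t. R \<epsilon> Rs \<Longrightarrow> t \<epsilon> univ M \<^bold>^ rar L R \<Longrightarrow> t \<epsilon> RI M R \<longleftrightarrow> (h \<odot> t) \<epsilon> RI N R"
    and "fun": "\<And>F t. F \<epsilon> Fs \<Longrightarrow> t \<epsilon> univ M \<^bold>^ far L F \<Longrightarrow>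
      ap h (ap (FI M F) t) = ap (FI N F) (h \<odot> t)"
  proof -
    show hf: "h \<epsilon> univ N \<^bold>^ univ M"
      and "\<And>b. b \<epsilon> univ N \<Longrightarrow> \<exists>!a. a \<epsilon> univ M \<and> h \<cdot> a = b"
      using h unfolding is_isomorphism_def by auto
    show "t \<epsilon> RI M R \<longleftrightarrow> (h \<odot> t) \<epsilon> RI N R" if "R \<epsilon> Rs" "t \<epsilon> univ M \<^bold>^ rar L R" for R t
      using h that unfolding is_isomorphism_def
      by (simp add: arity_eq rel_interp_eq[OF M] rel_interp_eq[OF N])
    show "ap h (ap (FI M F) t) = ap (FI N F) (h \<odot> t)" if F: "F \<epsilon> Fs" and t: "t \<epsilon> univ M \<^bold>^ far L F" for F t
    proof -
      have "h \<cdot> (FI M F \<cdot> t) = FI N F \<cdot> (h \<odot> t)"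
        using h that unfolding is_isomorphism_def
        by (simp add: arity_eq fun_interp_eq[OF M] fun_interp_eq[OF N])
      then show ?thesis
        using exponent_app[OF FI_mem[OF M F] t] exponent_app[OF FI_mem[OF N F] compose_mem[OF t hf]]
          exponent_app[OF hf exponent_ap[OF FI_mem[OF M F] t]] by simp
    qed
  qed
  have inj: "a = b" if "a \<epsilon> univ M" "b \<epsilon> univ M" "ap h a = ap h b" for a b
    using bijection[OF exponent_ap[OF hf that(1)]] that exponent_app[OF hf] by metis
  \<comment> \<open>A definable stand-in for composition with \<open>h\<close>, total in
    \<open>s\<close>, needed because the system must be definable.\<close>
  define H where "H s = lam (dom s) (\<lambda>k. ap h (ap s k))" for s
  have H: "h \<odot> s = H s" if "s \<epsilon> univ M \<^bold>^ X" for s X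
    unfolding H_def exponent_dom[OF that] using that hf by (intro compose_eq) (auto simp: mem_exponent)
  have Hv: "H s = lam X (\<lambda>k. ap h (ap s k))" if "s \<epsilon> univ M \<^bold>^ X" for s X
    unfolding H_def exponent_dom[OF that] ..
  have val: "val N (H s) t = ap h (val M s t) \<and> t \<epsilon> terms L X"
    if s: "s \<epsilon> univ M \<^bold>^ X" and t: "t \<epsilon> terms L X" for s t X
    using t
  proof (induction rule: terms_induct)
    case dfn
    show ?case by (intro dfn_intros)
  next
    case (var x)
    have "H s \<epsilon> univ N \<^bold>^ X" using compose_mem[OF s hf] H[OF s] by simp
    with var show ?case
      using val_var[OF M s] val_var[OF N] ap_compose[OF s hf] H[OF s] by (simp add: terms_var)
  next
    case (app F u)
    have Hs: "H s \<epsilon> univ N \<^bold>^ X" using compose_mem[OF s hf] H[OF s] by simp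
    have t: "tdf (\<lambda>e. val M s (ap u (e 0)))" by (intro dfn_intros)
    let ?v = "lam (far L F) (\<lambda>k. val M s (ap u k))"
    have v: "?v \<epsilon> univ M \<^bold>^ far L F"
      by (rule lam_mem_exponent[OF t]) (use val_mem[OF M s] app exponent_ap in blast)
    have "val N (H s) (ap u k) = ap h (ap ?v k)" if "k \<epsilon> far L F" for k
      using app(3)[OF that] ap_lam[OF t that] by simp
    then have "lam (far L F) (\<lambda>k. val N (H s) (ap u k)) = h \<odot> ?v"
      unfolding H[OF v] Hv[OF v] by (rule lam_cong)
    then show ?case
      using app val_app[OF M s] val_app[OF N Hs] "fun"[OF app(1) v] by (simp add: terms_app)
  qed
  have dfnR: "dfn (\<lambda>e. e (Suc 0) = H (e 0))" unfolding H_def by (intro dfn_intros)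
  have Hupd: "upd (H s) x (ap h a) = H (upd s x a)" if s: "s \<epsilon> univ M \<^bold>^ X" and a: "a \<epsilon> univ M" for s X x a
  proof -
    have Hs: "H s \<epsilon> univ N \<^bold>^ X" using compose_mem[OF s hf] H[OF s] by simp
    note a' = exponent_ap[OF hf a]
    note us = upd_mem[OF s a, of x]
    have "upd (H s) x (ap h a) = h \<odot> upd s x a"
    proof (rule func_ext[of _ "adjoin X x"])
      show "func_on (upd (H s) x (ap h a)) (adjoin X x)" using upd_mem[OF Hs a'] by (rule exponent_func)
      show "func_on (h \<odot> upd s x a) (adjoin X x)" using compose_mem[OF us hf] by (rule exponent_func)
      fix y assume "y \<epsilon> adjoin X x"
      then show "ap (upd (H s) x (ap h a)) y = ap (h \<odot> upd s x a) y"
        using ap_compose[OF us hf] ap_upd[OF s] ap_upd[OF Hs] ap_compose[OF s hf] H[OF s] by auto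
    qed
    then show ?thesis using H[OF us] by simp
  qed
  have "sat M p s \<longleftrightarrow> sat N p (H s)"
  proof (rule back_and_forth[where R = "\<lambda>s t. t = H s", OF dfnR _ _ _ p s])
    fix X s t q assume s: "s \<epsilon> univ M \<^bold>^ X" and t: "t = H s" and q: "is_atomic L X q"
    have Hs: "H s \<epsilon> univ N \<^bold>^ X" using compose_mem[OF s hf] H[OF s] by simp
    from q consider u v where "u \<epsilon> terms L X" "v \<epsilon> terms L X" "q = fm_eq u v" |
      R u where "R \<epsilon> Rs" "u \<epsilon> terms L X \<^bold>^ rar L R" "q = fm_rel R u"
      unfolding is_atomic_iff by blast
    then show "sat_at M s q \<longleftrightarrow> sat_at N t q"
    proof cases
      case 1
      then show ?thesis using val[OF s] inj val_mem[OF M s] t by auto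
    next
      case 2
      have td: "tdf (\<lambda>e. val M s (ap u (e 0)))" by (intro dfn_intros)
      let ?v = "lam (rar L R) (\<lambda>k. val M s (ap u k))"
      have v: "?v \<epsilon> univ M \<^bold>^ rar L R"
        by (rule lam_mem_exponent[OF td]) (use val_mem[OF M s] 2 exponent_ap in blast)
      have "val N (H s) (ap u k) = ap h (ap ?v k)" if "k \<epsilon> rar L R" for k
        using val[OF s exponent_ap[OF 2(2) that]] ap_lam[OF td that] by simp
      then have "lam (rar L R) (\<lambda>k. val N (H s) (ap u k)) = h \<odot> ?v"
        unfolding H[OF v] Hv[OF v] by (rule lam_cong)
      then show ?thesis using rel[OF 2(1) v] t unfolding 2(3) sat_at_rel[OF 2(2)] by simp
    qed
  next
    fix X s t x a assume "s \<epsilon> univ M \<^bold>^ X" "t = H s" "a \<epsilon> univ M"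
    then show "\<exists>b. b \<epsilon> univ N \<and> upd t x b = H (upd s x a)"
      using Hupd exponent_ap[OF hf] by blast
  next
    fix X s t x b assume s: "s \<epsilon> univ M \<^bold>^ X" "t = H s" "b \<epsilon> univ N"
    then obtain a where "a \<epsilon> univ M" "ap h a = b" using bijection exponent_app[OF hf] by metis
    then show "\<exists>a. a \<epsilon> univ M \<and> upd t x b = H (upd s x a)"
      using Hupd s by blast
  qed (use compose_mem[OF s hf] H[OF s] in auto)
  then show ?thesis using H[OF s] by simp
qed

lemma empty_exponent: "empty \<epsilon> A \<^bold>^ (empty :: 'a)"
  by (simp add: mem_exponent func_on_iff)

lemma compose_empty: "h \<odot> empty = (empty :: 'a)"
proof -
  have "func_on (empty :: 'a) empty" by (simp add: func_on_iff)
  then have "dom (empty :: 'a) = empty" by (rule dom_eq)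
  then have "h \<odot> (empty :: 'a) = set_of {}" unfolding compose_def lam_def by simp
  then show ?thesis by (simp only: empty_def)
qed

lemma isomorphic_sat:
  assumes "is_structure L M" "is_structure L N" "isomorphic L M N" "is_formula L empty p"
  shows "sat M p empty \<longleftrightarrow> sat N p empty"
proof -
  obtain h where "is_isomorphism L M N h" using assms(3) unfolding isomorphic_def by blast
  from isomorphism_sat[OF assms(1,2) this assms(4) empty_exponent] show ?thesis
    unfolding compose_empty .
qed

text \<open>The empty assignment is its own image under composition with \<open>j\<close>, so an
  elementary embedding preserves the truth of sentences.\<close>

lemma elementary_embedding_sat:
  assumes "is_structure L M" "is_structure L N" "elementary_embedding L M N j" "is_formula L empty p"
  shows "sat M p empty \<longleftrightarrow> sat N p empty"
proof -
  have "\<forall>X p. is_formula L X p \<longrightarrow> (\<forall>s\<in>elts (univ M \<^bold>^ X).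
        satisfies L M p s \<longleftrightarrow> satisfies L N p (j \<odot> s))"
    using assms(3) unfolding elementary_embedding_def by (rule conjunct2)
  then have "\<forall>s\<in>elts (univ M \<^bold>^ empty). satisfies L M p s \<longleftrightarrow> satisfies L N p (j \<odot> s)"
    using assms(4) by (elim allE impE)
  moreover have "empty \<in> elts (univ M \<^bold>^ empty)" by (simp add: empty_exponent)
  ultimately have "satisfies L M p empty \<longleftrightarrow> satisfies L N p (j \<odot> empty)" by (rule bspec)
  then show ?thesis unfolding compose_empty satisfies_sat[OF assms(1)] satisfies_sat[OF assms(2)] .
qed

end

section \<open>Ultraproducts\<close>

locale ultra =
  fixes I U :: "'a::zf"
  assumes U: "ultrafilter_over I U"
begin

lemma U_I: "I \<epsilon> U" and U_empty: "\<not> empty \<epsilon> U"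
  and U_up: "X \<epsilon> U \<Longrightarrow> elts X \<subseteq> elts Y \<Longrightarrow> elts Y \<subseteq> elts I \<Longrightarrow> Y \<epsilon> U"
  and U_int: "X \<epsilon> U \<Longrightarrow> Y \<epsilon> U \<Longrightarrow> set_of (elts X \<inter> elts Y) \<epsilon> U"
  and U_ultra: "elts X \<subseteq> elts I \<Longrightarrow> X \<epsilon> U \<or> set_of (elts I - elts X) \<epsilon> U"
  using U unfolding ultrafilter_over_def Ball_def mem_elts by blast+

abbreviation many :: "('a \<Rightarrow> bool) \<Rightarrow> bool" where
  "many \<equiv> U_many I U"

lemma dfn_many [dfn_intros]:
  assumes "dfn (\<lambda>e. P (\<lambda>n. e (Suc n)) (e 0))"
  shows "dfn (\<lambda>e. many (P e))"
  unfolding U_many_def by (intro dfn_intros assms)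

lemma elts_many: "dfn (\<lambda>e. P (e 0)) \<Longrightarrow> elts (set_of {i \<in> elts I. P i}) = {i \<in> elts I. P i}"
  by (rule elts_set_of) (rule small_subset)

lemma many_cong: "(\<And>i. i \<epsilon> I \<Longrightarrow> P i \<longleftrightarrow> Q i) \<Longrightarrow> many P \<longleftrightarrow> many Q"
  unfolding U_many_def by (rule arg_cong[where f = "\<lambda>S. set_of S \<epsilon> U"]) auto

lemma many_all: "(\<And>i. i \<epsilon> I \<Longrightarrow> P i) \<Longrightarrow> many P"
  using many_cong[of P "\<lambda>i. True"] U_I unfolding U_many_def by (simp flip: elts_def)

lemma many_mono:
  assumes "dfn (\<lambda>e. P (e 0))" "dfn (\<lambda>e. Q (e 0))" "many P" "\<And>i. i \<epsilon> I \<Longrightarrow> P i \<Longrightarrow> Q i"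
  shows "many Q"
  unfolding U_many_def
  by (rule U_up[OF assms(3)[unfolded U_many_def]])
    (unfold elts_many[OF assms(1)] elts_many[OF assms(2)], use assms(4) in auto)

lemma many_conj:
  assumes "dfn (\<lambda>e. P (e 0))" "dfn (\<lambda>e. Q (e 0))" "many P" "many Q"
  shows "many (\<lambda>i. P i \<and> Q i)"
proof -
  have "elts (set_of {i \<in> elts I. P i}) \<inter> elts (set_of {i \<in> elts I. Q i}) = {i \<in> elts I. P i \<and> Q i}"
    unfolding elts_many[OF assms(1)] elts_many[OF assms(2)] by auto
  with U_int[OF assms(3)[unfolded U_many_def] assms(4)[unfolded U_many_def]]
  show ?thesis by (simp add: U_many_def)
qed

lemma many_mono2:
  assumes "dfn (\<lambda>e. P (e 0))" "dfn (\<lambda>e. Q (e 0))" "dfn (\<lambda>e. R (e 0))"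
    "many P" "many Q" "\<And>i. i \<epsilon> I \<Longrightarrow> P i \<Longrightarrow> Q i \<Longrightarrow> R i"
  shows "many R"
  by (rule many_mono[OF dfn_conj[OF assms(1,2)] assms(3) many_conj[OF assms(1,2,4,5)]])
    (use assms(6) in blast)

lemma many_conj_iff:
  assumes "dfn (\<lambda>e. P (e 0))" "dfn (\<lambda>e. Q (e 0))"
  shows "many (\<lambda>i. P i \<and> Q i) \<longleftrightarrow> many P \<and> many Q"
  using many_conj[OF assms] many_mono[OF dfn_conj[OF assms] assms(1)]
    many_mono[OF dfn_conj[OF assms] assms(2)] by blast

lemma many_not:
  assumes "dfn (\<lambda>e. P (e 0))"
  shows "many (\<lambda>i. \<not> P i) \<longleftrightarrow> \<not> many P"
proof
  assume "many (\<lambda>i. \<not> P i)"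
  show "\<not> many P"
  proof
    assume "many P"
    from many_conj[OF assms dfn_not[OF assms] this \<open>many (\<lambda>i. \<not> P i)\<close>]
    have "set_of {} \<epsilon> U" by (simp add: U_many_def)
    then show False using U_empty by (simp add: empty_def)
  qed
next
  assume "\<not> many P"
  then have "set_of (elts I - {i \<in> elts I. P i}) \<epsilon> U"
    using U_ultra[of "set_of {i \<in> elts I. P i}"] unfolding U_many_def elts_many[OF assms] by blast
  moreover have "elts I - {i \<in> elts I. P i} = {i \<in> elts I. \<not> P i}" by auto
  ultimately show "many (\<lambda>i. \<not> P i)" by (simp add: U_many_def)
qed

lemma many_ex: "many P \<Longrightarrow> \<exists>i. i \<epsilon> I \<and> P i"
proof (rule ccontr)
  assume P: "many P" and "\<nexists>i. i \<epsilon> I \<and> P i"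
  then have "many (\<lambda>i. False)" using many_cong[of P "\<lambda>i. False"] by blast
  then show False using U_empty by (simp add: U_many_def empty_def)
qed

text \<open>An ultrafilter is given with binary intersections only, and \<open>n\<close> may be
  non-standard, so the passage to intersections of length \<open>n\<close> is an internal
  induction.\<close>

lemma many_ball:
  assumes n: "n \<epsilon> \<omega>" and P: "dfn (\<lambda>e. P (e 0) (e (Suc 0)))"
    and many: "\<And>k. k \<epsilon> n \<Longrightarrow> many (P k)"
  shows "many (\<lambda>i. \<forall>k\<in>elts n. P k i)"
proof -
  have "(\<forall>k\<in>elts n. many (P k)) \<longrightarrow> many (\<lambda>i. \<forall>k\<in>elts n. P k i)"
    using n
  proof (rule omega_induct)
    show "dfn (\<lambda>e. (\<forall>k\<in>elts (e 0). many (P k)) \<longrightarrow> many (\<lambda>i. \<forall>k\<in>elts (e 0). P k i))"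
      by (intro dfn_intros dfn_subst2[OF P])
    show "(\<forall>k\<in>elts empty. many (P k)) \<longrightarrow> many (\<lambda>i. \<forall>k\<in>elts empty. P k i)"
      by (auto intro: many_all)
    fix n assume IH: "(\<forall>k\<in>elts n. many (P k)) \<longrightarrow> many (\<lambda>i. \<forall>k\<in>elts n. P k i)"
    show "(\<forall>k\<in>elts (adjoin n n). many (P k)) \<longrightarrow> many (\<lambda>i. \<forall>k\<in>elts (adjoin n n). P k i)"
    proof
      assume "\<forall>k\<in>elts (adjoin n n). many (P k)"
      then have "many (\<lambda>i. \<forall>k\<in>elts n. P k i)" "many (P n)" using IH by auto
      moreover have "dfn (\<lambda>e. \<forall>k\<in>elts n. P k (e 0))" "dfn (\<lambda>e. P n (e 0))"
        by (intro dfn_intros dfn_subst2[OF P])+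
      ultimately have "many (\<lambda>i. (\<forall>k\<in>elts n. P k i) \<and> P n i)" by (intro many_conj)
      then show "many (\<lambda>i. \<forall>k\<in>elts (adjoin n n). P k i)"
        by (rule back_subst[of many]) (auto simp: fun_eq_iff)
    qed
  qed
  then show ?thesis using many by simp
qed

end

section \<open>Products and ultraproducts of a family of structures\<close>

locale indexed_family = lang L + ultra I U for L I U :: "'a::zf" +
  fixes M :: 'a
  assumes M: "is_family L I M"
begin

abbreviation "PU \<equiv> product_univ I M"
abbreviation "Mi i \<equiv> ap M i"

lemma app_M: "i \<epsilon> I \<Longrightarrow> M \<cdot> i = Mi i"
  using M unfolding is_family_def by (auto intro: app_ap)

lemma structure_M: "i \<epsilon> I \<Longrightarrow> is_structure L (Mi i)"
  using M app_M unfolding is_family_def by auto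

lemma product_univ_eq: "PU = set_of {f. func_on f I \<and> (\<forall>i\<in>elts I. ap f i \<epsilon> univ (Mi i))}"
proof -
  have "{f. func_on f I \<and> (\<forall>i\<in>elts I. f \<cdot> i \<epsilon> univ (M \<cdot> i))} =
      {f. func_on f I \<and> (\<forall>i\<in>elts I. ap f i \<epsilon> univ (Mi i))}"
    by (auto simp: app_ap app_M)
  then show ?thesis by (simp add: product_univ_def)
qed

lemma mem_PU: "f \<epsilon> PU \<longleftrightarrow> func_on f I \<and> (\<forall>i. i \<epsilon> I \<longrightarrow> ap f i \<epsilon> univ (Mi i))"
proof -
  have "tdf (\<lambda>e. univ (Mi (e 0)))" by (intro dfn_intros)
  from small_image[OF this, of I]
  obtain c where c: "\<And>y. y \<epsilon> c \<longleftrightarrow> (\<exists>i. y = univ (Mi i) \<and> i \<epsilon> I)"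
    unfolding small_def by (auto simp: set_eq_iff)
  obtain d where d: "\<And>x. x \<epsilon> d \<longleftrightarrow> (\<exists>y. y \<epsilon> c \<and> x \<epsilon> y)" using union[of c] by blast
  have "small {f. func_on f I \<and> (\<forall>i\<in>elts I. ap f i \<epsilon> univ (Mi i))}"
  proof (rule small_Collect[of _ "d \<^bold>^ I"])
    show "dfn (\<lambda>e. func_on (e 0) I \<and> (\<forall>i\<in>elts I. ap (e 0) i \<epsilon> univ (Mi i)))" by (intro dfn_intros)
  qed (auto simp: mem_exponent d c)
  then show ?thesis by (simp add: product_univ_eq mem_set_of)
qed

lemma PU_ap: "f \<epsilon> PU \<Longrightarrow> i \<epsilon> I \<Longrightarrow> ap f i \<epsilon> univ (Mi i)"
  and PU_func: "f \<epsilon> PU \<Longrightarrow> func_on f I"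
  by (simp_all add: mem_PU)

lemma PU_lam:
  assumes "tdf (\<lambda>e. F (e 0))" "\<And>i. i \<epsilon> I \<Longrightarrow> F i \<epsilon> univ (Mi i)"
  shows "lam I F \<epsilon> PU"
  using assms by (simp add: mem_PU func_on_lam ap_lam)

end

text \<open>In ZF a product of non-empty universes may be empty. The ultraproduct would then have an
  empty universe and fail to be a structure.\<close>

locale ultra_family = indexed_family +
  assumes nonempty: "product_univ I M \<noteq> empty"
begin

abbreviation "Ult \<equiv> ultraproduct L I U M"

lemma ex_PU: "\<exists>h. h \<epsilon> PU"
  using nonempty by (auto simp: empty_iff)

text \<open>Definable versions of the classes, class tuples and coordinates.\<close>

definition cl :: "'a \<Rightarrow> 'a" where
  "cl f = set_of {g. g \<epsilon> PU \<and> many (\<lambda>i. ap f i = ap g i)}"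

definition ct :: "'a \<Rightarrow> 'a" where
  "ct g = lam (dom g) (\<lambda>k. cl (ap g k))"

definition co :: "'a \<Rightarrow> 'a \<Rightarrow> 'a" where
  "co g i = lam (dom g) (\<lambda>k. ap (ap g k) i)"

lemma tdf_cl [dfn_intros]: "tdf s \<Longrightarrow> tdf (\<lambda>e. cl (s e))"
  by (rule tdf_subst1) (unfold cl_def, intro dfn_intros)

lemma tdf_ct [dfn_intros]: "tdf s \<Longrightarrow> tdf (\<lambda>e. ct (s e))"
  by (rule tdf_subst1) (unfold ct_def, intro dfn_intros)

lemma tdf_co [dfn_intros]: "tdf s \<Longrightarrow> tdf t \<Longrightarrow> tdf (\<lambda>e. co (s e) (t e))"
  by (rule tdf_subst2) (unfold co_def, intro dfn_intros)

lemma mem_cl: "g \<epsilon> cl f \<longleftrightarrow> g \<epsilon> PU \<and> many (\<lambda>i. ap f i = ap g i)"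
proof -
  have "small {g. g \<epsilon> PU \<and> many (\<lambda>i. ap f i = ap g i)}"
    by (rule small_Collect[of _ PU]) (intro dfn_intros, simp)
  then show ?thesis by (simp add: cl_def mem_set_of)
qed

lemma ultra_class_eq: "f \<epsilon> PU \<Longrightarrow> ultra_class I U M f = cl f"
proof -
  assume f: "f \<epsilon> PU"
  have "many (\<lambda>i. f \<cdot> i = g \<cdot> i) \<longleftrightarrow> many (\<lambda>i. ap f i = ap g i)" if "g \<epsilon> PU" for g
    by (rule many_cong) (simp add: app_ap[OF PU_func[OF f]] app_ap[OF PU_func[OF that]])
  then have "{g \<in> elts PU. many (\<lambda>i. f \<cdot> i = g \<cdot> i)} = {g. g \<epsilon> PU \<and> many (\<lambda>i. ap f i = ap g i)}"
    by auto
  then show ?thesis by (simp add: ultra_class_def cl_def)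
qed

lemma cl_eq:
  assumes "f \<epsilon> PU" "g \<epsilon> PU"
  shows "cl f = cl g \<longleftrightarrow> many (\<lambda>i. ap f i = ap g i)"
proof
  assume "cl f = cl g"
  moreover have "g \<epsilon> cl g" using assms by (auto simp: mem_cl intro: many_all)
  ultimately have "g \<epsilon> cl f" by simp
  then show "many (\<lambda>i. ap f i = ap g i)" by (simp add: mem_cl)
next
  assume eq: "many (\<lambda>i. ap f i = ap g i)"
  have d: "dfn (\<lambda>e. ap x (e 0) = ap y (e 0))" for x y :: 'a by (intro dfn_intros)
  have "many (\<lambda>i. ap f i = ap h i) \<longleftrightarrow> many (\<lambda>i. ap g i = ap h i)" for h
    using many_mono2[OF d[of f g] d[of f h] d[of g h] eq]
      many_mono2[OF d[of f g] d[of g h] d[of f h] eq] by auto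
  then show "cl f = cl g" by (intro extensionality) (simp add: mem_cl)
qed

context
  fixes g n
  assumes g: "g \<epsilon> PU \<^bold>^ n"
begin

lemma class_tuple_eq: "class_tuple I U M g = ct g"
  unfolding class_tuple_def ct_def exponent_dom[OF g]
  by (rule lam_cong) (simp add: exponent_app[OF g] ultra_class_eq[OF exponent_ap[OF g]])

lemma coordinate_eq: "i \<epsilon> I \<Longrightarrow> coordinate g i = co g i"
  unfolding coordinate_def co_def exponent_dom[OF g]
  by (rule lam_cong) (simp add: exponent_app[OF g] app_ap[OF PU_func[OF exponent_ap[OF g]]])

lemma ap_ct: "k \<epsilon> n \<Longrightarrow> ap (ct g) k = cl (ap g k)"
proof -
  have "tdf (\<lambda>e. cl (ap g (e 0)))" by (intro dfn_intros)
  then show "k \<epsilon> n \<Longrightarrow> ap (ct g) k = cl (ap g k)"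
    unfolding ct_def exponent_dom[OF g] by (rule ap_lam)
qed

lemma ap_co: "k \<epsilon> n \<Longrightarrow> ap (co g i) k = ap (ap g k) i"
proof -
  have "tdf (\<lambda>e. ap (ap g (e 0)) i)" by (intro dfn_intros)
  then show "k \<epsilon> n \<Longrightarrow> ap (co g i) k = ap (ap g k) i"
    unfolding co_def exponent_dom[OF g] by (rule ap_lam)
qed

lemma func_on_ct: "func_on (ct g) n"
proof -
  have "tdf (\<lambda>e. cl (ap g (e 0)))" by (intro dfn_intros)
  then show ?thesis unfolding ct_def exponent_dom[OF g] by (rule func_on_lam)
qed

lemma co_mem: "i \<epsilon> I \<Longrightarrow> co g i \<epsilon> univ (Mi i) \<^bold>^ n"
proof -
  have "tdf (\<lambda>e. ap (ap g (e 0)) i)" by (intro dfn_intros)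
  then show "i \<epsilon> I \<Longrightarrow> co g i \<epsilon> univ (Mi i) \<^bold>^ n"
    unfolding co_def exponent_dom[OF g]
    by (rule lam_mem_exponent) (rule PU_ap[OF exponent_ap[OF g]])
qed

end

lemma ct_eq:
  assumes g: "g \<epsilon> PU \<^bold>^ n" and h: "h \<epsilon> PU \<^bold>^ n" and n: "n \<epsilon> \<omega>" and eq: "ct g = ct h"
  shows "many (\<lambda>i. co g i = co h i)"
proof -
  have "many (\<lambda>i. ap (ap g k) i = ap (ap h k) i)" if "k \<epsilon> n" for k
    using cl_eq[OF exponent_ap[OF g that] exponent_ap[OF h that]] ap_ct[OF g that] ap_ct[OF h that] eq
    by simp
  then have m: "many (\<lambda>i. \<forall>k\<in>elts n. ap (ap g k) i = ap (ap h k) i)"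
    by (intro many_ball n) (intro dfn_intros)
  have iff: "(\<forall>k\<in>elts n. ap (ap g k) i = ap (ap h k) i) \<longleftrightarrow> co g i = co h i" if "i \<epsilon> I" for i
  proof
    assume eq: "\<forall>k\<in>elts n. ap (ap g k) i = ap (ap h k) i"
    show "co g i = co h i"
    proof (rule func_ext)
      show "func_on (co g i) n" "func_on (co h i) n"
        using co_mem[OF g that] co_mem[OF h that] by (auto intro: exponent_func)
      show "ap (co g i) k = ap (co h i) k" if "k \<epsilon> n" for k
        using eq that by (simp add: ap_co[OF g that] ap_co[OF h that])
    qed
  next
    assume eq: "co g i = co h i"
    show "\<forall>k\<in>elts n. ap (ap g k) i = ap (ap h k) i"
    proof
      fix k assume "k \<in> elts n"
      then show "ap (ap g k) i = ap (ap h k) i"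
        using ap_co[OF g, of k i] ap_co[OF h, of k i] eq by simp
    qed
  qed
  show ?thesis by (rule iffD1[OF many_cong[OF iff] m])
qed

lemma mem_univ_Ult: "c \<epsilon> univ Ult \<longleftrightarrow> (\<exists>f. f \<epsilon> PU \<and> c = cl f)"
proof -
  have "univ Ult = set_of {cl f | f. f \<in> elts PU}"
    unfolding ultraproduct_def univ_def pfst_pair
    by (rule arg_cong[where f = set_of], rule Collect_cong, rule ex_cong1) (auto simp: ultra_class_eq)
  moreover have "tdf (\<lambda>e. cl (e 0))" by (intro dfn_intros)
  ultimately show ?thesis using mem_set_of[OF small_image, of cl c PU] by auto
qed

lemma ct_mem: "g \<epsilon> PU \<^bold>^ n \<Longrightarrow> ct g \<epsilon> univ Ult \<^bold>^ n"
  using func_on_ct[of g n] ap_ct[of g n] exponent_ap[of g PU n] by (auto simp: mem_exponent[of "ct g"] mem_univ_Ult)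

text \<open>Choosing representatives for a tuple of length in \<omega> is possible in ZF: induction
  on the length prolongs the tuple of representatives by one pair at a time.\<close>

lemma lift_tuple:
  assumes n: "n \<epsilon> \<omega>" and t: "t \<epsilon> univ Ult \<^bold>^ n"
  obtains g where "g \<epsilon> PU \<^bold>^ n" "t = ct g"
proof -
  have "(\<forall>k\<in>elts n. ap t k \<epsilon> univ Ult) \<longrightarrow> (\<exists>g. g \<epsilon> PU \<^bold>^ n \<and> (\<forall>k\<in>elts n. ap t k = cl (ap g k)))"
    using n
  proof (rule omega_induct)
    show "dfn (\<lambda>e. (\<forall>k\<in>elts (e 0). ap t k \<epsilon> univ Ult) \<longrightarrow>
      (\<exists>g. g \<epsilon> PU \<^bold>^ e 0 \<and> (\<forall>k\<in>elts (e 0). ap t k = cl (ap g k))))" by (intro dfn_intros)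
    show "(\<forall>k\<in>elts empty. ap t k \<epsilon> univ Ult) \<longrightarrow>
      (\<exists>g. g \<epsilon> PU \<^bold>^ empty \<and> (\<forall>k\<in>elts empty. ap t k = cl (ap g k)))"
      using empty_exponent by auto
    fix n assume IH: "(\<forall>k\<in>elts n. ap t k \<epsilon> univ Ult) \<longrightarrow>
      (\<exists>g. g \<epsilon> PU \<^bold>^ n \<and> (\<forall>k\<in>elts n. ap t k = cl (ap g k)))"
    show "(\<forall>k\<in>elts (adjoin n n). ap t k \<epsilon> univ Ult) \<longrightarrow>
      (\<exists>g. g \<epsilon> PU \<^bold>^ adjoin n n \<and> (\<forall>k\<in>elts (adjoin n n). ap t k = cl (ap g k)))"
    proof
      assume "\<forall>k\<in>elts (adjoin n n). ap t k \<epsilon> univ Ult"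
      then obtain g f where g: "g \<epsilon> PU \<^bold>^ n" "\<And>k. k \<epsilon> n \<Longrightarrow> ap t k = cl (ap g k)"
        and f: "f \<epsilon> PU" "ap t n = cl f" using IH mem_univ_Ult by auto
      note h = func_on_adjoin[OF exponent_func[OF g(1)] mem_irrefl, where y = f]
      have hk: "ap (adjoin g \<langle>n, f\<rangle>) k = (if k = n then f else ap g k)" if "k = n \<or> k \<epsilon> n" for k
        using that h by auto
      have "adjoin g \<langle>n, f\<rangle> \<epsilon> PU \<^bold>^ adjoin n n"
        unfolding mem_exponent using h(1) hk f(1) exponent_ap[OF g(1)] by simp
      then show "\<exists>g. g \<epsilon> PU \<^bold>^ adjoin n n \<and> (\<forall>k\<in>elts (adjoin n n). ap t k = cl (ap g k))"
        using hk f g(2) by (intro exI[of _ "adjoin g \<langle>n, f\<rangle>"]) auto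
    qed
  qed
  then obtain g where g: "g \<epsilon> PU \<^bold>^ n" "\<And>k. k \<epsilon> n \<Longrightarrow> ap t k = cl (ap g k)"
    using exponent_ap[OF t] by auto
  have "t = ct g"
    by (rule func_ext[OF exponent_func[OF t] func_on_ct[OF g(1)]]) (simp add: g(2) ap_ct[OF g(1)])
  then show ?thesis using that g(1) by blast
qed

lemma func_on_RI_Ult: "func_on (pfst (psnd Ult)) Rs"
  and RI_Ult_iff: "R \<epsilon> Rs \<Longrightarrow> t \<epsilon> RI Ult R \<longleftrightarrow> (\<exists>g. g \<epsilon> PU \<^bold>^ rar L R \<and> t = ct g \<and> many (\<lambda>i. co g i \<epsilon> RI (Mi i) R))"
proof -
  define F where "F R = set_of {t. \<exists>g. g \<epsilon> PU \<^bold>^ rar L R \<and> t = ct g \<and> many (\<lambda>i. co g i \<epsilon> RI (Mi i) R)}" for R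
  have F: "tdf (\<lambda>e. F (e 0))" unfolding F_def by (intro dfn_intros)
  have "lam Rs (\<lambda>R. set_of {class_tuple I U M g | g.
           g \<in> elts (PU \<^bold>^ rel_arity L R) \<and>
           many (\<lambda>i. coordinate g i \<epsilon> rel_interp (M \<cdot> i) R)}) = lam Rs F"
  proof (rule lam_cong)
    fix R assume R: "R \<epsilon> Rs"
    have "many (\<lambda>i. coordinate g i \<epsilon> rel_interp (M \<cdot> i) R) \<longleftrightarrow> many (\<lambda>i. co g i \<epsilon> RI (Mi i) R)"
      if "g \<epsilon> PU \<^bold>^ rar L R" for g
      by (rule many_cong) (simp add: coordinate_eq[OF that] app_M rel_interp_eq[OF structure_M R])
    then show "set_of {class_tuple I U M g | g. g \<in> elts (PU \<^bold>^ rel_arity L R) \<and>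
           many (\<lambda>i. coordinate g i \<epsilon> rel_interp (M \<cdot> i) R)} = F R"
      unfolding F_def arity_eq(1)[OF R] mem_elts
      by (intro arg_cong[where f = set_of] Collect_cong ex_cong1) (auto simp: class_tuple_eq)
  qed
  then have eq: "pfst (psnd Ult) = lam Rs F"
    unfolding ultraproduct_def by simp
  show "func_on (pfst (psnd Ult)) Rs" unfolding eq by (rule func_on_lam[OF F])
  assume R: "R \<epsilon> Rs"
  then have "RI Ult R = F R" unfolding RI_def eq by (rule ap_lam[OF F])
  moreover have "small {t. \<exists>g. g \<epsilon> PU \<^bold>^ rar L R \<and> t = ct g \<and> many (\<lambda>i. co g i \<epsilon> RI (Mi i) R)}"
    by (rule small_Collect[of _ "univ Ult \<^bold>^ rar L R"]) (intro dfn_intros, use ct_mem in blast)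
  ultimately show "t \<epsilon> RI Ult R \<longleftrightarrow>
      (\<exists>g. g \<epsilon> PU \<^bold>^ rar L R \<and> t = ct g \<and> many (\<lambda>i. co g i \<epsilon> RI (Mi i) R))"
    by (simp add: F_def mem_set_of)
qed

lemma RI_Ult:
  assumes R: "R \<epsilon> Rs" and g: "g \<epsilon> PU \<^bold>^ rar L R"
  shows "ct g \<epsilon> RI Ult R \<longleftrightarrow> many (\<lambda>i. co g i \<epsilon> RI (Mi i) R)"
proof
  assume "ct g \<epsilon> RI Ult R"
  then obtain h where h: "h \<epsilon> PU \<^bold>^ rar L R" "ct g = ct h" "many (\<lambda>i. co h i \<epsilon> RI (Mi i) R)"
    unfolding RI_Ult_iff[OF R] by blast
  show "many (\<lambda>i. co g i \<epsilon> RI (Mi i) R)"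
    by (rule many_mono2[OF _ _ _ ct_eq[OF g h(1) arity_omega(1)[OF R] h(2)] h(3)])
      (intro dfn_intros, intro dfn_intros, intro dfn_intros, simp)
qed (use g RI_Ult_iff[OF R] in blast)

text \<open>The coordinatewise value of \<open>F\<close> at a tuple of representatives; its class is
  the value in the ultraproduct.\<close>

definition fv :: "'a \<Rightarrow> 'a \<Rightarrow> 'a" where
  "fv F g = lam I (\<lambda>i. ap (FI (Mi i) F) (co g i))"

lemma tdf_fv [dfn_intros]: "tdf s \<Longrightarrow> tdf t \<Longrightarrow> tdf (\<lambda>e. fv (s e) (t e))"
  by (rule tdf_subst2) (unfold fv_def, intro dfn_intros)

lemma
  assumes F: "F \<epsilon> Fs" and g: "g \<epsilon> PU \<^bold>^ far L F"
  shows fv_mem: "fv F g \<epsilon> PU"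
    and ap_fv: "i \<epsilon> I \<Longrightarrow> ap (fv F g) i = ap (FI (Mi i) F) (co g i)"
proof -
  have t: "tdf (\<lambda>e. ap (FI (Mi (e 0)) F) (co g (e 0)))" by (intro dfn_intros)
  show "fv F g \<epsilon> PU" unfolding fv_def
    by (rule PU_lam[OF t]) (rule exponent_ap[OF FI_mem[OF structure_M F] co_mem[OF g]])
  show "i \<epsilon> I \<Longrightarrow> ap (fv F g) i = ap (FI (Mi i) F) (co g i)"
    unfolding fv_def by (rule ap_lam[OF t])
qed

lemma func_on_FI_Ult: "func_on (psnd (psnd Ult)) Fs"
  and FI_Ult: "F \<epsilon> Fs \<Longrightarrow> g \<epsilon> PU \<^bold>^ far L F \<Longrightarrow> ap (FI Ult F) (ct g) = cl (fv F g)"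
  and FI_Ult_mem: "F \<epsilon> Fs \<Longrightarrow> FI Ult F \<epsilon> univ Ult \<^bold>^ (univ Ult \<^bold>^ far L F)"
proof -
  define G where "G F = set_of {p. \<exists>g. g \<epsilon> PU \<^bold>^ far L F \<and> p = \<langle>ct g, cl (fv F g)\<rangle>}" for F
  have G: "tdf (\<lambda>e. G (e 0))" unfolding G_def by (intro dfn_intros)
  have "lam Fs (\<lambda>F. set_of {\<langle>class_tuple I U M g,
             ultra_class I U M (lam I (\<lambda>i. fun_interp (M \<cdot> i) F \<cdot> coordinate g i))\<rangle> | g.
           g \<in> elts (PU \<^bold>^ fun_arity L F)}) = lam Fs G"
  proof (rule lam_cong)
    fix F assume F: "F \<epsilon> Fs"
    have "lam I (\<lambda>i. fun_interp (M \<cdot> i) F \<cdot> coordinate g i) = fv F g" if "g \<epsilon> PU \<^bold>^ far L F" for g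
      unfolding fv_def
      by (rule lam_cong) (simp add: coordinate_eq[OF that] app_M fun_interp_eq[OF structure_M F]
          exponent_app[OF FI_mem[OF structure_M F] co_mem[OF that]])
    then have "\<langle>class_tuple I U M g,
             ultra_class I U M (lam I (\<lambda>i. fun_interp (M \<cdot> i) F \<cdot> coordinate g i))\<rangle> =
        \<langle>ct g, cl (fv F g)\<rangle>" if "g \<epsilon> PU \<^bold>^ far L F" for g
      using that by (simp add: class_tuple_eq ultra_class_eq[OF fv_mem[OF F]])
    then show "set_of {\<langle>class_tuple I U M g,
             ultra_class I U M (lam I (\<lambda>i. fun_interp (M \<cdot> i) F \<cdot> coordinate g i))\<rangle> | g.
           g \<in> elts (PU \<^bold>^ fun_arity L F)} = G F"
      unfolding G_def arity_eq(2)[OF F] mem_elts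
      by (intro arg_cong[where f = set_of] Collect_cong) metis
  qed
  then have eq: "psnd (psnd Ult) = lam Fs G"
    unfolding ultraproduct_def by simp
  show "func_on (psnd (psnd Ult)) Fs" unfolding eq by (rule func_on_lam[OF G])
  have FG: "FI Ult F = G F" if "F \<epsilon> Fs" for F
    unfolding FI_def eq by (rule ap_lam[OF G that])
  have cl_mem: "cl f \<epsilon> univ Ult" if "f \<epsilon> PU" for f using that mem_univ_Ult by blast
  assume F: "F \<epsilon> Fs"
  have "small {p. \<exists>g. g \<epsilon> PU \<^bold>^ far L F \<and> p = \<langle>ct g, cl (fv F g)\<rangle>}"
    by (rule small_Collect[of _ "times (univ Ult \<^bold>^ far L F) (univ Ult)"])
      (intro dfn_intros, use ct_mem cl_mem fv_mem[OF F] in auto)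
  then have mem: "p \<epsilon> FI Ult F \<longleftrightarrow> (\<exists>g. g \<epsilon> PU \<^bold>^ far L F \<and> p = \<langle>ct g, cl (fv F g)\<rangle>)" for p
    by (simp add: FG[OF F] G_def mem_set_of)
  have fv_eq: "cl (fv F g) = cl (fv F h)"
    if g: "g \<epsilon> PU \<^bold>^ far L F" and h: "h \<epsilon> PU \<^bold>^ far L F" and eq: "ct g = ct h" for g h
    unfolding cl_eq[OF fv_mem[OF F g] fv_mem[OF F h]]
    by (rule many_mono[OF _ _ ct_eq[OF g h arity_omega(2)[OF F] eq]])
      (intro dfn_intros, intro dfn_intros, simp add: ap_fv[OF F g] ap_fv[OF F h])
  have pair: "\<langle>ct g, y\<rangle> \<epsilon> FI Ult F \<longleftrightarrow> y = cl (fv F g)" if "g \<epsilon> PU \<^bold>^ far L F" for g y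
    unfolding mem pair_inject using fv_eq[OF that] that by metis
  have ap: "ap (FI Ult F) (ct g) = cl (fv F g)" if "g \<epsilon> PU \<^bold>^ far L F" for g
    by (rule ap_eq(1)) (rule pair[OF that])
  then show "g \<epsilon> PU \<^bold>^ far L F \<Longrightarrow> ap (FI Ult F) (ct g) = cl (fv F g)" .
  have "func_on (FI Ult F) (univ Ult \<^bold>^ far L F)"
    unfolding func_on_iff
  proof (intro allI iffI)
    fix p assume "p \<epsilon> FI Ult F"
    then obtain g where "g \<epsilon> PU \<^bold>^ far L F" "p = \<langle>ct g, cl (fv F g)\<rangle>" unfolding mem by blast
    then show "\<exists>x. x \<epsilon> univ Ult \<^bold>^ far L F \<and> p = \<langle>x, ap (FI Ult F) x\<rangle>"
      using ct_mem ap by (intro exI[of _ "ct g"]) simp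
  next
    fix p assume "\<exists>x. x \<epsilon> univ Ult \<^bold>^ far L F \<and> p = \<langle>x, ap (FI Ult F) x\<rangle>"
    then obtain x where x: "x \<epsilon> univ Ult \<^bold>^ far L F" "p = \<langle>x, ap (FI Ult F) x\<rangle>" by blast
    obtain g where g: "g \<epsilon> PU \<^bold>^ far L F" "x = ct g" by (rule lift_tuple[OF arity_omega(2)[OF F] x(1)])
    then show "p \<epsilon> FI Ult F" using x(2) ap[OF g(1)] pair[OF g(1)] by simp
  qed
  moreover have "ap (FI Ult F) x \<epsilon> univ Ult" if x: "x \<epsilon> univ Ult \<^bold>^ far L F" for x
  proof -
    obtain g where g: "g \<epsilon> PU \<^bold>^ far L F" "x = ct g" by (rule lift_tuple[OF arity_omega(2)[OF F] x])
    then show ?thesis using ap cl_mem[OF fv_mem[OF F]] by simp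
  qed
  ultimately show "FI Ult F \<epsilon> univ Ult \<^bold>^ (univ Ult \<^bold>^ far L F)"
    unfolding mem_exponent[of "FI Ult F"] by blast
qed

lemma structure_Ult: "is_structure L Ult"
proof -
  obtain A r f where Ult: "Ult = \<langle>A, \<langle>r, f\<rangle>\<rangle>" and r: "func_on r Rs" and f: "func_on f Fs"
    using func_on_RI_Ult func_on_FI_Ult unfolding ultraproduct_def by simp
  have A: "A \<noteq> empty"
    using mem_univ_Ult ex_PU by (auto simp: Ult univ_def empty_iff)
  have "rel_interp Ult R = RI Ult R" if "R \<epsilon> Rs" for R
    using that r by (simp add: Ult rel_interp_def RI_def app_ap)
  moreover have "fun_interp Ult F = FI Ult F" if "F \<epsilon> Fs" for F
    using that f by (simp add: Ult fun_interp_def FI_def app_ap)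
  moreover have "t \<epsilon> univ Ult \<^bold>^ rar L R" if "R \<epsilon> Rs" "t \<epsilon> RI Ult R" for t R
    using that ct_mem unfolding RI_Ult_iff[OF that(1)] by blast
  ultimately show ?thesis
    unfolding is_structure_def using Ult A r f FI_Ult_mem by (auto simp: arity_eq)
qed


section \<open>From choice modulo the ultrafilter to the theorem of Los\<close>

lemma many_choice:
  assumes AC: "U_AC I U" and Q: "dfn (\<lambda>e. Q (e 0) (e (Suc 0)))"
    and many: "many (\<lambda>i. \<exists>a. a \<epsilon> univ (Mi i) \<and> Q i a)"
  shows "\<exists>f. f \<epsilon> PU \<and> many (\<lambda>i. Q i (ap f i))"
proof -
  \<comment> \<open>\<open>U_AC\<close> asks for a non-empty set at every index, but witnesses exist
    only in \<open>U\<close>-many coordinates. Where there is none, the whole universe is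
    offered.\<close>
  define B where "B i = set_of {a. a \<epsilon> univ (Mi i) \<and> ((\<exists>b. b \<epsilon> univ (Mi i) \<and> Q i b) \<longrightarrow> Q i a)}" for i
  have tB: "tdf (\<lambda>e. B (e 0))" unfolding B_def by (intro dfn_intros dfn_subst2[OF Q])
  have B: "a \<epsilon> B i \<longleftrightarrow> a \<epsilon> univ (Mi i) \<and> ((\<exists>b. b \<epsilon> univ (Mi i) \<and> Q i b) \<longrightarrow> Q i a)" for a i
  proof -
    have "small {a. a \<epsilon> univ (Mi i) \<and> ((\<exists>b. b \<epsilon> univ (Mi i) \<and> Q i b) \<longrightarrow> Q i a)}"
      by (rule small_Collect[of _ "univ (Mi i)"]) (intro dfn_intros dfn_subst2[OF Q], simp)
    then show ?thesis by (simp add: B_def mem_set_of)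
  qed
  have "func_on (lam I B) I" by (rule func_on_lam[OF tB])
  moreover have "lam I B \<cdot> i \<noteq> empty" if i: "i \<epsilon> I" for i
  proof -
    obtain c where "c \<epsilon> univ (Mi i)" using univ_not_empty[OF structure_M[OF i]] by blast
    then have "\<exists>a. a \<epsilon> B i" unfolding B by blast
    then show ?thesis using app_lam[OF tB i] by (auto simp: empty_iff)
  qed
  ultimately obtain f where f: "func_on f I" "many (\<lambda>i. f \<cdot> i \<epsilon> lam I B \<cdot> i)"
    using AC unfolding U_AC_def ball_elts by blast
  have iff: "f \<cdot> i \<epsilon> lam I B \<cdot> i \<longleftrightarrow> ap f i \<epsilon> B i" if "i \<epsilon> I" for i
    using that by (simp add: app_lam[OF tB] app_ap[OF f(1)])
  have fB: "many (\<lambda>i. ap f i \<epsilon> B i)" by (rule iffD1[OF many_cong[OF iff] f(2)])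
  \<comment> \<open>The function obtained may leave the universes outside a set in \<open>U\<close>.
    A given element of the product repairs it there.\<close>
  obtain h where h: "h \<epsilon> PU" using ex_PU by blast
  define F where "F i = (if ap f i \<epsilon> univ (Mi i) then ap f i else ap h i)" for i
  have tF: "tdf (\<lambda>e. F (e 0))" unfolding F_def by (intro dfn_intros)
  have "lam I F \<epsilon> PU" by (rule PU_lam[OF tF]) (simp add: F_def PU_ap[OF h])
  moreover have "many (\<lambda>i. Q i (ap (lam I F) i))"
  proof (rule many_mono2[OF _ _ _ fB many])
    fix i assume i: "i \<epsilon> I" and "ap f i \<epsilon> B i" "\<exists>a. a \<epsilon> univ (Mi i) \<and> Q i a"
    then show "Q i (ap (lam I F) i)" unfolding ap_lam[OF tF i] F_def B by simp
  qed (intro dfn_intros tdf_subst1[OF tB] dfn_subst2[OF Q])+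
  ultimately show ?thesis by blast
qed

lemma many_choice_iff:
  assumes AC: "U_AC I U" and Q: "dfn (\<lambda>e. Q (e 0) (e (Suc 0)))"
  shows "many (\<lambda>i. \<exists>a. a \<epsilon> univ (Mi i) \<and> Q i a) \<longleftrightarrow> (\<exists>f. f \<epsilon> PU \<and> many (\<lambda>i. Q i (ap f i)))"
proof
  assume "\<exists>f. f \<epsilon> PU \<and> many (\<lambda>i. Q i (ap f i))"
  then obtain f where f: "f \<epsilon> PU" "many (\<lambda>i. Q i (ap f i))" by blast
  show "many (\<lambda>i. \<exists>a. a \<epsilon> univ (Mi i) \<and> Q i a)"
    by (rule many_mono[OF _ _ f(2)])
      (intro dfn_intros dfn_subst2[OF Q], intro dfn_intros dfn_subst2[OF Q], use PU_ap[OF f(1)] in blast)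
qed (rule many_choice[OF AC Q])

text \<open>A representative of the value that the term has in the ultraproduct under the assignment
  \<open>ct r\<close>.\<close>

definition tv :: "'a \<Rightarrow> 'a \<Rightarrow> 'a" where
  "tv r t = lam I (\<lambda>i. val (Mi i) (co r i) t)"

lemma tdf_tv [dfn_intros]: "tdf s \<Longrightarrow> tdf t \<Longrightarrow> tdf (\<lambda>e. tv (s e) (t e))"
  by (rule tdf_subst2) (unfold tv_def, intro dfn_intros)

lemma
  assumes r: "r \<epsilon> PU \<^bold>^ X" and t: "t \<epsilon> terms L X"
  shows tv_mem: "tv r t \<epsilon> PU" and ap_tv: "i \<epsilon> I \<Longrightarrow> ap (tv r t) i = val (Mi i) (co r i) t"
proof -
  have d: "tdf (\<lambda>e. val (Mi (e 0)) (co r (e 0)) t)" by (intro dfn_intros)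
  show "tv r t \<epsilon> PU" unfolding tv_def
    by (rule PU_lam[OF d]) (rule val_mem[OF structure_M co_mem[OF r] t])
  show "i \<epsilon> I \<Longrightarrow> ap (tv r t) i = val (Mi i) (co r i) t"
    unfolding tv_def by (rule ap_lam[OF d])
qed

definition tvs :: "'a \<Rightarrow> 'a \<Rightarrow> 'a \<Rightarrow> 'a" where
  "tvs r n u = lam n (\<lambda>k. tv r (ap u k))"

lemma
  assumes r: "r \<epsilon> PU \<^bold>^ X" and u: "u \<epsilon> terms L X \<^bold>^ n"
  shows tvs_mem: "tvs r n u \<epsilon> PU \<^bold>^ n"
    and ct_tvs: "ct (tvs r n u) = lam n (\<lambda>k. cl (tv r (ap u k)))"
    and co_tvs: "i \<epsilon> I \<Longrightarrow> co (tvs r n u) i = lam n (\<lambda>k. val (Mi i) (co r i) (ap u k))"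
proof -
  have d: "tdf (\<lambda>e. tv r (ap u (e 0)))" by (intro dfn_intros)
  show m: "tvs r n u \<epsilon> PU \<^bold>^ n"
    unfolding tvs_def by (rule lam_mem_exponent[OF d]) (rule tv_mem[OF r exponent_ap[OF u]])
  have a: "ap (tvs r n u) k = tv r (ap u k)" if "k \<epsilon> n" for k
    unfolding tvs_def by (rule ap_lam[OF d that])
  show "ct (tvs r n u) = lam n (\<lambda>k. cl (tv r (ap u k)))"
    unfolding ct_def exponent_dom[OF m] by (rule lam_cong) (simp add: a)
  show "co (tvs r n u) i = lam n (\<lambda>k. val (Mi i) (co r i) (ap u k))" if "i \<epsilon> I"
    unfolding co_def exponent_dom[OF m]
    by (rule lam_cong) (simp add: a ap_tv[OF r exponent_ap[OF u] that] co_def)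
qed

text \<open>The theorem of Los for terms is already true in ZF, because function symbols are
  interpreted coordinatewise and no witness has to be found.\<close>

lemma val_Ult:
  assumes r: "r \<epsilon> PU \<^bold>^ X" and t: "t \<epsilon> terms L X"
  shows "val Ult (ct r) t = cl (tv r t)"
  using t
proof (induction rule: terms_induct)
  case dfn
  show ?case by (intro dfn_intros)
next
  case (var x)
  have rx: "ap r x \<epsilon> PU" by (rule exponent_ap[OF r var])
  have "val Ult (ct r) (tm_var x) = cl (ap r x)"
    using val_var[OF structure_Ult ct_mem[OF r] var] ap_ct[OF r var] by simp
  moreover have "ap (ap r x) i = ap (tv r (tm_var x)) i" if "i \<epsilon> I" for i
    using ap_tv[OF r terms_var[OF var] that] val_var[OF structure_M[OF that] co_mem[OF r that] var]
      ap_co[OF r var] by simp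
  then have "cl (ap r x) = cl (tv r (tm_var x))"
    unfolding cl_eq[OF rx tv_mem[OF r terms_var[OF var]]] by (rule many_all)
  ultimately show ?case by simp
next
  case (app F u)
  note u = app(2)
  have "val Ult (ct r) (tm_app F u) = ap (FI Ult F) (lam (far L F) (\<lambda>k. val Ult (ct r) (ap u k)))"
    by (rule val_app[OF structure_Ult ct_mem[OF r] app(1,2)])
  also have "lam (far L F) (\<lambda>k. val Ult (ct r) (ap u k)) = ct (tvs r (far L F) u)"
    unfolding ct_tvs[OF r u] by (rule lam_cong) (rule app(3))
  also have "ap (FI Ult F) (ct (tvs r (far L F) u)) = cl (fv F (tvs r (far L F) u))"
    by (rule FI_Ult[OF app(1) tvs_mem[OF r u]])
  also have "\<dots> = cl (tv r (tm_app F u))"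
    unfolding cl_eq[OF fv_mem[OF app(1) tvs_mem[OF r u]] tv_mem[OF r terms_app[OF app(1) u]]]
  proof (rule many_all)
    fix i assume i: "i \<epsilon> I"
    show "ap (fv F (tvs r (far L F) u)) i = ap (tv r (tm_app F u)) i"
      unfolding ap_fv[OF app(1) tvs_mem[OF r u] i] ap_tv[OF r terms_app[OF app(1) u] i]
        co_tvs[OF r u i] val_app[OF structure_M[OF i] co_mem[OF r i] app(1) u] ..
  qed
  finally show ?case .
qed

lemma
  assumes r: "r \<epsilon> PU \<^bold>^ X" and f: "f \<epsilon> PU"
  shows upd_PU: "upd r x f \<epsilon> PU \<^bold>^ adjoin X x"
    and ct_upd: "ct (upd r x f) = upd (ct r) x (cl f)"
    and co_upd: "i \<epsilon> I \<Longrightarrow> co (upd r x f) i = upd (co r i) x (ap f i)"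
proof -
  show m: "upd r x f \<epsilon> PU \<^bold>^ adjoin X x" by (rule upd_mem[OF r f])
  have clf: "cl f \<epsilon> univ Ult" using f mem_univ_Ult by blast
  note a = ap_upd[OF r] ap_upd[OF ct_mem[OF r]]
  show "ct (upd r x f) = upd (ct r) x (cl f)"
  proof (rule func_ext)
    show "func_on (ct (upd r x f)) (adjoin X x)" by (rule func_on_ct[OF m])
    show "func_on (upd (ct r) x (cl f)) (adjoin X x)"
      by (rule exponent_func[OF upd_mem[OF ct_mem[OF r] clf]])
    fix y assume y: "y \<epsilon> adjoin X x"
    then have "y = x \<or> y \<epsilon> X" by simp
    then show "ap (ct (upd r x f)) y = ap (upd (ct r) x (cl f)) y"
      using ap_ct[OF m y] a[of y x] ap_ct[OF r, of y] by auto
  qed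
  show "co (upd r x f) i = upd (co r i) x (ap f i)" if i: "i \<epsilon> I"
  proof (rule func_ext)
    show "func_on (co (upd r x f) i) (adjoin X x)" by (rule exponent_func[OF co_mem[OF m i]])
    show "func_on (upd (co r i) x (ap f i)) (adjoin X x)"
      by (rule exponent_func[OF upd_mem[OF co_mem[OF r i] PU_ap[OF f i]]])
    fix y assume y: "y \<epsilon> adjoin X x"
    then have "y = x \<or> y \<epsilon> X" by simp
    then show "ap (co (upd r x f) i) y = ap (upd (co r i) x (ap f i)) y"
      using ap_co[OF m y] ap_upd[OF r, of y x] ap_upd[OF co_mem[OF r i], of y x] ap_co[OF r, of y] by auto
  qed
qed

lemma Los_atomic:
  assumes X: "elts X \<subseteq> elts \<omega>" and q: "is_atomic L X q" and r: "r \<epsilon> PU \<^bold>^ X"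
  shows "sat_at Ult (ct r) q \<longleftrightarrow> many (\<lambda>i. sat_at (Mi i) (co r i) q)"
proof -
  from q consider u v where "u \<epsilon> terms L X" "v \<epsilon> terms L X" "q = fm_eq u v" |
    R u where "R \<epsilon> Rs" "u \<epsilon> terms L X \<^bold>^ rar L R" "q = fm_rel R u"
    unfolding is_atomic_iff by blast
  then show ?thesis
  proof cases
    case 1
    have "sat_at Ult (ct r) q \<longleftrightarrow> many (\<lambda>i. ap (tv r u) i = ap (tv r v) i)"
      unfolding 1(3) sat_at_eq val_Ult[OF r 1(1)] val_Ult[OF r 1(2)]
        cl_eq[OF tv_mem[OF r 1(1)] tv_mem[OF r 1(2)]] ..
    also have "\<dots> \<longleftrightarrow> many (\<lambda>i. sat_at (Mi i) (co r i) q)"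
      by (rule many_cong) (simp add: 1(3) ap_tv[OF r 1(1)] ap_tv[OF r 1(2)])
    finally show ?thesis .
  next
    case 2
    have "lam (rar L R) (\<lambda>k. val Ult (ct r) (ap u k)) = ct (tvs r (rar L R) u)"
      unfolding ct_tvs[OF r 2(2)] by (rule lam_cong) (rule val_Ult[OF r exponent_ap[OF 2(2)]])
    then have "sat_at Ult (ct r) q \<longleftrightarrow> many (\<lambda>i. co (tvs r (rar L R) u) i \<epsilon> RI (Mi i) R)"
      unfolding 2(3) sat_at_rel[OF 2(2)] using RI_Ult[OF 2(1) tvs_mem[OF r 2(2)]] by simp
    also have "\<dots> \<longleftrightarrow> many (\<lambda>i. sat_at (Mi i) (co r i) q)"
      by (rule many_cong) (simp add: 2(3) sat_at_rel[OF 2(2)] co_tvs[OF r 2(2)])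
    finally show ?thesis .
  qed
qed

text \<open>The quantifier over \<open>r\<close> belongs to the induction hypothesis, since the
  quantifier steps prolong \<open>r\<close> by a representative. Choice enters only in these steps,
  through \<open>many_choice_iff\<close>.\<close>

theorem Los:
  assumes AC: "U_AC I U" and p: "is_formula L X p"
  shows "\<forall>r\<in>elts (PU \<^bold>^ X). sat Ult p (ct r) \<longleftrightarrow> many (\<lambda>i. sat (Mi i) p (co r i))"
  using p
proof (induction rule: formula_induct)
  case dfn
  show ?case by (intro dfn_intros)
next
  case (atomic X p)
  show ?case
  proof
    fix r assume "r \<in> elts (PU \<^bold>^ X)"
    then have r: "r \<epsilon> PU \<^bold>^ X" by simp
    have "sat Ult p (ct r) \<longleftrightarrow> many (\<lambda>i. sat_at (Mi i) (co r i) p)"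
      unfolding sat_atomic[OF ct_mem[OF r] atomic] by (rule Los_atomic[OF atomic r])
    also have "\<dots> \<longleftrightarrow> many (\<lambda>i. sat (Mi i) p (co r i))"
      by (rule many_cong) (rule sat_atomic[OF co_mem[OF r] atomic, symmetric])
    finally show "sat Ult p (ct r) \<longleftrightarrow> many (\<lambda>i. sat (Mi i) p (co r i))" .
  qed
next
  case (neg X p)
  show ?case
  proof
    fix r assume "r \<in> elts (PU \<^bold>^ X)"
    then have r: "r \<epsilon> PU \<^bold>^ X" by simp
    have d: "dfn (\<lambda>e. sat (Mi (e 0)) p (co r (e 0)))" by (intro dfn_intros)
    have "many (\<lambda>i. sat (Mi i) (fm_neg p) (co r i)) \<longleftrightarrow> many (\<lambda>i. \<not> sat (Mi i) p (co r i))"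
      by (rule many_cong) (rule sat_neg[OF co_mem[OF r] neg(1)])
    then show "sat Ult (fm_neg p) (ct r) \<longleftrightarrow> many (\<lambda>i. sat (Mi i) (fm_neg p) (co r i))"
      unfolding many_not[OF d] sat_neg[OF ct_mem[OF r] neg(1)] using neg(2) r by simp
  qed
next
  case (conj X p q)
  show ?case
  proof
    fix r assume "r \<in> elts (PU \<^bold>^ X)"
    then have r: "r \<epsilon> PU \<^bold>^ X" by simp
    have d: "dfn (\<lambda>e. sat (Mi (e 0)) p (co r (e 0)))" for p by (intro dfn_intros)
    have "many (\<lambda>i. sat (Mi i) (fm_and p q) (co r i)) \<longleftrightarrow>
        many (\<lambda>i. sat (Mi i) p (co r i) \<and> sat (Mi i) q (co r i))"
      by (rule many_cong) (rule sat_and[OF co_mem[OF r] conj(1,2)])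
    then show "sat Ult (fm_and p q) (ct r) \<longleftrightarrow> many (\<lambda>i. sat (Mi i) (fm_and p q) (co r i))"
      unfolding many_conj_iff[OF d d] sat_and[OF ct_mem[OF r] conj(1,2)] using conj(3,4) r by simp
  qed
next
  case (ex X x p)
  show ?case
  proof
    fix r assume "r \<in> elts (PU \<^bold>^ X)"
    then have r: "r \<epsilon> PU \<^bold>^ X" by simp
    have d: "dfn (\<lambda>e. sat (Mi (e 0)) p (upd (co r (e 0)) x (e (Suc 0))))" by (intro dfn_intros)
    have "sat Ult (fm_ex x p) (ct r) \<longleftrightarrow> (\<exists>f. f \<epsilon> PU \<and> sat Ult p (upd (ct r) x (cl f)))"
      unfolding sat_ex[OF ct_mem[OF r] ex(2)] mem_univ_Ult by blast
    also have "\<dots> \<longleftrightarrow> (\<exists>f. f \<epsilon> PU \<and> many (\<lambda>i. sat (Mi i) p (upd (co r i) x (ap f i))))"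
    proof -
      have "sat Ult p (upd (ct r) x (cl f)) \<longleftrightarrow> many (\<lambda>i. sat (Mi i) p (upd (co r i) x (ap f i)))"
        if f: "f \<epsilon> PU" for f
      proof -
        have "sat Ult p (upd (ct r) x (cl f)) \<longleftrightarrow> many (\<lambda>i. sat (Mi i) p (co (upd r x f) i))"
          using bspec[OF ex(3), of "upd r x f", unfolded mem_elts, OF upd_PU[OF r f]]
          unfolding ct_upd[OF r f] .
        also have "\<dots> \<longleftrightarrow> many (\<lambda>i. sat (Mi i) p (upd (co r i) x (ap f i)))"
          by (rule many_cong) (simp add: co_upd[OF r f])
        finally show ?thesis .
      qed
      then show ?thesis by blast
    qed
    also have "\<dots> \<longleftrightarrow> many (\<lambda>i. \<exists>a. a \<epsilon> univ (Mi i) \<and> sat (Mi i) p (upd (co r i) x a))"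
      by (rule many_choice_iff[OF AC d, symmetric])
    also have "\<dots> \<longleftrightarrow> many (\<lambda>i. sat (Mi i) (fm_ex x p) (co r i))"
      by (rule many_cong) (rule sat_ex[OF co_mem[OF r] ex(2), symmetric])
    finally show "sat Ult (fm_ex x p) (ct r) \<longleftrightarrow> many (\<lambda>i. sat (Mi i) (fm_ex x p) (co r i))" .
  qed
next
  case (all X x p)
  show ?case
  proof
    fix r assume "r \<in> elts (PU \<^bold>^ X)"
    then have r: "r \<epsilon> PU \<^bold>^ X" by simp
    have d: "dfn (\<lambda>e. \<not> sat (Mi (e 0)) p (upd (co r (e 0)) x (e (Suc 0))))" by (intro dfn_intros)
    \<comment> \<open>The universal step is the existential step for counterexamples: both sides are
      negated, and \<open>U\<close> being an ultrafilter turns the negations back.\<close>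
    have "\<not> sat Ult (fm_all x p) (ct r) \<longleftrightarrow> (\<exists>f. f \<epsilon> PU \<and> \<not> sat Ult p (upd (ct r) x (cl f)))"
      unfolding sat_all[OF ct_mem[OF r] all(2)] mem_univ_Ult by blast
    also have "\<dots> \<longleftrightarrow> (\<exists>f. f \<epsilon> PU \<and> many (\<lambda>i. \<not> sat (Mi i) p (upd (co r i) x (ap f i))))"
    proof -
      have "\<not> sat Ult p (upd (ct r) x (cl f)) \<longleftrightarrow> many (\<lambda>i. \<not> sat (Mi i) p (upd (co r i) x (ap f i)))"
        if f: "f \<epsilon> PU" for f
      proof -
        have d: "dfn (\<lambda>e. sat (Mi (e 0)) p (upd (co r (e 0)) x (ap f (e 0))))" by (intro dfn_intros)
        have "sat Ult p (upd (ct r) x (cl f)) \<longleftrightarrow> many (\<lambda>i. sat (Mi i) p (co (upd r x f) i))"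
          using bspec[OF all(3), of "upd r x f", unfolded mem_elts, OF upd_PU[OF r f]]
          unfolding ct_upd[OF r f] .
        also have "\<dots> \<longleftrightarrow> many (\<lambda>i. sat (Mi i) p (upd (co r i) x (ap f i)))"
          by (rule many_cong) (simp add: co_upd[OF r f])
        finally show ?thesis unfolding many_not[OF d] by simp
      qed
      then show ?thesis by blast
    qed
    also have "\<dots> \<longleftrightarrow> many (\<lambda>i. \<exists>a. a \<epsilon> univ (Mi i) \<and> \<not> sat (Mi i) p (upd (co r i) x a))"
      by (rule many_choice_iff[OF AC d, symmetric])
    also have "\<dots> \<longleftrightarrow> many (\<lambda>i. \<not> sat (Mi i) (fm_all x p) (co r i))"
      by (rule many_cong) (use sat_all[OF co_mem[OF r] all(2)] in blast)
    also have "\<dots> \<longleftrightarrow> \<not> many (\<lambda>i. sat (Mi i) (fm_all x p) (co r i))"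
      by (rule many_not) (intro dfn_intros)
    finally show "sat Ult (fm_all x p) (ct r) \<longleftrightarrow> many (\<lambda>i. sat (Mi i) (fm_all x p) (co r i))" by blast
  qed
qed

lemma Los_sentence:
  assumes AC: "U_AC I U" and p: "is_formula L empty p"
  shows "sat Ult p empty \<longleftrightarrow> many (\<lambda>i. sat (Mi i) p empty)"
proof -
  have r: "empty \<epsilon> PU \<^bold>^ empty" by (rule empty_exponent)
  have e: "f = empty" if "func_on f empty" for f :: 'a
    using that by (simp add: func_on_iff empty_iff)
  have "ct empty = empty" by (rule e) (rule func_on_ct[OF r])
  moreover have "co empty i = empty" if "i \<epsilon> I" for i
    by (rule e) (rule exponent_func[OF co_mem[OF r that]])
  then have "many (\<lambda>i. sat (Mi i) p (co empty i)) \<longleftrightarrow> many (\<lambda>i. sat (Mi i) p empty)"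
    by (intro many_cong) simp
  ultimately show ?thesis using bspec[OF Los[OF AC p], of empty, unfolded mem_elts, OF r] by simp
qed

text \<open>A truth value that does not depend on the index holds everywhere or nowhere, and
  \<open>U\<close> contains \<open>I\<close> but not the empty set.\<close>

lemma Los_const:
  assumes AC: "U_AC I U" and p: "is_formula L empty p" and i: "i \<epsilon> I"
    and "\<And>j. j \<epsilon> I \<Longrightarrow> sat (Mi j) p empty \<longleftrightarrow> sat (Mi i) p empty"
  shows "sat Ult p empty \<longleftrightarrow> sat (Mi i) p empty"
proof -
  have "many (\<lambda>j. sat (Mi j) p empty) \<longleftrightarrow> many (\<lambda>j. sat (Mi i) p empty)"
    by (rule many_cong) (rule assms(4))
  also have "\<dots> \<longleftrightarrow> sat (Mi i) p empty"
    using many_ex[of "\<lambda>j. sat (Mi i) p empty"] many_all[of "\<lambda>j. sat (Mi i) p empty"] by blast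
  finally show ?thesis unfolding Los_sentence[OF AC p] .
qed

end

section \<open>Ultraproducts of isomorphic structures\<close>

lemma (in ultra) many_iff:
  assumes "dfn (\<lambda>e. K (e 0))" "dfn (\<lambda>e. P (e 0))" "dfn (\<lambda>e. Q (e 0))" "many K"
    "\<And>i. i \<epsilon> I \<Longrightarrow> K i \<Longrightarrow> P i \<longleftrightarrow> Q i"
  shows "many P \<longleftrightarrow> many Q"
proof
  show "many P \<Longrightarrow> many Q"
    by (rule many_mono2[OF assms(1,2,3,4)]) (use assms(5) in auto)
  show "many Q \<Longrightarrow> many P"
    by (rule many_mono2[OF assms(1,3,2,4)]) (use assms(5) in auto)
qed

text \<open>Composition of \<open>h\<close> with a tuple of length \<open>n\<close>. With the length
  as an argument and \<open>ap\<close> as application it is definable.\<close>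

definition push :: "'a::zf \<Rightarrow> 'a \<Rightarrow> 'a \<Rightarrow> 'a" where
  "push h n t = lam n (\<lambda>k. ap h (ap t k))"

lemma tdf_push [dfn_intros]:
  "tdf s \<Longrightarrow> tdf t \<Longrightarrow> tdf u \<Longrightarrow> tdf (\<lambda>e. push (s e) (t e) (u e))"
  unfolding push_def by (intro dfn_intros; (assumption | erule tdf_shift))

lemma compose_push:
  "t \<epsilon> A \<^bold>^ n \<Longrightarrow> h \<epsilon> B \<^bold>^ A \<Longrightarrow> h \<odot> t = push h (n :: 'a::zf) t"
  unfolding push_def by (intro compose_eq) (auto simp: mem_exponent)

lemma push_mem: "t \<epsilon> A \<^bold>^ n \<Longrightarrow> h \<epsilon> B \<^bold>^ A \<Longrightarrow> push h (n :: 'a::zf) t \<epsilon> B \<^bold>^ n"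
  using compose_push compose_mem by metis

context lang
begin

definition iso :: "'a \<Rightarrow> 'a \<Rightarrow> 'a \<Rightarrow> bool" where
  "iso M N h \<longleftrightarrow> h \<epsilon> univ N \<^bold>^ univ M \<and>
     (\<forall>b\<in>elts (univ N). \<exists>!a. a \<epsilon> univ M \<and> ap h a = b) \<and>
     (\<forall>R\<in>elts Rs. \<forall>t\<in>elts (univ M \<^bold>^ rar L R). t \<epsilon> RI M R \<longleftrightarrow> push h (rar L R) t \<epsilon> RI N R) \<and>
     (\<forall>F\<in>elts Fs. \<forall>t\<in>elts (univ M \<^bold>^ far L F).
        ap h (ap (FI M F) t) = ap (FI N F) (push h (far L F) t))"

lemma dfn_iso [dfn_intros]: "tdf s \<Longrightarrow> tdf t \<Longrightarrow> tdf u \<Longrightarrow> dfn (\<lambda>e. iso (s e) (t e) (u e))"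
  by (rule dfn_subst3) (unfold iso_def, intro dfn_intros)

lemma is_isomorphism_iff:
  assumes M: "is_structure L M" and N: "is_structure L N"
  shows "is_isomorphism L M N h \<longleftrightarrow> iso M N h"
proof (cases "h \<epsilon> univ N \<^bold>^ univ M")
  case h: True
  have "(\<forall>b\<in>elts (univ N). \<exists>!a. a \<epsilon> univ M \<and> h \<cdot> a = b) \<longleftrightarrow>
      (\<forall>b\<in>elts (univ N). \<exists>!a. a \<epsilon> univ M \<and> ap h a = b)"
    by (simp add: exponent_app[OF h] cong: conj_cong)
  moreover have "(\<forall>R\<in>elts Rs. \<forall>t\<in>elts (univ M \<^bold>^ rel_arity L R).
        t \<epsilon> rel_interp M R \<longleftrightarrow> (h \<odot> t) \<epsilon> rel_interp N R) \<longleftrightarrow>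
      (\<forall>R\<in>elts Rs. \<forall>t\<in>elts (univ M \<^bold>^ rar L R). t \<epsilon> RI M R \<longleftrightarrow> push h (rar L R) t \<epsilon> RI N R)"
    by (simp add: arity_eq rel_interp_eq[OF M] rel_interp_eq[OF N] compose_push[OF _ h])
  moreover have "h \<cdot> (fun_interp M F \<cdot> t) = fun_interp N F \<cdot> (h \<odot> t) \<longleftrightarrow>
      ap h (ap (FI M F) t) = ap (FI N F) (push h (far L F) t)"
    if F: "F \<epsilon> Fs" and t: "t \<epsilon> univ M \<^bold>^ far L F" for F t
    unfolding fun_interp_eq[OF M F] fun_interp_eq[OF N F] compose_push[OF t h]
      exponent_app[OF FI_mem[OF M F] t] exponent_app[OF FI_mem[OF N F] push_mem[OF t h]]
      exponent_app[OF h exponent_ap[OF FI_mem[OF M F] t]] ..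
  then have "(\<forall>F\<in>elts Fs. \<forall>t\<in>elts (univ M \<^bold>^ fun_arity L F).
        h \<cdot> (fun_interp M F \<cdot> t) = fun_interp N F \<cdot> (h \<odot> t)) \<longleftrightarrow>
      (\<forall>F\<in>elts Fs. \<forall>t\<in>elts (univ M \<^bold>^ far L F).
        ap h (ap (FI M F) t) = ap (FI N F) (push h (far L F) t))"
    by (simp add: arity_eq)
  ultimately show ?thesis unfolding is_isomorphism_def iso_def by simp
qed (simp add: is_isomorphism_def iso_def)

end

lemma isomorphic_ultraproducts:
  fixes L I U M N :: "'a::zf"
  assumes L: "is_language L" and U: "ultrafilter_over I U" and AC: "U_AC I U"
    and M: "is_family L I M" and N: "is_family L I N"
    and iso: "\<And>i. i \<epsilon> I \<Longrightarrow> isomorphic L (M \<cdot> i) (N \<cdot> i)"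
    and nM: "product_univ I M \<noteq> empty" and nN: "product_univ I N \<noteq> empty"
  shows "isomorphic L (ultraproduct L I U M) (ultraproduct L I U N)"
proof -
  interpret A: ultra_family L I U M by unfold_locales (fact assms)+
  interpret B: ultra_family L I U N by unfold_locales (fact assms)+
  let ?iso = "\<lambda>i h. A.iso (ap M i) (ap N i) h"
  \<comment> \<open>The family to which \<open>U_AC\<close> is applied. Definability of the notion
    of isomorphism makes it a function in the model.\<close>
  define Hs where "Hs i = set_of {h. ?iso i h}" for i
  have tHs: "tdf (\<lambda>e. Hs (e 0))" unfolding Hs_def by (intro dfn_intros A.dfn_iso)
  have Hs: "h \<epsilon> Hs i \<longleftrightarrow> ?iso i h" for h i
  proof -
    have "small {h. ?iso i h}"
      by (rule small_Collect[of _ "univ (ap N i) \<^bold>^ univ (ap M i)"])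
        (intro dfn_intros A.dfn_iso, simp add: A.iso_def)
    then show ?thesis by (simp add: Hs_def mem_set_of)
  qed
  have "func_on (lam I Hs) I" by (rule func_on_lam[OF tHs])
  moreover have "lam I Hs \<cdot> i \<noteq> empty" if i: "i \<epsilon> I" for i
  proof -
    have "\<exists>h. is_isomorphism L (ap M i) (ap N i) h"
      using iso[OF i] unfolding isomorphic_def A.app_M[OF i] B.app_M[OF i] .
    then have "\<exists>h. h \<epsilon> Hs i"
      unfolding Hs A.is_isomorphism_iff[OF A.structure_M[OF i] B.structure_M[OF i]] .
    then show ?thesis using app_lam[OF tHs i] by (auto simp: empty_iff)
  qed
  ultimately obtain H where H: "func_on H I" "A.many (\<lambda>i. H \<cdot> i \<epsilon> lam I Hs \<cdot> i)"
    using AC unfolding U_AC_def ball_elts by blast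
  have iff: "H \<cdot> i \<epsilon> lam I Hs \<cdot> i \<longleftrightarrow> ?iso i (ap H i)" if "i \<epsilon> I" for i
    using that by (simp add: app_lam[OF tHs] app_ap[OF H(1)] Hs)
  have mH: "A.many (\<lambda>i. ?iso i (ap H i))" by (rule iffD1[OF A.many_cong[OF iff] H(2)])
  have dH: "dfn (\<lambda>e. ?iso (e 0) (ap H (e 0)))" by (intro dfn_intros A.dfn_iso)
  obtain h0 where h0: "h0 \<epsilon> product_univ I N" using B.ex_PU by blast
  \<comment> \<open>Off the coordinates where \<open>H\<close> gives an isomorphism its values are
    arbitrary; falling back to \<open>h0\<close> keeps the image inside the product.\<close>
  define \<theta> where "\<theta> f = lam I (\<lambda>i. if ap (ap H i) (ap f i) \<epsilon> univ (ap N i)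
    then ap (ap H i) (ap f i) else ap h0 i)" for f
  have t\<theta>: "tdf (\<lambda>e. \<theta> (e 0))" unfolding \<theta>_def by (intro dfn_intros)
  have t\<theta>': "tdf (\<lambda>e. if ap (ap H (e 0)) (ap f (e 0)) \<epsilon> univ (ap N (e 0))
    then ap (ap H (e 0)) (ap f (e 0)) else ap h0 (e 0))" for f by (intro dfn_intros)
  have \<theta>: "\<theta> f \<epsilon> product_univ I N" for f
    unfolding \<theta>_def by (rule B.PU_lam[OF t\<theta>']) (simp add: B.PU_ap[OF h0])
  have ap_\<theta>: "ap (\<theta> f) i = ap (ap H i) (ap f i)"
    if f: "f \<epsilon> product_univ I M" and i: "i \<epsilon> I" and h: "?iso i (ap H i)" for f i
    unfolding \<theta>_def ap_lam[OF t\<theta>' i]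
    using h exponent_ap[of "ap H i" "univ (ap N i)" "univ (ap M i)", OF _ A.PU_ap[OF f i]]
    by (simp add: A.iso_def)
  have inj: "a = b" if h: "?iso i h" and ab: "a \<epsilon> univ (ap M i)" "b \<epsilon> univ (ap M i)" "ap h a = ap h b"
    for i h a b
  proof -
    have "ap h a \<epsilon> univ (ap N i)" using h ab(1) exponent_ap unfolding A.iso_def by blast
    then have "\<exists>!c. c \<epsilon> univ (ap M i) \<and> ap h c = ap h a"
      using h unfolding A.iso_def ball_elts by blast
    then show ?thesis using ab by auto
  qed
  have \<theta>_iff: "B.cl (\<theta> f) = B.cl (\<theta> g) \<longleftrightarrow> A.cl f = A.cl g"
    if f: "f \<epsilon> product_univ I M" and g: "g \<epsilon> product_univ I M" for f g
    unfolding A.cl_eq[OF f g] B.cl_eq[OF \<theta> \<theta>]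
  proof (rule A.many_iff[OF dH _ _ mH])
    fix i assume i: "i \<epsilon> I" and h: "?iso i (ap H i)"
    show "ap (\<theta> f) i = ap (\<theta> g) i \<longleftrightarrow> ap f i = ap g i"
      unfolding ap_\<theta>[OF f i h] ap_\<theta>[OF g i h]
      using inj[OF h A.PU_ap[OF f i] A.PU_ap[OF g i]] by auto
  qed (intro dfn_intros)+
  have clA: "A.cl f \<epsilon> univ A.Ult" if "f \<epsilon> product_univ I M" for f
    using that A.mem_univ_Ult by blast
  have clB: "B.cl f \<epsilon> univ B.Ult" if "f \<epsilon> product_univ I N" for f
    using that B.mem_univ_Ult by blast
  define G where "G = set_of {p. \<exists>f. f \<epsilon> product_univ I M \<and> p = \<langle>A.cl f, B.cl (\<theta> f)\<rangle>}"
  have "small {p. \<exists>f. f \<epsilon> product_univ I M \<and> p = \<langle>A.cl f, B.cl (\<theta> f)\<rangle>}"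
    by (rule small_Collect[of _ "times (univ A.Ult) (univ B.Ult)"])
      (intro dfn_intros A.tdf_cl B.tdf_cl tdf_subst1[OF t\<theta>],
        use clA clB[OF \<theta>] in auto)
  then have G: "p \<epsilon> G \<longleftrightarrow> (\<exists>f. f \<epsilon> product_univ I M \<and> p = \<langle>A.cl f, B.cl (\<theta> f)\<rangle>)" for p
    by (simp add: G_def mem_set_of)
  have G_pair: "\<langle>A.cl f, y\<rangle> \<epsilon> G \<longleftrightarrow> y = B.cl (\<theta> f)" if "f \<epsilon> product_univ I M" for f y
    unfolding G pair_inject using \<theta>_iff[OF that] that by metis
  have ap_G: "ap G (A.cl f) = B.cl (\<theta> f)" if "f \<epsilon> product_univ I M" for f
    by (rule ap_eq(1)) (rule G_pair[OF that])
  have G_func: "func_on G (univ A.Ult)"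
    unfolding func_on_iff A.mem_univ_Ult
  proof (intro allI iffI)
    fix p assume "p \<epsilon> G"
    then obtain f where "f \<epsilon> product_univ I M" "p = \<langle>A.cl f, B.cl (\<theta> f)\<rangle>" unfolding G by blast
    then show "\<exists>x. (\<exists>f. f \<epsilon> product_univ I M \<and> x = A.cl f) \<and> p = \<langle>x, ap G x\<rangle>"
      using ap_G by auto
  next
    fix p assume "\<exists>x. (\<exists>f. f \<epsilon> product_univ I M \<and> x = A.cl f) \<and> p = \<langle>x, ap G x\<rangle>"
    then obtain f where "f \<epsilon> product_univ I M" "p = \<langle>A.cl f, ap G (A.cl f)\<rangle>" by blast
    then show "p \<epsilon> G" using ap_G G by auto
  qed
  have G_mem: "G \<epsilon> univ B.Ult \<^bold>^ univ A.Ult"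
    unfolding mem_exponent
  proof (intro conjI allI impI G_func)
    fix x assume "x \<epsilon> univ A.Ult"
    then obtain f where "f \<epsilon> product_univ I M" "x = A.cl f" unfolding A.mem_univ_Ult by blast
    then show "ap G x \<epsilon> univ B.Ult" using ap_G clB[OF \<theta>] by simp
  qed
  have tuple: "push G n (A.ct g) = B.ct (lam n (\<lambda>k. \<theta> (ap g k)))"
    and tuple_mem: "lam n (\<lambda>k. \<theta> (ap g k)) \<epsilon> product_univ I N \<^bold>^ n"
    and tuple_co: "i \<epsilon> I \<Longrightarrow> ?iso i (ap H i) \<Longrightarrow>
      B.co (lam n (\<lambda>k. \<theta> (ap g k))) i = push (ap H i) n (A.co g i)"
    if g: "g \<epsilon> product_univ I M \<^bold>^ n" for g n i
  proof -
    have d: "tdf (\<lambda>e. \<theta> (ap g (e 0)))" by (intro tdf_subst1[OF t\<theta>] dfn_intros)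
    show m: "lam n (\<lambda>k. \<theta> (ap g k)) \<epsilon> product_univ I N \<^bold>^ n"
      by (rule lam_mem_exponent[OF d]) (rule \<theta>)
    show "push G n (A.ct g) = B.ct (lam n (\<lambda>k. \<theta> (ap g k)))"
      unfolding push_def B.ct_def exponent_dom[OF m]
      by (rule lam_cong) (simp add: A.ap_ct[OF g] ap_G[OF exponent_ap[OF g]] ap_lam[OF d])
    show "B.co (lam n (\<lambda>k. \<theta> (ap g k))) i = push (ap H i) n (A.co g i)"
      if i: "i \<epsilon> I" "?iso i (ap H i)"
      unfolding push_def B.co_def exponent_dom[OF m]
      by (rule lam_cong) (simp add: A.ap_co[OF g, unfolded A.co_def] ap_\<theta>[OF exponent_ap[OF g] i] ap_lam[OF d])
  qed
  have "A.iso A.Ult B.Ult G"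
    unfolding A.iso_def ball_elts
  proof (intro conjI allI impI)
    show "G \<epsilon> univ B.Ult \<^bold>^ univ A.Ult" by (rule G_mem)
  next
    fix b assume "b \<epsilon> univ B.Ult"
    then obtain g where g: "g \<epsilon> product_univ I N" "b = B.cl g" unfolding B.mem_univ_Ult by blast
    have d: "dfn (\<lambda>e. ap (ap H (e 0)) (e (Suc 0)) = ap g (e 0))" by (intro dfn_intros)
    have "A.many (\<lambda>i. \<exists>a. a \<epsilon> univ (ap M i) \<and> ap (ap H i) a = ap g i)"
    proof (rule A.many_mono[OF dH _ mH])
      fix i assume "i \<epsilon> I" "?iso i (ap H i)"
      then show "\<exists>a. a \<epsilon> univ (ap M i) \<and> ap (ap H i) a = ap g i"
        using B.PU_ap[OF g(1)] unfolding A.iso_def ball_elts by blast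
    qed (intro dfn_intros)
    \<comment> \<open>Preimages of \<open>g\<close> are known to exist only in \<open>U\<close>-many
      coordinates. Here they are assembled into an element of the full product, which gives
      surjectivity.\<close>
    from A.many_choice[OF AC d this]
    obtain f where f: "f \<epsilon> product_univ I M" "A.many (\<lambda>i. ap (ap H i) (ap f i) = ap g i)" by blast
    have "A.many (\<lambda>i. ap (\<theta> f) i = ap g i)"
      by (rule A.many_mono2[OF dH _ _ mH f(2)]) (intro dfn_intros, intro dfn_intros, simp add: ap_\<theta>[OF f(1)])
    then have "B.cl (\<theta> f) = b" unfolding g(2) B.cl_eq[OF \<theta> g(1)] .
    show "\<exists>!a. a \<epsilon> univ A.Ult \<and> ap G a = b"
    proof (rule ex1I[of _ "A.cl f"])
      show "A.cl f \<epsilon> univ A.Ult \<and> ap G (A.cl f) = b"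
        using f(1) ap_G[OF f(1)] \<open>B.cl (\<theta> f) = b\<close> A.mem_univ_Ult by blast
      fix a assume "a \<epsilon> univ A.Ult \<and> ap G a = b"
      then obtain f' where f': "f' \<epsilon> product_univ I M" "a = A.cl f'" "ap G a = b"
        unfolding A.mem_univ_Ult by blast
      then have "B.cl (\<theta> f') = B.cl (\<theta> f)" using ap_G[OF f'(1)] \<open>B.cl (\<theta> f) = b\<close> by simp
      then show "a = A.cl f" unfolding \<theta>_iff[OF f'(1) f(1)] f'(2) .
    qed
  next
    fix R t assume R: "R \<epsilon> A.Rs" and t: "t \<epsilon> univ A.Ult \<^bold>^ rar L R"
    obtain g where g: "g \<epsilon> product_univ I M \<^bold>^ rar L R" "t = A.ct g"
      by (rule A.lift_tuple[OF A.arity_omega(1)[OF R] t])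
    show "t \<epsilon> RI A.Ult R \<longleftrightarrow> push G (rar L R) t \<epsilon> RI B.Ult R"
      unfolding g(2) tuple[OF g(1)] A.RI_Ult[OF R g(1)] B.RI_Ult[OF R tuple_mem[OF g(1)]]
    proof (rule A.many_iff[OF dH _ _ mH])
      fix i assume i: "i \<epsilon> I" and h: "?iso i (ap H i)"
      show "A.co g i \<epsilon> RI (ap M i) R \<longleftrightarrow> B.co (lam (rar L R) (\<lambda>k. \<theta> (ap g k))) i \<epsilon> RI (ap N i) R"
        unfolding tuple_co[OF g(1) i h] using h R A.co_mem[OF g(1) i]
        unfolding A.iso_def ball_elts by blast
    qed (intro dfn_intros A.tdf_co B.tdf_co)+
  next
    fix F t assume F: "F \<epsilon> A.Fs" and t: "t \<epsilon> univ A.Ult \<^bold>^ far L F"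
    obtain g where g: "g \<epsilon> product_univ I M \<^bold>^ far L F" "t = A.ct g"
      by (rule A.lift_tuple[OF A.arity_omega(2)[OF F] t])
    let ?g = "lam (far L F) (\<lambda>k. \<theta> (ap g k))"
    note fv = A.fv_mem[OF F g(1)] and fv' = B.fv_mem[OF F tuple_mem[OF g(1)]]
    have "A.many (\<lambda>i. ap (\<theta> (A.fv F g)) i = ap (B.fv F ?g) i)"
    proof (rule A.many_mono[OF dH _ mH])
      fix i assume i: "i \<epsilon> I" and h: "?iso i (ap H i)"
      show "ap (\<theta> (A.fv F g)) i = ap (B.fv F ?g) i"
        unfolding ap_\<theta>[OF fv i h] A.ap_fv[OF F g(1) i] B.ap_fv[OF F tuple_mem[OF g(1)] i]
          tuple_co[OF g(1) i h]
        using h F A.co_mem[OF g(1) i] unfolding A.iso_def ball_elts by blast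
    qed (intro dfn_intros)
    then have "B.cl (\<theta> (A.fv F g)) = B.cl (B.fv F ?g)" unfolding B.cl_eq[OF \<theta> fv'] .
    then show "ap G (ap (FI A.Ult F) t) = ap (FI B.Ult F) (push G (far L F) t)"
      unfolding g(2) tuple[OF g(1)] A.FI_Ult[OF F g(1)] B.FI_Ult[OF F tuple_mem[OF g(1)]] ap_G[OF fv] .
  qed
  then show ?thesis
    unfolding isomorphic_def A.is_isomorphism_iff[OF A.structure_Ult B.structure_Ult] by blast
qed

section \<open>Structures with one binary relation\<close>

definition two :: "'a::zf" where "two = numeral_set 2"
definition one :: "'a::zf" where "one = numeral_set 1"

lemma one_neq_empty [simp]: "one \<noteq> (empty :: 'a::zf)" "(empty :: 'a::zf) \<noteq> one"
  using numeral_inject[of 1 0, where 'a = 'a] unfolding one_def numeral_set.simps(1)[symmetric] by auto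

lemma one_omega [simp]: "one \<epsilon> \<omega>"
  by (simp add: one_def)

lemma mem_two [simp]: "k \<epsilon> two \<longleftrightarrow> k = empty \<or> k = (one :: 'a::zf)"
  by (auto simp: two_def one_def numeral_2_eq_2 numeral_set.simps)

lemma two_omega [simp]: "two \<epsilon> \<omega>"
  by (simp add: two_def)

lemma two_neq_empty [simp]: "two \<noteq> (empty :: 'a::zf)"
  unfolding empty_iff by auto

definition graph_lang :: "'a::zf" where
  "graph_lang = \<langle>lam (set_of {empty}) (\<lambda>R. two), empty\<rangle>"

text \<open>The arguments of a binary relation symbol are functions on the ordinal two, in contrast
  to Kuratowski pairs.\<close>

definition tup :: "'a::zf \<Rightarrow> 'a \<Rightarrow> 'a" where
  "tup a b = lam two (\<lambda>k. if k = empty then a else b)"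

lemma tdf_tup [dfn_intros]: "tdf s \<Longrightarrow> tdf t \<Longrightarrow> tdf (\<lambda>e. tup (s e) (t e))"
  unfolding tup_def by (intro dfn_intros; (assumption | erule tdf_shift))

lemma ap_tup [simp]: "ap (tup a b) empty = a" "ap (tup a b) one = b"
  and func_on_tup: "func_on (tup a b) two"
proof -
  have t: "tdf (\<lambda>e. if e 0 = empty then a else b)" by (intro dfn_intros)
  show "ap (tup a b) empty = a" "ap (tup a b) one = b" "func_on (tup a b) two"
    by (simp_all add: tup_def ap_lam[OF t] func_on_lam[OF t])
qed

lemma tup_mem: "tup a b \<epsilon> A \<^bold>^ two \<longleftrightarrow> a \<epsilon> A \<and> b \<epsilon> A"
  by (auto simp: mem_exponent func_on_tup)

lemma tup_eq:
  assumes "func_on t two"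
  shows "t = tup (ap t empty) (ap t one)"
  by (rule func_ext[OF assms func_on_tup]) auto

lemma rel_symbols_graph: "rel_symbols graph_lang = set_of {empty :: 'a::zf}"
  and fun_symbols_graph: "fun_symbols graph_lang = (empty :: 'a::zf)"
  and rar_graph [simp]: "rar graph_lang empty = (two :: 'a::zf)"
  and is_language_graph: "is_language (graph_lang :: 'a::zf)"
proof -
  have t: "tdf (\<lambda>e. two :: 'a)" by (intro dfn_intros)
  have e: "func_on (empty :: 'a) empty" by (simp add: func_on_iff)
  show 1: "rel_symbols graph_lang = set_of {empty :: 'a}"
    by (simp add: rel_symbols_def graph_lang_def dom_lam[OF t])
  show 2: "fun_symbols graph_lang = (empty :: 'a)"
    by (simp add: fun_symbols_def graph_lang_def dom_eq[OF e])
  show "rar graph_lang empty = (two :: 'a)"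
    by (simp add: rar_def graph_lang_def ap_lam[OF t] mem_set_of)
  show "is_language (graph_lang :: 'a)"
    unfolding is_language_def 1 2 rel_arity_def
    by (auto simp: graph_lang_def func_on_lam[OF t] e mem_set_of app_lam[OF t])
qed

interpretation graph: lang graph_lang
  by unfold_locales (rule is_language_graph)

lemma graph_symbols [simp]: "R \<epsilon> rel_symbols graph_lang \<longleftrightarrow> R = (empty :: 'a::zf)"
  "\<not> F \<epsilon> fun_symbols (graph_lang :: 'a::zf)"
  by (simp_all add: rel_symbols_graph fun_symbols_graph mem_set_of)

definition graph_str :: "'a::zf \<Rightarrow> ('a \<Rightarrow> 'a \<Rightarrow> bool) \<Rightarrow> 'a" where
  "graph_str A E = \<langle>A, \<langle>lam (set_of {empty})
     (\<lambda>R. set_of {t. t \<epsilon> A \<^bold>^ two \<and> E (ap t empty) (ap t one)}), empty\<rangle>\<rangle>"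

lemma tdf_graph_str:
  assumes E: "dfn (\<lambda>e. E (e 0) (e (Suc 0)))" and s: "tdf s"
  shows "tdf (\<lambda>e. graph_str (s e) E)"
  unfolding graph_str_def
  by (intro dfn_intros dfn_subst2[OF E] s tdf_shift[OF s] tdf_shift[OF tdf_shift[OF s]])

lemma univ_graph_str [simp]: "univ (graph_str A E) = A"
  by (simp add: univ_def graph_str_def)

lemma
  fixes A :: "'a::zf"
  assumes E: "dfn (\<lambda>e. E (e 0) (e (Suc 0)))"
  shows RI_graph_str: "t \<epsilon> RI (graph_str A E) empty \<longleftrightarrow> t \<epsilon> A \<^bold>^ two \<and> E (ap t empty) (ap t one)"
    and structure_graph_str: "A \<noteq> empty \<Longrightarrow> is_structure graph_lang (graph_str A E)"
proof -
  let ?r = "lam (set_of {empty}) (\<lambda>R. set_of {t. t \<epsilon> A \<^bold>^ two \<and> E (ap t empty) (ap t one)})"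
  have t: "tdf (\<lambda>e. set_of {t. t \<epsilon> A \<^bold>^ two \<and> E (ap t empty) (ap t one)})"
    by (intro dfn_intros dfn_subst2[OF E])
  have "small {t. t \<epsilon> A \<^bold>^ two \<and> E (ap t empty) (ap t one)}"
    by (rule small_Collect[of _ "A \<^bold>^ two"]) (intro dfn_intros dfn_subst2[OF E], simp)
  then show 1: "t \<epsilon> RI (graph_str A E) empty \<longleftrightarrow> t \<epsilon> A \<^bold>^ two \<and> E (ap t empty) (ap t one)" for t
    by (simp add: RI_def graph_str_def ap_lam[OF t] mem_set_of)
  assume A: "A \<noteq> empty"
  have r: "func_on ?r (rel_symbols graph_lang)"
    unfolding rel_symbols_graph by (rule func_on_lam[OF t])
  have f: "func_on (empty :: 'a) (fun_symbols graph_lang)"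
    by (simp add: fun_symbols_graph func_on_iff)
  have "rel_interp (graph_str A E) empty = RI (graph_str A E) empty"
    using r by (simp add: rel_interp_def RI_def graph_str_def app_ap)
  then show "is_structure graph_lang (graph_str A E)"
    unfolding is_structure_def using A r f 1
    by (auto simp: graph_str_def[of A E] graph.arity_eq univ_def)
qed

lemma RI_graph_str_tup:
  assumes "dfn (\<lambda>e. E (e 0) (e (Suc 0)))"
  shows "tup a b \<epsilon> RI (graph_str A E) empty \<longleftrightarrow> a \<epsilon> A \<and> b \<epsilon> (A :: 'a::zf) \<and> E a b"
  by (simp add: RI_graph_str[OF assms] tup_mem)

text \<open>The language has no function symbols, hence the variables are the only terms.\<close>

lemma graph_terms: "t \<epsilon> terms graph_lang X \<Longrightarrow> \<exists>x. x \<epsilon> X \<and> t = tm_var (x :: 'a::zf)"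
proof (induction rule: graph.terms_induct)
  case dfn
  show ?case by (intro dfn_intros)
qed auto

lemma tuple_graph_terms:
  assumes "u \<epsilon> terms graph_lang X \<^bold>^ two"
  obtains x y where "x \<epsilon> X" "y \<epsilon> X" "u = tup (tm_var x) (tm_var (y :: 'a::zf))"
proof -
  obtain x where "x \<epsilon> X" "ap u empty = tm_var x"
    using graph_terms[OF exponent_ap[OF assms, of empty]] by auto
  moreover obtain y where "y \<epsilon> X" "ap u one = tm_var y"
    using graph_terms[OF exponent_ap[OF assms, of one]] by auto
  ultimately show ?thesis using that tup_eq[OF exponent_func[OF assms]] by simp
qed

definition edge :: "'a::zf \<Rightarrow> 'a \<Rightarrow> 'a" where
  "edge x y = fm_rel empty (tup (tm_var x) (tm_var y))"

lemma edge_atomic: "x \<epsilon> X \<Longrightarrow> y \<epsilon> X \<Longrightarrow> is_atomic graph_lang X (edge x (y :: 'a::zf))"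
  unfolding graph.is_atomic_iff edge_def by (simp add: tup_mem graph.terms_var)

lemma sat_at_edge:
  assumes M: "is_structure graph_lang M" and s: "s \<epsilon> univ M \<^bold>^ X" and x: "x \<epsilon> X" and y: "y \<epsilon> (X :: 'a::zf)"
  shows "graph.sat_at M s (edge x y) \<longleftrightarrow> tup (ap s x) (ap s y) \<epsilon> RI M empty"
proof -
  have "tup (tm_var x) (tm_var y) \<epsilon> terms graph_lang X \<^bold>^ two"
    using x y by (simp add: tup_mem graph.terms_var)
  moreover have "lam two (\<lambda>k. graph.val M s (ap (tup (tm_var x) (tm_var y)) k)) = tup (ap s x) (ap s y)"
    unfolding tup_def[of "ap s x"]
    by (rule lam_cong) (auto simp: graph.val_var[OF M s] x y)
  ultimately show ?thesis unfolding edge_def by (simp add: graph.sat_at_rel)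
qed

lemma graph_atomic_cases:
  assumes "is_atomic graph_lang X p"
  obtains x y where "x \<epsilon> X" "y \<epsilon> X" "p = fm_eq (tm_var x) (tm_var (y :: 'a::zf))" |
    x y where "x \<epsilon> X" "y \<epsilon> X" "p = edge x y"
proof -
  from assms consider t u where "t \<epsilon> terms graph_lang X" "u \<epsilon> terms graph_lang X" "p = fm_eq t u" |
    t where "t \<epsilon> terms graph_lang X \<^bold>^ two" "p = fm_rel empty t"
    unfolding graph.is_atomic_iff graph_symbols by auto
  then show thesis
  proof cases
    case 1
    then show thesis using graph_terms[OF 1(1)] graph_terms[OF 1(2)] that(1) by blast
  next
    case 2
    obtain x y where "x \<epsilon> X" "y \<epsilon> X" "t = tup (tm_var x) (tm_var y)"
      by (rule tuple_graph_terms[OF 2(1)])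
    then show thesis using that(2) 2(2) unfolding edge_def by blast
  qed
qed

lemma (in lang) is_Sigma_base: "elts X \<subseteq> elts \<omega> \<Longrightarrow> is_Pi n L X p \<Longrightarrow> is_Sigma (Suc n) L X p"
  and is_Pi_base: "elts X \<subseteq> elts \<omega> \<Longrightarrow> is_Sigma n L X p \<Longrightarrow> is_Pi (Suc n) L X p"
  unfolding is_Sigma.simps is_Pi.simps by (intro conjI allI impI; (elim conjE)?; blast)+

lemma (in lang) is_Sigma_ex:
    "elts X \<subseteq> elts \<omega> \<Longrightarrow> x \<epsilon> \<omega> \<Longrightarrow> is_Sigma (Suc n) L (adjoin X x) p \<Longrightarrow> is_Sigma (Suc n) L X (fm_ex x p)"
  and is_Pi_all:
    "elts X \<subseteq> elts \<omega> \<Longrightarrow> x \<epsilon> \<omega> \<Longrightarrow> is_Pi (Suc n) L (adjoin X x) p \<Longrightarrow> is_Pi (Suc n) L X (fm_all x p)"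
  unfolding is_Sigma.simps is_Pi.simps ball_elts by (intro conjI allI impI; (elim conjE)?; blast)+

lemma (in lang) quantifier_free_atomic:
  "elts X \<subseteq> elts \<omega> \<Longrightarrow> is_atomic L X p \<Longrightarrow> is_quantifier_free L X p"
  "elts X \<subseteq> elts \<omega> \<Longrightarrow> is_atomic L X p \<Longrightarrow> is_quantifier_free L X (fm_neg p)"
  unfolding is_quantifier_free_def by (intro conjI allI impI; (elim conjE)?; blast)+

text \<open>In a structure whose relation is inequality this says that there are two distinct
  elements.\<close>

definition some_edge :: "'a::zf" where
  "some_edge = fm_ex empty (fm_ex one (edge empty one))"

text \<open>For the relation \<open>classmates\<close> defined later this says that some class is a
  singleton, since a point is not related to itself.\<close>

definition some_isolated :: "'a::zf" where
  "some_isolated = fm_ex empty (fm_all one (fm_neg (edge empty one)))"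

abbreviation (input) "v1 \<equiv> adjoin empty (empty :: 'a::zf)"
abbreviation (input) "v2 \<equiv> adjoin (adjoin empty empty) (one :: 'a::zf)"

lemma Sigma_some_edge: "is_Sigma 1 graph_lang empty (some_edge :: 'a::zf)"
  and Sigma_some_isolated: "is_Sigma 2 graph_lang empty (some_isolated :: 'a::zf)"
proof -
  have sub: "elts (empty :: 'a) \<subseteq> elts \<omega>" "elts (v1 :: 'a) \<subseteq> elts \<omega>" "elts (v2 :: 'a) \<subseteq> elts \<omega>"
    by auto
  note qf = graph.quantifier_free_atomic[OF sub(3) edge_atomic]
  have "is_Sigma (Suc 0) graph_lang empty (some_edge :: 'a)"
    unfolding some_edge_def
    by (intro graph.is_Sigma_ex sub empty_omega one_omega graph.is_Sigma_base) (simp add: qf(1))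
  then show "is_Sigma 1 graph_lang empty (some_edge :: 'a)" by simp
  have "is_Sigma (Suc (Suc 0)) graph_lang empty (some_isolated :: 'a)"
    unfolding some_isolated_def
    by (intro graph.is_Sigma_ex graph.is_Sigma_base graph.is_Pi_all graph.is_Pi_base sub empty_omega one_omega)
      (simp add: qf(2))
  then show "is_Sigma 2 graph_lang empty (some_isolated :: 'a)" by (simp add: numeral_2_eq_2)
qed

lemma
  fixes M :: "'a::zf"
  assumes M: "is_structure graph_lang M"
  shows sat_some_edge: "graph.sat M some_edge empty \<longleftrightarrow>
      (\<exists>a b. a \<epsilon> univ M \<and> b \<epsilon> univ M \<and> tup a b \<epsilon> RI M empty)"
    and sat_some_isolated: "graph.sat M some_isolated empty \<longleftrightarrow>
      (\<exists>a. a \<epsilon> univ M \<and> (\<forall>b. b \<epsilon> univ M \<longrightarrow> \<not> tup a b \<epsilon> RI M empty))"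
proof -
  have sub: "elts (v2 :: 'a) \<subseteq> elts \<omega>" by auto
  have at: "is_atomic graph_lang v2 (edge empty (one :: 'a))" by (rule edge_atomic) auto
  note f = graph.formula_atomic[OF sub at]
  note s0 = graph.empty_exponent[of "univ M"]
  have edge: "graph.sat M (edge empty one) (upd (upd empty empty a) one b) \<longleftrightarrow> tup a b \<epsilon> RI M empty"
    if a: "a \<epsilon> univ M" and b: "b \<epsilon> univ M" for a b
  proof -
    note s1 = upd_mem[OF s0 a, of empty]
    note s2 = upd_mem[OF s1 b, of one]
    have "ap (upd (upd empty empty a) one b) empty = a" "ap (upd (upd empty empty a) one b) one = b"
      using ap_upd[OF s1, of empty one b] ap_upd[OF s1, of one one b] ap_upd[OF s0, of empty empty a]
      by simp_all
    then show ?thesis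
      unfolding graph.sat_atomic[OF s2 sub at] using sat_at_edge[OF M s2, of empty one] by simp
  qed
  show "graph.sat M some_edge empty \<longleftrightarrow>
      (\<exists>a b. a \<epsilon> univ M \<and> b \<epsilon> univ M \<and> tup a b \<epsilon> RI M empty)"
    unfolding some_edge_def graph.sat_ex[OF s0 graph.formula_ex[OF f]]
    using graph.sat_ex[OF upd_mem[OF s0] f] edge by blast
  have "graph.sat M (fm_all one (fm_neg (edge empty one))) (upd empty empty a) \<longleftrightarrow>
      (\<forall>b. b \<epsilon> univ M \<longrightarrow> \<not> tup a b \<epsilon> RI M empty)" if a: "a \<epsilon> univ M" for a
    using graph.sat_all[OF upd_mem[OF s0 a] graph.formula_neg[OF f]]
      graph.sat_neg[OF upd_mem[OF upd_mem[OF s0 a]] f] edge[OF a] by blast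
  then show "graph.sat M some_isolated empty \<longleftrightarrow>
      (\<exists>a. a \<epsilon> univ M \<and> (\<forall>b. b \<epsilon> univ M \<longrightarrow> \<not> tup a b \<epsilon> RI M empty))"
    unfolding some_isolated_def graph.sat_ex[OF s0 graph.formula_all[OF graph.formula_neg[OF f]]] by blast
qed

section \<open>Equipotent sets\<close>

definition bijection :: "'a::zf \<Rightarrow> 'a \<Rightarrow> 'a \<Rightarrow> bool" where
  "bijection a b f \<longleftrightarrow> f \<epsilon> b \<^bold>^ a \<and> (\<forall>y. y \<epsilon> b \<longrightarrow> (\<exists>!x. x \<epsilon> a \<and> ap f x = y))"

definition equipotent :: "'a::zf \<Rightarrow> 'a \<Rightarrow> bool" where
  "equipotent a b \<longleftrightarrow> (\<exists>f. bijection a b f)"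

lemma bijection_inj: "bijection a b f \<Longrightarrow> x \<epsilon> a \<Longrightarrow> x' \<epsilon> a \<Longrightarrow> ap f x = ap f x' \<Longrightarrow> x = x'"
  unfolding bijection_def using exponent_ap[of f b a x] by metis

lemma bijectionI:
  assumes "f \<epsilon> b \<^bold>^ a" "\<And>y. y \<epsilon> b \<Longrightarrow> \<exists>x. x \<epsilon> a \<and> ap f x = y"
    "\<And>x x'. x \<epsilon> a \<Longrightarrow> x' \<epsilon> a \<Longrightarrow> ap f x = ap f x' \<Longrightarrow> x = x'"
  shows "bijection a b (f :: 'a::zf)"
  unfolding bijection_def using assms by metis

lemma equipotent_sym:
  assumes "equipotent a b"
  shows "equipotent b (a :: 'a::zf)"
proof -
  obtain f where f: "bijection a b f" using assms unfolding equipotent_def by blast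
  then have fm: "f \<epsilon> b \<^bold>^ a" unfolding bijection_def by blast
  \<comment> \<open>The inverse function: the unique preimage of \<open>y\<close>, written as the
    set of its elements to be definable.\<close>
  define G where "G y = set_of {z. \<exists>x. (x \<epsilon> a \<and> ap f x = y) \<and> z \<epsilon> x}" for y
  have t: "tdf (\<lambda>e. G (e 0))" unfolding G_def by (intro dfn_intros)
  have G: "G y = x" if "x \<epsilon> a" "ap f x = y" for x y
  proof -
    have "x' \<epsilon> a \<and> ap f x' = y \<longleftrightarrow> x' = x" for x' using bijection_inj[OF f, of x' x] that by auto
    then show ?thesis unfolding G_def by (simp flip: elts_def)
  qed
  have "bijection b a (lam b G)"
  proof (rule bijectionI)
    show m: "lam b G \<epsilon> a \<^bold>^ b"
    proof (rule lam_mem_exponent[OF t])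
      fix y assume "y \<epsilon> b"
      then obtain x where "x \<epsilon> a" "ap f x = y" using f unfolding bijection_def by blast
      then show "G y \<epsilon> a" using G by simp
    qed
    show "\<exists>y. y \<epsilon> b \<and> ap (lam b G) y = x" if "x \<epsilon> a" for x
      using exponent_ap[OF fm that] ap_lam[OF t] G[OF that refl] by auto
    fix y y' assume y: "y \<epsilon> b" "y' \<epsilon> b" and eq: "ap (lam b G) y = ap (lam b G) y'"
    obtain x x' where "x \<epsilon> a" "ap f x = y" "x' \<epsilon> a" "ap f x' = y'"
      using f y unfolding bijection_def by blast
    then show "y = y'" using G eq y by (auto simp: ap_lam[OF t])
  qed
  then show ?thesis unfolding equipotent_def by blast
qed

lemma equipotent_trans:
  assumes "equipotent a b" "equipotent b c"
  shows "equipotent a (c :: 'a::zf)"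
proof -
  obtain f g where f: "bijection a b f" and g: "bijection b c g" using assms unfolding equipotent_def by blast
  then have fm: "f \<epsilon> b \<^bold>^ a" and gm: "g \<epsilon> c \<^bold>^ b" unfolding bijection_def by blast+
  have "bijection a c (g \<odot> f)"
  proof (rule bijectionI)
    show "g \<odot> f \<epsilon> c \<^bold>^ a" by (rule compose_mem[OF fm gm])
    fix z assume "z \<epsilon> c"
    then obtain y where "y \<epsilon> b" "ap g y = z" using g unfolding bijection_def by blast
    moreover then obtain x where "x \<epsilon> a" "ap f x = y" using f unfolding bijection_def by blast
    ultimately show "\<exists>x. x \<epsilon> a \<and> ap (g \<odot> f) x = z" using ap_compose[OF fm gm] by auto
  next
    fix x x' assume x: "x \<epsilon> a" "x' \<epsilon> a" "ap (g \<odot> f) x = ap (g \<odot> f) x'"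
    then have "ap f x = ap f x'"
      using bijection_inj[OF g exponent_ap[OF fm] exponent_ap[OF fm]] ap_compose[OF fm gm] by simp
    then show "x = x'" using bijection_inj[OF f] x by blast
  qed
  then show ?thesis unfolding equipotent_def by blast
qed

text \<open>Hilbert's hotel: shift by \<open>f\<close> the points whose backward orbit under \<open>f\<close> leaves \<open>b\<close>.\<close>

lemma equipotent_subset:
  fixes a b :: "'a::zf"
  assumes f: "f \<epsilon> b \<^bold>^ a" and inj: "\<And>x x'. x \<epsilon> a \<Longrightarrow> x' \<epsilon> a \<Longrightarrow> ap f x = ap f x' \<Longrightarrow> x = x'"
    and sub: "elts b \<subseteq> elts a"
  shows "equipotent a b"
proof -
  \<comment> \<open>Any fixed point serves: it contains the points of \<open>a\<close> outside
    \<open>b\<close>, is closed under \<open>f\<close>, and each of its points in \<open>b\<close>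
    is the image of another point of it. Shifting it by \<open>f\<close> and fixing the rest is then
    onto \<open>b\<close>.\<close>
  define \<Phi> where "\<Phi> S x \<longleftrightarrow> x \<epsilon> a \<and> \<not> x \<epsilon> b \<or> (\<exists>z. z \<epsilon> a \<and> z \<epsilon> S \<and> x = ap f z)" for S x
  obtain K where K: "\<And>x. x \<epsilon> K \<longleftrightarrow> \<Phi> K x"
  proof (rule ex_lfp[of \<Phi> a])
    show "dfn (\<lambda>e. \<Phi> (e 0) (e (Suc 0)))" unfolding \<Phi>_def by (intro dfn_intros)
    show "\<Phi> T x" if "elts S \<subseteq> elts T" "\<Phi> S x" for S T x
      using that unfolding \<Phi>_def elts_subset by blast
    show "x \<epsilon> a" if "\<Phi> S x" for S x
      using that exponent_ap[OF f] sub unfolding \<Phi>_def by auto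
    fix T assume T: "\<And>x. x \<epsilon> T \<longleftrightarrow> \<Phi> T x"
    show thesis by (rule that[OF T])
  qed
  define g where "g x = (if x \<epsilon> K then ap f x else x)" for x
  have t: "tdf (\<lambda>e. g (e 0))" unfolding g_def by (intro dfn_intros)
  have out: "x \<epsilon> K" if "x \<epsilon> a" "\<not> x \<epsilon> b" for x using K[of x] that unfolding \<Phi>_def by blast
  have step: "ap f x \<epsilon> K" if "x \<epsilon> a" "x \<epsilon> K" for x using K[of "ap f x"] that unfolding \<Phi>_def by blast
  have "bijection a b (lam a g)"
  proof (rule bijectionI)
    show "lam a g \<epsilon> b \<^bold>^ a"
      by (rule lam_mem_exponent[OF t]) (use out exponent_ap[OF f] in \<open>auto simp: g_def\<close>)
    fix y assume y: "y \<epsilon> b"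
    show "\<exists>x. x \<epsilon> a \<and> ap (lam a g) x = y"
    proof (cases "y \<epsilon> K")
      case True
      then obtain x where "x \<epsilon> a" "x \<epsilon> K" "y = ap f x" using K[of y] y unfolding \<Phi>_def by blast
      then show ?thesis by (intro exI[of _ x]) (simp add: ap_lam[OF t] g_def)
    next
      case False
      then show ?thesis using y sub by (intro exI[of _ y]) (simp add: ap_lam[OF t] g_def)
    qed
  next
    fix x x' assume "x \<epsilon> a" "x' \<epsilon> a" "ap (lam a g) x = ap (lam a g) x'"
    then show "x = x'"
      using inj step by (auto simp: ap_lam[OF t] g_def split: if_splits)
  qed
  then show ?thesis unfolding equipotent_def by blast
qed

lemma dfn_neq: "dfn (\<lambda>e. e 0 \<noteq> (e (Suc 0) :: 'a::zf))"
  by (intro dfn_intros)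

lemma isomorphic_graph_str:
  fixes a b :: "'a::zf"
  assumes "equipotent a b" "a \<noteq> empty" "b \<noteq> empty"
  shows "isomorphic graph_lang (graph_str a (\<noteq>)) (graph_str b (\<noteq>))"
proof -
  obtain f where f: "bijection a b f" using assms unfolding equipotent_def by blast
  then have fm: "f \<epsilon> b \<^bold>^ a" unfolding bijection_def by blast
  note graph_str = structure_graph_str[OF dfn_neq]
  have "t \<epsilon> RI (graph_str a (\<noteq>)) empty \<longleftrightarrow> push f two t \<epsilon> RI (graph_str b (\<noteq>)) empty" if t: "t \<epsilon> a \<^bold>^ two" for t
  proof -
    have td: "tdf (\<lambda>e. ap f (ap t (e 0)))" by (intro dfn_intros)
    have "ap (push f two t) k = ap f (ap t k)" if "k \<epsilon> two" for k
      unfolding push_def by (rule ap_lam[OF td that])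
    then show ?thesis
      unfolding RI_graph_str[OF dfn_neq] using t push_mem[OF t fm] exponent_ap[OF t] bijection_inj[OF f] by auto
  qed
  then have "graph.iso (graph_str a (\<noteq>)) (graph_str b (\<noteq>)) f"
    using f unfolding graph.iso_def bijection_def by simp
  then show ?thesis
    unfolding isomorphic_def graph.is_isomorphism_iff[OF graph_str[OF assms(2)] graph_str[OF assms(3)]] by blast
qed

lemma pair_not_empty [simp]: "\<langle>x, y\<rangle> \<noteq> (empty :: 'a::zf)" "empty \<noteq> \<langle>x, y :: 'a::zf\<rangle>"
proof -
  have "set_of {x} \<epsilon> \<langle>x, y\<rangle>" by (simp add: pair_def mem_set_of)
  then show "\<langle>x, y\<rangle> \<noteq> empty" by (auto simp: empty_iff)
  then show "empty \<noteq> \<langle>x, y\<rangle>" by (rule not_sym)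
qed

lemma (in lang) Sigma_equivalent_iff:
  assumes "is_structure L M" "is_structure L N"
  shows "Sigma_equivalent n L M N \<longleftrightarrow>
    (\<forall>p. is_Sigma n L empty p \<longrightarrow> (sat M p empty \<longleftrightarrow> sat N p empty))"
  unfolding Sigma_equivalent_def satisfies_sat[OF assms(1)] satisfies_sat[OF assms(2)] ..

locale graph_family = ultra_family graph_lang I U M for I U M :: "'a::zf"
begin

lemma edge_Ult:
  assumes f: "f \<epsilon> PU" and g: "g \<epsilon> PU"
  shows "tup (cl f) (cl g) \<epsilon> RI Ult empty \<longleftrightarrow> many (\<lambda>i. tup (ap f i) (ap g i) \<epsilon> RI (Mi i) empty)"
proof -
  have fg: "tup f g \<epsilon> PU \<^bold>^ two" using f g by (simp add: tup_mem)
  have "ct (tup f g) = tup (cl f) (cl g)"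
    using tup_eq[OF func_on_ct[OF fg]] ap_ct[OF fg, of empty] ap_ct[OF fg, of one] by simp
  moreover have "co (tup f g) i = tup (ap f i) (ap g i)" if "i \<epsilon> I" for i
    using tup_eq[OF exponent_func[OF co_mem[OF fg that]]] ap_co[OF fg, of empty i] ap_co[OF fg, of one i]
    by simp
  then have "many (\<lambda>i. co (tup f g) i \<epsilon> RI (Mi i) empty) \<longleftrightarrow>
      many (\<lambda>i. tup (ap f i) (ap g i) \<epsilon> RI (Mi i) empty)"
    by (intro many_cong) simp
  ultimately show ?thesis using RI_Ult[of empty "tup f g"] fg by simp
qed

lemma some_edge_Ult: "sat Ult some_edge empty \<longleftrightarrow>
    (\<exists>f g. f \<epsilon> PU \<and> g \<epsilon> PU \<and> many (\<lambda>i. tup (ap f i) (ap g i) \<epsilon> RI (Mi i) empty))"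
  unfolding sat_some_edge[OF structure_Ult] mem_univ_Ult using edge_Ult by blast

lemma some_isolated_Ult: "sat Ult some_isolated empty \<longleftrightarrow>
    (\<exists>f. f \<epsilon> PU \<and> (\<forall>g. g \<epsilon> PU \<longrightarrow> \<not> many (\<lambda>i. tup (ap f i) (ap g i) \<epsilon> RI (Mi i) empty)))"
  unfolding sat_some_isolated[OF structure_Ult] mem_univ_Ult using edge_Ult by blast

end

section \<open>Equivalence relations with many large classes\<close>

text \<open>Points are pairs whose first component names their class. Leaving out the diagonal turns
  the singleton classes into isolated points.\<close>

definition classmates :: "'a::zf \<Rightarrow> 'a \<Rightarrow> bool" where
  "classmates p q \<longleftrightarrow> pfst p = pfst q \<and> p \<noteq> q"

lemma dfn_classmates: "dfn (\<lambda>e. classmates (e 0) (e (Suc 0) :: 'a::zf))"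
  unfolding classmates_def by (intro dfn_intros)

text \<open>The extension property for the back-and-forth argument: each occupied class has a
  further member, and there is a further class. The values to be avoided are indexed by an arbitrary
  set of variables, possibly all of \<omega>.\<close>

definition rich :: "'a::zf \<Rightarrow> bool" where
  "rich A \<longleftrightarrow> (\<forall>X s. elts X \<subseteq> elts \<omega> \<longrightarrow> s \<epsilon> A \<^bold>^ X \<longrightarrow>
    (\<forall>k. k \<epsilon> X \<longrightarrow> (\<exists>a. a \<epsilon> A \<and> pfst a = pfst (ap s k) \<and> (\<forall>l. l \<epsilon> X \<longrightarrow> a \<noteq> ap s l))) \<and>
    (\<exists>a. a \<epsilon> A \<and> (\<forall>l. l \<epsilon> X \<longrightarrow> pfst a \<noteq> pfst (ap s l))))"

text \<open>Equality and membership in a common class determine all atomic formulas, so this is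
  agreement on quantifier-free formulas.\<close>

definition same_type :: "'a::zf \<Rightarrow> 'a \<Rightarrow> bool" where
  "same_type s t \<longleftrightarrow> (\<forall>k\<in>elts (dom s). \<forall>l\<in>elts (dom s). (ap s k = ap s l \<longleftrightarrow> ap t k = ap t l) \<and>
    (pfst (ap s k) = pfst (ap s l) \<longleftrightarrow> pfst (ap t k) = pfst (ap t l)))"

lemma same_type_iff: "s \<epsilon> A \<^bold>^ X \<Longrightarrow> same_type s t \<longleftrightarrow>
    (\<forall>k l. k \<epsilon> X \<longrightarrow> l \<epsilon> X \<longrightarrow> (ap s k = ap s l \<longleftrightarrow> ap t k = ap t l) \<and>
      (pfst (ap s k) = pfst (ap s l) \<longleftrightarrow> pfst (ap t k) = pfst (ap t l)))"
  unfolding same_type_def ball_elts by (simp only: exponent_dom) blast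

text \<open>The new element \<open>a\<close> either is a value of \<open>s\<close> already, or is
  new in the class of some value, or lies in a new class. The first case copies the corresponding
  value of \<open>t\<close>; the other two are the two clauses of \<open>rich\<close>.\<close>

lemma same_type_upd:
  assumes B: "rich B" and X: "elts X \<subseteq> elts \<omega>" and s: "s \<epsilon> A \<^bold>^ X" and t: "t \<epsilon> B \<^bold>^ X"
    and st: "same_type s t" and a: "a \<epsilon> A"
  shows "\<exists>b. b \<epsilon> B \<and> same_type (upd s x a) (upd t x (b :: 'a::zf))"
proof -
  note st' = st[unfolded same_type_iff[OF s], rule_format]
  note B' = B[unfolded rich_def, rule_format, OF X t]
  have "\<exists>b. b \<epsilon> B \<and> (\<forall>l. l \<epsilon> X \<longrightarrow> (ap s l = a \<longleftrightarrow> ap t l = b) \<and>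
      (pfst (ap s l) = pfst a \<longleftrightarrow> pfst (ap t l) = pfst b))"
  proof (cases "\<exists>k. k \<epsilon> X \<and> ap s k = a")
    case True
    then obtain k where k: "k \<epsilon> X" "ap s k = a" by blast
    show ?thesis
      using st'[OF _ k(1)] unfolding k(2) by (intro exI[of _ "ap t k"] conjI allI impI exponent_ap[OF t k(1)]) simp_all
  next
    case new: False
    show ?thesis
    proof (cases "\<exists>k. k \<epsilon> X \<and> pfst (ap s k) = pfst a")
      case True
      then obtain k where k: "k \<epsilon> X" "pfst (ap s k) = pfst a" by blast
      obtain b where b: "b \<epsilon> B" "pfst b = pfst (ap t k)" "\<And>l. l \<epsilon> X \<Longrightarrow> b \<noteq> ap t l"
        using conjunct1[OF B', rule_format, OF k(1)] by blast
      have "(ap s l = a \<longleftrightarrow> ap t l = b) \<and> (pfst (ap s l) = pfst a \<longleftrightarrow> pfst (ap t l) = pfst b)"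
        if l: "l \<epsilon> X" for l
        using st'[OF l k(1)] k(2) b(2) b(3)[OF l] new l by auto
      then show ?thesis using b(1) by blast
    next
      case False
      obtain b where b: "b \<epsilon> B" "\<And>l. l \<epsilon> X \<Longrightarrow> pfst b \<noteq> pfst (ap t l)"
        using conjunct2[OF B'] by blast
      have "(ap s l = a \<longleftrightarrow> ap t l = b) \<and> (pfst (ap s l) = pfst a \<longleftrightarrow> pfst (ap t l) = pfst b)"
        if l: "l \<epsilon> X" for l
        using b(2)[OF l] new False l by auto
      then show ?thesis using b(1) by blast
    qed
  qed
  then obtain b where b: "b \<epsilon> B" and bl: "\<And>l. l \<epsilon> X \<Longrightarrow> ap s l = a \<longleftrightarrow> ap t l = b"
    "\<And>l. l \<epsilon> X \<Longrightarrow> pfst (ap s l) = pfst a \<longleftrightarrow> pfst (ap t l) = pfst b" by blast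
  have "same_type (upd s x a) (upd t x b)"
    unfolding same_type_iff[OF upd_mem[OF s a]]
  proof (intro allI impI)
    fix k l assume "k \<epsilon> adjoin X x" "l \<epsilon> adjoin X x"
    then have kl: "k = x \<or> k \<epsilon> X" "l = x \<or> l \<epsilon> X" by auto
    note u = ap_upd[OF s kl(1), of a] ap_upd[OF s kl(2), of a]
      ap_upd[OF t kl(1), of b] ap_upd[OF t kl(2), of b]
    show "(ap (upd s x a) k = ap (upd s x a) l \<longleftrightarrow> ap (upd t x b) k = ap (upd t x b) l) \<and>
      (pfst (ap (upd s x a) k) = pfst (ap (upd s x a) l) \<longleftrightarrow> pfst (ap (upd t x b) k) = pfst (ap (upd t x b) l))"
    proof (cases "k = x"; cases "l = x")
      assume "k = x" "l \<noteq> x"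
      then show ?thesis unfolding u using kl bl[of l] by (simp add: eq_commute[of a] eq_commute[of b]
            eq_commute[of "pfst a"] eq_commute[of "pfst b"])
    next
      assume "k \<noteq> x" "l = x"
      then show ?thesis unfolding u using kl bl[of k] by simp
    next
      assume "k \<noteq> x" "l \<noteq> x"
      then show ?thesis unfolding u using kl st'[of k l] by simp
    qed (simp add: u)
  qed
  then show ?thesis using b by blast
qed

lemma same_type_sym: "s \<epsilon> A \<^bold>^ X \<Longrightarrow> t \<epsilon> B \<^bold>^ X \<Longrightarrow> same_type s t \<longleftrightarrow> same_type t (s :: 'a::zf)"
  by (simp only: same_type_iff) blast

text \<open>\<open>same_type\<close> is a back-and-forth system between any two rich universes.
  Since it is symmetric, one extension lemma covers both directions.\<close>

lemma rich_sat:
  fixes A B :: "'a::zf"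
  assumes A: "rich A" "A \<noteq> empty" and B: "rich B" "B \<noteq> empty"
    and p: "is_formula graph_lang X p" "s \<epsilon> A \<^bold>^ X" "t \<epsilon> B \<^bold>^ X" "same_type s t"
  shows "graph.sat (graph_str A classmates) p s \<longleftrightarrow> graph.sat (graph_str B classmates) p t"
proof (rule graph.back_and_forth[where R = same_type])
  show "dfn (\<lambda>e. same_type (e 0) (e (Suc 0) :: 'a))" unfolding same_type_def by (intro dfn_intros)
  note sA = structure_graph_str[OF dfn_classmates A(2)] and sB = structure_graph_str[OF dfn_classmates B(2)]
  show "graph.sat_at (graph_str A classmates) s p \<longleftrightarrow> graph.sat_at (graph_str B classmates) t p"
    if X: "elts X \<subseteq> elts \<omega>" and s: "s \<epsilon> univ (graph_str A classmates) \<^bold>^ X" and t: "t \<epsilon> univ (graph_str B classmates) \<^bold>^ X"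
      and st: "same_type s t" and p: "is_atomic graph_lang X p" for X s t p
    using p
  proof (cases rule: graph_atomic_cases)
    case (1 x y)
    then show ?thesis
      using st[unfolded same_type_iff[OF s], rule_format, OF 1(1,2)]
      by (simp add: graph.val_var[OF sA s] graph.val_var[OF sB t])
  next
    case (2 x y)
    note xs = exponent_ap[OF s[unfolded univ_graph_str] 2(1)] exponent_ap[OF s[unfolded univ_graph_str] 2(2)]
      exponent_ap[OF t[unfolded univ_graph_str] 2(1)] exponent_ap[OF t[unfolded univ_graph_str] 2(2)]
    show ?thesis
      unfolding 2(3) sat_at_edge[OF sA s 2(1,2)] sat_at_edge[OF sB t 2(1,2)] RI_graph_str_tup[OF dfn_classmates] classmates_def
      using st[unfolded same_type_iff[OF s], rule_format, OF 2(1,2)] xs by simp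
  qed
  show "\<exists>b. b \<epsilon> univ (graph_str B classmates) \<and> same_type (upd s x a) (upd t x b)"
    if "elts X \<subseteq> elts \<omega>" "s \<epsilon> univ (graph_str A classmates) \<^bold>^ X" "t \<epsilon> univ (graph_str B classmates) \<^bold>^ X"
      "same_type s t" "x \<epsilon> \<omega>" "a \<epsilon> univ (graph_str A classmates)" for X s t x a
    using that(2,3,6) unfolding univ_graph_str by (intro same_type_upd[OF B(1) that(1) _ _ that(4)])
  show "\<exists>a. a \<epsilon> univ (graph_str A classmates) \<and> same_type (upd s x a) (upd t x b)"
    if "elts X \<subseteq> elts \<omega>" "s \<epsilon> univ (graph_str A classmates) \<^bold>^ X" "t \<epsilon> univ (graph_str B classmates) \<^bold>^ X"
      "same_type s t" "x \<epsilon> \<omega>" "b \<epsilon> univ (graph_str B classmates)" for X s t x b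
  proof -
    note st = that(2,3)[unfolded univ_graph_str] and b = that(6)[unfolded univ_graph_str]
    have "same_type t s" using same_type_sym[OF st] that(4) by blast
    from same_type_upd[OF A(1) that(1) st(2,1) this b]
    obtain a where a: "a \<epsilon> A" "same_type (upd t x b) (upd s x a)" by blast
    then show ?thesis
      unfolding univ_graph_str using same_type_sym[OF upd_mem[OF st(1) a(1)] upd_mem[OF st(2) b]] by blast
  qed
qed (use p in simp_all)

text \<open>Each assignment has the same type as its image, because \<open>j\<close> preserves and
  reflects equality and sharing a class.\<close>

lemma rich_embedding:
  fixes A B :: "'a::zf"
  assumes A: "rich A" "A \<noteq> empty" and B: "rich B" "B \<noteq> empty" and j: "j \<epsilon> B \<^bold>^ A"
    and inj: "\<And>a b. a \<epsilon> A \<Longrightarrow> b \<epsilon> A \<Longrightarrow> (ap j a = ap j b \<longleftrightarrow> a = b) \<and>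
      (pfst (ap j a) = pfst (ap j b) \<longleftrightarrow> pfst a = pfst b)"
  shows "elementary_embedding graph_lang (graph_str A classmates) (graph_str B classmates) j"
  unfolding elementary_embedding_def univ_graph_str ball_elts
    graph.satisfies_sat[OF structure_graph_str[OF dfn_classmates A(2)]]
    graph.satisfies_sat[OF structure_graph_str[OF dfn_classmates B(2)]]
proof (intro conjI allI impI j)
  fix X p s assume p: "is_formula graph_lang X p" and s: "s \<epsilon> A \<^bold>^ X"
  have "same_type s (j \<odot> s)"
    unfolding same_type_iff[OF s] using ap_compose[OF s j] inj exponent_ap[OF s] by simp
  then show "graph.sat (graph_str A classmates) p s \<longleftrightarrow> graph.sat (graph_str B classmates) p (j \<odot> s)"
    by (rule rich_sat[OF A B p s compose_mem[OF s j]])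
qed

text \<open>The diagonal set of those \<open>n\<close> in \<open>X\<close> that do not belong to
  \<open>F n\<close>. It yields the new elements demanded by \<open>rich\<close>, without any
  well-ordering or choice.\<close>

lemma Cantor:
  fixes X :: "'a::zf"
  assumes F: "tdf (\<lambda>e. F (e 0))" and X: "elts X \<subseteq> elts \<omega>"
  shows "\<exists>d. elts d \<subseteq> elts \<omega> \<and> (\<forall>l. l \<epsilon> X \<longrightarrow> d \<noteq> F l)"
proof -
  have "dfn (\<lambda>e. \<not> e 0 \<epsilon> F (e 0))" by (intro dfn_intros F)
  from separation_dfn[OF this, of X]
  obtain d where d: "\<And>n. n \<epsilon> d \<longleftrightarrow> n \<epsilon> X \<and> \<not> n \<epsilon> F n" by blast
  then have "d \<noteq> F l" if "l \<epsilon> X" for l using that by metis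
  then show ?thesis using d X by (intro exI[of _ d]) auto
qed

section \<open>Structures coding a family of non-empty sets\<close>

text \<open>The elements of \<open>I\<close> are in \<open>W\<close> because they name classes, and
  the subsets of \<omega> because they are the diagonal sets of \<open>Cantor\<close>. Closure under
  pairs puts the products \<open>A \<cdot> i \<times> W\<close> inside \<open>W\<close>.\<close>

locale choice_problem = ultra I U for I U :: "'a::zf" +
  fixes A W :: 'a
  assumes A: "func_on A I" and A_not_empty: "\<And>i. i \<epsilon> I \<Longrightarrow> \<exists>a. a \<epsilon> ap A i"
    and WA: "\<And>i a. i \<epsilon> I \<Longrightarrow> a \<epsilon> ap A i \<Longrightarrow> a \<epsilon> W"
    and WI: "\<And>i. i \<epsilon> I \<Longrightarrow> i \<epsilon> W" and WP: "\<And>d. elts d \<subseteq> elts \<omega> \<Longrightarrow> d \<epsilon> W"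
    and W_pair: "\<And>x y. x \<epsilon> W \<Longrightarrow> y \<epsilon> W \<Longrightarrow> \<langle>x, y\<rangle> \<epsilon> W"
begin

abbreviation chosen :: bool where
  "chosen \<equiv> (\<exists>f. func_on f I \<and> U_many I U (\<lambda>i. f \<cdot> i \<epsilon> A \<cdot> i))"

lemma chosenI:
  assumes F: "tdf (\<lambda>e. F (e 0))" and "many (\<lambda>i. F i \<epsilon> ap A i)"
  shows chosen
proof -
  have "lam I F \<cdot> i \<epsilon> A \<cdot> i \<longleftrightarrow> F i \<epsilon> ap A i" if "i \<epsilon> I" for i
    using that by (simp add: app_lam[OF F] app_ap[OF A])
  then have "many (\<lambda>i. lam I F \<cdot> i \<epsilon> A \<cdot> i) \<longleftrightarrow> many (\<lambda>i. F i \<epsilon> ap A i)" by (rule many_cong)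
  then show ?thesis using assms(2) func_on_lam[OF F] by blast
qed

lemma W_empty: "empty \<epsilon> W" and W_one: "one \<epsilon> W"
  by (rule WP; auto simp: one_def numeral_set.simps)+

text \<open>The factor \<open>W\<close> gives all these sets the same size, and the base point
  \<open>empty\<close> makes their product non-empty.\<close>

definition B :: "'a \<Rightarrow> 'a" where
  "B i = set_of {y. y = empty \<or> (\<exists>a w. a \<epsilon> ap A i \<and> w \<epsilon> W \<and> y = \<langle>a, w\<rangle>)}"

lemma tdf_B: "tdf s \<Longrightarrow> tdf (\<lambda>e. B (s e))"
  by (rule tdf_subst1) (unfold B_def, intro dfn_intros)

lemma mem_B: "y \<epsilon> B i \<longleftrightarrow> y = empty \<or> (\<exists>a w. a \<epsilon> ap A i \<and> w \<epsilon> W \<and> y = \<langle>a, w\<rangle>)"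
proof -
  have "small {y. y = empty \<or> (\<exists>a w. a \<epsilon> ap A i \<and> w \<epsilon> W \<and> y = \<langle>a, w\<rangle>)}"
    by (rule small_Collect[of _ "adjoin (times (ap A i) W) empty"]) (intro dfn_intros, auto)
  then show ?thesis by (simp add: B_def mem_set_of)
qed

lemma B_not_empty: "B i \<noteq> empty" and WN: "W \<noteq> empty"
proof -
  have "empty \<epsilon> B i" by (simp add: mem_B)
  then show "B i \<noteq> empty" by (metis not_mem_empty)
  show "W \<noteq> empty" using W_empty by (metis not_mem_empty)
qed

lemma equipotent_B:
  assumes i: "i \<epsilon> I"
  shows "equipotent W (B i)"
proof -
  obtain a where a: "a \<epsilon> ap A i" using A_not_empty[OF i] by blast
  have t: "tdf (\<lambda>e. \<langle>a, e 0\<rangle>)" by (intro dfn_intros)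
  show ?thesis
  proof (rule equipotent_subset)
    show "lam W (\<lambda>w. \<langle>a, w\<rangle>) \<epsilon> B i \<^bold>^ W"
      by (rule lam_mem_exponent[OF t]) (use a in \<open>auto simp: mem_B\<close>)
    show "elts (B i) \<subseteq> elts W" using W_empty W_pair WA[OF i] by (auto simp: mem_B)
  qed (simp add: ap_lam[OF t])
qed

section \<open>Structures of pairwise distinct points, for the statements on isomorphic
  families\<close>

definition K :: 'a where
  "K = lam I (\<lambda>i. graph_str (B i) (\<noteq>))"

lemma tdf_graph_str_B: "tdf (\<lambda>e. graph_str (B (e 0)) (\<noteq>))"
  by (rule tdf_graph_str[OF dfn_neq]) (intro tdf_B tdf_var)

lemma ap_K: "i \<epsilon> I \<Longrightarrow> ap K i = graph_str (B i) (\<noteq>)" and app_K: "i \<epsilon> I \<Longrightarrow> K \<cdot> i = graph_str (B i) (\<noteq>)"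
  unfolding K_def by (rule ap_lam[OF tdf_graph_str_B] app_lam[OF tdf_graph_str_B]; assumption)+

lemma family_K: "is_family graph_lang I K"
  unfolding is_family_def ball_elts
  by (simp add: app_K structure_graph_str[OF dfn_neq B_not_empty]) (simp add: K_def func_on_lam[OF tdf_graph_str_B])

lemma product_K: "product_univ I K \<noteq> empty"
proof -
  interpret indexed_family graph_lang I U K by unfold_locales (rule family_K)
  have "lam I (\<lambda>i. empty) \<epsilon> PU"
    by (rule PU_lam) (intro dfn_intros, simp add: ap_K mem_B)
  then show ?thesis by (auto simp: empty_iff)
qed

lemma structure_K: "i \<epsilon> I \<Longrightarrow> is_structure graph_lang (ap K i)"
  by (simp add: ap_K structure_graph_str[OF dfn_neq B_not_empty])

lemma K_family: "graph_family I U K"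
  by unfold_locales (rule family_K, rule product_K)

lemma isomorphic_K: "i \<epsilon> I \<Longrightarrow> j \<epsilon> I \<Longrightarrow> isomorphic graph_lang (K \<cdot> i) (K \<cdot> j)"
  unfolding app_K
  by (intro isomorphic_graph_str B_not_empty equipotent_trans[OF equipotent_sym[OF equipotent_B] equipotent_B])

lemma some_edge_K:
  assumes i: "i \<epsilon> I"
  shows "graph.sat (ap K i) some_edge empty"
proof -
  obtain a where "a \<epsilon> ap A i" using A_not_empty[OF i] by blast
  then have "tup empty \<langle>a, empty\<rangle> \<epsilon> RI (ap K i) empty" "\<langle>a, empty\<rangle> \<epsilon> B i" "empty \<epsilon> B i"
    using W_empty unfolding ap_K[OF i] RI_graph_str_tup[OF dfn_neq] by (auto simp: mem_B)
  then show ?thesis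
    unfolding sat_some_edge[OF structure_K[OF i]] unfolding ap_K[OF i] univ_graph_str by blast
qed

lemma chosen_K:
  assumes "graph.sat (ultraproduct graph_lang I U K) some_edge empty"
  shows chosen
proof -
  interpret K: graph_family I U K by (rule K_family)
  obtain f g where m: "many (\<lambda>i. tup (ap f i) (ap g i) \<epsilon> RI (ap K i) empty)"
    using assms unfolding K.some_edge_Ult by blast
  \<comment> \<open>The decision is made in each coordinate separately: where \<open>f\<close> takes
    the base point, \<open>g\<close> does not, as the two values differ.\<close>
  have t: "tdf (\<lambda>e. if ap f (e 0) = empty then pfst (ap g (e 0)) else pfst (ap f (e 0)))"
    by (intro dfn_intros)
  show ?thesis
  proof (rule chosenI[OF t], rule many_mono[OF _ _ m])
    fix i assume i: "i \<epsilon> I" "tup (ap f i) (ap g i) \<epsilon> RI (ap K i) empty"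
    then have "ap f i \<epsilon> B i" "ap g i \<epsilon> B i" "ap f i \<noteq> ap g i"
      unfolding ap_K[OF i(1)] RI_graph_str_tup[OF dfn_neq] by auto
    then show "(if ap f i = empty then pfst (ap g i) else pfst (ap f i)) \<epsilon> ap A i"
      unfolding mem_B by auto
  qed (intro dfn_intros)+
qed

lemma chosen_of_isomorphic_family:
  assumes "\<forall>i\<in>elts I. Sigma_equivalent 1 graph_lang (ultraproduct graph_lang I U K) (K \<cdot> i)"
  shows chosen
proof -
  interpret K: graph_family I U K by (rule K_family)
  \<comment> \<open>\<open>I\<close> is non-empty, since the empty set is not in
    \<open>U\<close>.\<close>
  obtain i where i: "i \<epsilon> I" using many_ex[of "\<lambda>i. True"] many_all[of "\<lambda>i. True"] by blast
  then have "Sigma_equivalent 1 graph_lang K.Ult (ap K i)" using assms app_K ap_K by simp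
  then have "graph.sat K.Ult some_edge empty"
    unfolding graph.Sigma_equivalent_iff[OF K.structure_Ult structure_K[OF i]]
    using Sigma_some_edge some_edge_K[OF i] by blast
  then show ?thesis by (rule chosen_K)
qed

end

lemma
  fixes I M :: "'a::zf"
  shows app_const: "i \<epsilon> I \<Longrightarrow> lam I (\<lambda>i. M) \<cdot> i = M"
    and ap_const: "i \<epsilon> I \<Longrightarrow> ap (lam I (\<lambda>i. M)) i = M"
    and func_on_const: "func_on (lam I (\<lambda>i. M)) I"
  by (rule app_lam ap_lam func_on_lam; (intro dfn_intros)?; assumption?)+

text \<open>The constant functions lie in a power of a structure, so it is non-empty in ZF.\<close>

lemma const_ultra_family:
  assumes L: "is_language L" and U: "ultrafilter_over I U" and M': "is_structure L M"
  shows "ultra_family L I U (lam I (\<lambda>i. M))"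
proof -
  interpret lang L by unfold_locales (rule L)
  have fam: "is_family L I (lam I (\<lambda>i. M))"
    unfolding is_family_def ball_elts using func_on_const app_const M' by metis
  interpret indexed_family L I U "lam I (\<lambda>i. M)" by unfold_locales (fact L U fam)+
  obtain a where "a \<epsilon> univ M" using univ_not_empty[OF M'] by blast
  then have "lam I (\<lambda>i. a) \<epsilon> PU"
    by (intro PU_lam dfn_intros) (simp add: ap_const)
  then have "PU \<noteq> empty" by (auto simp: empty_iff)
  then show ?thesis by unfold_locales
qed

context choice_problem
begin

text \<open>The second family is constant with universe \<open>W\<close>; the constant sequences of
  \<open>empty\<close> and \<open>one\<close> are distinct in its ultrapower. The equivalence
  transfers the existence of two elements to the ultraproduct of the \<open>B i\<close>.\<close>

lemma chosen_of_isomorphic_families: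
  assumes "Sigma_equivalent 1 graph_lang (ultraproduct graph_lang I U K)
    (ultraproduct graph_lang I U (lam I (\<lambda>i. graph_str W (\<noteq>))))"
  shows chosen
proof -
  let ?N = "lam I (\<lambda>i. graph_str W (\<noteq>))"
  interpret K: graph_family I U K by (rule K_family)
  interpret N: graph_family I U ?N
    unfolding graph_family_def
    by (rule const_ultra_family[OF is_language_graph U structure_graph_str[OF dfn_neq WN]])
  have t: "tdf (\<lambda>e. c)" for c :: 'a by (intro dfn_intros)
  have c: "lam I (\<lambda>i. c) \<epsilon> N.PU" if "c \<epsilon> W" for c
    by (rule N.PU_lam[OF t]) (simp add: ap_const that)
  have "many (\<lambda>i. tup (ap (lam I (\<lambda>i. empty)) i) (ap (lam I (\<lambda>i. one)) i) \<epsilon> RI (ap ?N i) empty)"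
    by (rule many_all) (simp add: ap_const RI_graph_str_tup[OF dfn_neq] W_empty W_one)
  then have "graph.sat N.Ult some_edge empty"
    unfolding N.some_edge_Ult using c[OF W_empty] c[OF W_one] by blast
  then have "graph.sat K.Ult some_edge empty"
    using assms Sigma_some_edge
    unfolding graph.Sigma_equivalent_iff[OF K.structure_Ult N.structure_Ult] by blast
  then show ?thesis by (rule chosen_K)
qed

lemma isomorphic_K_W: "i \<epsilon> I \<Longrightarrow> isomorphic graph_lang (K \<cdot> i) (lam I (\<lambda>i. graph_str W (\<noteq>)) \<cdot> i)"
  unfolding app_K app_const
  by (intro isomorphic_graph_str B_not_empty WN equipotent_sym[OF equipotent_B])

text \<open>
  In \<open>full_univ\<close> all classes are the same set, so that its ultrapower has no isolated points; over \<open>i \<in> I\<close>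
  the class of \<open>\<langle>empty, i\<rangle>\<close> in \<open>coded_univ\<close> consists of a base point and of a copy of \<open>A \<cdot> i \<times> W\<close>.
\<close>

definition full_univ :: 'a where "full_univ = times W W"

definition coded_univ :: 'a where
  "coded_univ = set_of {p. \<exists>x y. p = \<langle>x, y\<rangle> \<and> ((\<exists>i. i \<epsilon> I \<and> x = \<langle>empty, i\<rangle> \<and> y \<epsilon> B i) \<or>
    (\<exists>w. w \<epsilon> W \<and> y \<epsilon> W \<and> x = \<langle>one, w\<rangle>))}"

lemma B_W: "i \<epsilon> I \<Longrightarrow> y \<epsilon> B i \<Longrightarrow> y \<epsilon> W"
  using W_empty W_pair WA by (auto simp: mem_B)

lemma mem_coded_univ: "p \<epsilon> coded_univ \<longleftrightarrow> (\<exists>x y. p = \<langle>x, y\<rangle> \<and> ((\<exists>i. i \<epsilon> I \<and> x = \<langle>empty, i\<rangle> \<and> y \<epsilon> B i) \<or>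
    (\<exists>w. w \<epsilon> W \<and> y \<epsilon> W \<and> x = \<langle>one, w\<rangle>)))"
proof -
  have "small {p. \<exists>x y. p = \<langle>x, y\<rangle> \<and> ((\<exists>i. i \<epsilon> I \<and> x = \<langle>empty, i\<rangle> \<and> y \<epsilon> B i) \<or>
    (\<exists>w. w \<epsilon> W \<and> y \<epsilon> W \<and> x = \<langle>one, w\<rangle>))}"
    by (rule small_Collect[of _ "times W W"])
      (intro dfn_intros tdf_B, use W_pair W_empty W_one WI B_W in auto)
  then show ?thesis by (simp add: coded_univ_def mem_set_of)
qed

lemma coded_univ_full_univ: "p \<epsilon> coded_univ \<Longrightarrow> p \<epsilon> full_univ"
  unfolding mem_coded_univ full_univ_def using W_pair W_empty W_one WI B_W by auto

lemma coded_univ_one: "w \<epsilon> W \<Longrightarrow> y \<epsilon> W \<Longrightarrow> \<langle>\<langle>one, w\<rangle>, y\<rangle> \<epsilon> coded_univ"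
  and coded_univ_base: "i \<epsilon> I \<Longrightarrow> \<langle>\<langle>empty, i\<rangle>, empty\<rangle> \<epsilon> coded_univ"
  unfolding mem_coded_univ by (auto simp: mem_B)

lemma coded_univ_not_empty: "coded_univ \<noteq> empty" and full_univ_not_empty: "full_univ \<noteq> empty"
  using coded_univ_full_univ coded_univ_one[OF W_empty W_empty] by (metis not_mem_empty)+

text \<open>One diagonal set avoids all second components and gives a new member of an occupied
  class; another avoids all first components and names a new class.\<close>

lemma rich_full_univ: "rich full_univ"
  unfolding rich_def
proof (intro allI impI conjI)
  fix X s assume X: "elts X \<subseteq> elts \<omega>" and s: "s \<epsilon> full_univ \<^bold>^ X"
  have "tdf (\<lambda>e. psnd (ap s (e 0)))" "tdf (\<lambda>e. pfst (ap s (e 0)))" by (intro dfn_intros)+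
  from Cantor[OF this(1) X] Cantor[OF this(2) X]
  obtain d d' where d: "elts d \<subseteq> elts \<omega>" "\<And>l. l \<epsilon> X \<Longrightarrow> d \<noteq> psnd (ap s l)"
    and d': "elts d' \<subseteq> elts \<omega>" "\<And>l. l \<epsilon> X \<Longrightarrow> d' \<noteq> pfst (ap s l)" by blast
  show "\<exists>a. a \<epsilon> full_univ \<and> (\<forall>l. l \<epsilon> X \<longrightarrow> pfst a \<noteq> pfst (ap s l))"
    by (rule exI[of _ "\<langle>d', empty\<rangle>"]) (use d' WP[OF d'(1)] W_empty in \<open>simp add: full_univ_def\<close>)
  fix k assume "k \<epsilon> X"
  then have "pfst (ap s k) \<epsilon> W" using exponent_ap[OF s] unfolding full_univ_def mem_times by fastforce
  moreover have "\<langle>pfst (ap s k), d\<rangle> \<noteq> ap s l" if "l \<epsilon> X" for l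
    using d(2)[OF that] by (metis psnd_pair)
  ultimately show "\<exists>a. a \<epsilon> full_univ \<and> pfst a = pfst (ap s k) \<and> (\<forall>l. l \<epsilon> X \<longrightarrow> a \<noteq> ap s l)"
    using WP[OF d(1)] by (intro exI[of _ "\<langle>pfst (ap s k), d\<rangle>"]) (simp add: full_univ_def)
qed

lemma rich_coded_univ: "rich coded_univ"
  unfolding rich_def
proof (intro allI impI conjI)
  fix X s assume X: "elts X \<subseteq> elts \<omega>" and s: "s \<epsilon> coded_univ \<^bold>^ X"
  \<comment> \<open>Three diagonal sets for the three places where a new element can differ:
    \<open>d\<close> as a member of a class tagged by \<open>one\<close>, \<open>d'\<close> in the
    name of a new class of that kind, and \<open>d''\<close> in the second component of a point of
    \<open>A \<cdot> i \<times> W\<close>.\<close>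
  have t: "tdf (\<lambda>e. psnd (ap s (e 0)))" "tdf (\<lambda>e. psnd (pfst (ap s (e 0))))"
    "tdf (\<lambda>e. psnd (psnd (ap s (e 0))))" by (intro dfn_intros)+
  obtain d where d: "elts d \<subseteq> elts \<omega>" "\<And>l. l \<epsilon> X \<Longrightarrow> d \<noteq> psnd (ap s l)"
    using Cantor[OF t(1) X] by blast
  obtain d' where d': "elts d' \<subseteq> elts \<omega>" "\<And>l. l \<epsilon> X \<Longrightarrow> d' \<noteq> psnd (pfst (ap s l))"
    using Cantor[OF t(2) X] by blast
  obtain d'' where d'': "elts d'' \<subseteq> elts \<omega>" "\<And>l. l \<epsilon> X \<Longrightarrow> d'' \<noteq> psnd (psnd (ap s l))"
    using Cantor[OF t(3) X] by blast
  have "pfst \<langle>\<langle>one, d'\<rangle>, empty\<rangle> \<noteq> pfst (ap s l)" if "l \<epsilon> X" for l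
    using d'(2)[OF that] by (metis pfst_pair psnd_pair)
  then show "\<exists>a. a \<epsilon> coded_univ \<and> (\<forall>l. l \<epsilon> X \<longrightarrow> pfst a \<noteq> pfst (ap s l))"
    using coded_univ_one[OF WP[OF d'(1)] W_empty] by blast
  fix k assume "k \<epsilon> X"
  then have "ap s k \<epsilon> coded_univ" by (rule exponent_ap[OF s])
  then consider i y where "i \<epsilon> I" "ap s k = \<langle>\<langle>empty, i\<rangle>, y\<rangle>" | w y where "w \<epsilon> W" "ap s k = \<langle>\<langle>one, w\<rangle>, y\<rangle>"
    unfolding mem_coded_univ by blast
  then show "\<exists>a. a \<epsilon> coded_univ \<and> pfst a = pfst (ap s k) \<and> (\<forall>l. l \<epsilon> X \<longrightarrow> a \<noteq> ap s l)"
  proof cases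
    case 1
    obtain a where "a \<epsilon> ap A i" using A_not_empty[OF 1(1)] by blast
    then have "\<langle>\<langle>empty, i\<rangle>, \<langle>a, d''\<rangle>\<rangle> \<epsilon> coded_univ" using 1(1) WP[OF d''(1)] by (auto simp: mem_coded_univ mem_B)
    moreover have "\<langle>\<langle>empty, i\<rangle>, \<langle>a, d''\<rangle>\<rangle> \<noteq> ap s l" if "l \<epsilon> X" for l
      using d''(2)[OF that] by (metis psnd_pair)
    ultimately show ?thesis using 1(2) by (intro exI[of _ "\<langle>\<langle>empty, i\<rangle>, \<langle>a, d''\<rangle>\<rangle>"]) simp
  next
    case 2
    have "\<langle>\<langle>one, w\<rangle>, d\<rangle> \<noteq> ap s l" if "l \<epsilon> X" for l
      using d(2)[OF that] by (metis psnd_pair)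
    then show ?thesis using 2 coded_univ_one[OF 2(1) WP[OF d(1)]]
      by (intro exI[of _ "\<langle>\<langle>one, w\<rangle>, d\<rangle>"]) simp
  qed
qed

text \<open>The inclusion works: both universes name the class of a point by its first
  component.\<close>

lemma embedding_coded_full: "\<exists>j. elementary_embedding graph_lang (graph_str coded_univ classmates) (graph_str full_univ classmates) j"
proof
  have t: "tdf (\<lambda>e::nat \<Rightarrow> 'a. e 0)" by (intro dfn_intros)
  show "elementary_embedding graph_lang (graph_str coded_univ classmates) (graph_str full_univ classmates) (lam coded_univ (\<lambda>p. p))"
    by (rule rich_embedding[OF rich_coded_univ coded_univ_not_empty rich_full_univ full_univ_not_empty])
      (rule lam_mem_exponent[OF t coded_univ_full_univ], assumption, simp add: ap_lam[OF t])
qed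

text \<open>The classes tagged by \<open>one\<close> form a copy of \<open>full_univ\<close> inside
  \<open>coded_univ\<close>.\<close>

lemma embedding_full_coded: "\<exists>j. elementary_embedding graph_lang (graph_str full_univ classmates) (graph_str coded_univ classmates) j"
proof
  have t: "tdf (\<lambda>e::nat \<Rightarrow> 'a. \<langle>\<langle>one, pfst (e 0)\<rangle>, psnd (e 0)\<rangle>)" by (intro dfn_intros)
  show "elementary_embedding graph_lang (graph_str full_univ classmates) (graph_str coded_univ classmates) (lam full_univ (\<lambda>p. \<langle>\<langle>one, pfst p\<rangle>, psnd p\<rangle>))"
  proof (rule rich_embedding[OF rich_full_univ full_univ_not_empty rich_coded_univ coded_univ_not_empty])
    show "lam full_univ (\<lambda>p. \<langle>\<langle>one, pfst p\<rangle>, psnd p\<rangle>) \<epsilon> coded_univ \<^bold>^ full_univ"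
      by (rule lam_mem_exponent[OF t]) (auto simp: full_univ_def mem_times intro: coded_univ_one)
  qed (auto simp: ap_lam[OF t] full_univ_def mem_times)
qed

lemma structure_coded_univ: "is_structure graph_lang (graph_str coded_univ classmates)"
  and structure_full_univ: "is_structure graph_lang (graph_str full_univ classmates)"
  by (rule structure_graph_str[OF dfn_classmates coded_univ_not_empty] structure_graph_str[OF dfn_classmates full_univ_not_empty])+

lemma chosen_of_embeddings:
  assumes "Sigma_equivalent 2 graph_lang (ultrapower graph_lang I U (graph_str coded_univ classmates))
    (ultrapower graph_lang I U (graph_str full_univ classmates))"
  shows chosen
proof -
  let ?M = "lam I (\<lambda>i. graph_str coded_univ classmates)" and ?N = "lam I (\<lambda>i. graph_str full_univ classmates)"
  interpret M: graph_family I U ?M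
    unfolding graph_family_def by (rule const_ultra_family[OF is_language_graph U structure_coded_univ])
  interpret N: graph_family I U ?N
    unfolding graph_family_def by (rule const_ultra_family[OF is_language_graph U structure_full_univ])
  have "\<not> graph.sat N.Ult some_isolated empty"
    unfolding N.some_isolated_Ult
  proof (intro notI, elim exE conjE)
    fix f assume f: "f \<epsilon> N.PU"
      and iso: "\<forall>g. g \<epsilon> N.PU \<longrightarrow> \<not> many (\<lambda>i. tup (ap f i) (ap g i) \<epsilon> RI (ap ?N i) empty)"
    \<comment> \<open>A classmate of \<open>f\<close> is defined uniformly, by switching the second
      component between two fixed elements of \<open>W\<close>.\<close>
    define F where "F i = \<langle>pfst (ap f i), if psnd (ap f i) = empty then one else empty\<rangle>" for i
    have t: "tdf (\<lambda>e. F (e 0))" unfolding F_def by (intro dfn_intros)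
    have fi: "ap f i \<epsilon> full_univ" if "i \<epsilon> I" for i using N.PU_ap[OF f that] that by (simp add: ap_const)
    have F: "F i \<epsilon> full_univ \<and> classmates (ap f i) (F i)" if "i \<epsilon> I" for i
      using fi[OF that] W_empty W_one unfolding F_def classmates_def full_univ_def mem_times by auto
    have "lam I F \<epsilon> N.PU" by (rule N.PU_lam[OF t]) (simp add: ap_const F)
    moreover have "many (\<lambda>i. tup (ap f i) (ap (lam I F) i) \<epsilon> RI (ap ?N i) empty)"
      by (rule many_all) (simp add: ap_const ap_lam[OF t] RI_graph_str_tup[OF dfn_classmates] F fi)
    ultimately show False using iso by blast
  qed
  then have "\<not> graph.sat M.Ult some_isolated empty"
    using assms Sigma_some_isolated
    unfolding ultrapower_def graph.Sigma_equivalent_iff[OF M.structure_Ult N.structure_Ult] by blast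
  moreover have t: "tdf (\<lambda>e::nat \<Rightarrow> 'a. \<langle>\<langle>empty, e 0\<rangle>, empty\<rangle>)" by (intro dfn_intros)
  moreover have "lam I (\<lambda>i. \<langle>\<langle>empty, i\<rangle>, empty\<rangle>) \<epsilon> M.PU"
    by (rule M.PU_lam[OF t]) (simp add: ap_const coded_univ_base)
  ultimately obtain g where
    g: "many (\<lambda>i. tup (ap (lam I (\<lambda>i. \<langle>\<langle>empty, i\<rangle>, empty\<rangle>)) i) (ap g i) \<epsilon> RI (ap ?M i) empty)"
    unfolding M.some_isolated_Ult by blast
  \<comment> \<open>A classmate of the base point over \<open>i\<close> has the form
    \<open>\<langle>\<langle>empty, i\<rangle>, \<langle>a, w\<rangle>\<rangle>\<close> with
    \<open>a\<close> in \<open>A \<cdot> i\<close>, and this term extracts \<open>a\<close>.\<close>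
  have tF: "tdf (\<lambda>e. pfst (psnd (ap g (e 0))))" by (intro dfn_intros)
  show chosen
  proof (rule chosenI[OF tF], rule many_mono[OF _ _ g])
    fix i assume i: "i \<epsilon> I"
      and "tup (ap (lam I (\<lambda>i. \<langle>\<langle>empty, i\<rangle>, empty\<rangle>)) i) (ap g i) \<epsilon> RI (ap ?M i) empty"
    then have "ap g i \<epsilon> coded_univ" "classmates \<langle>\<langle>empty, i\<rangle>, empty\<rangle> (ap g i)"
      by (simp_all add: ap_const ap_lam[OF t] RI_graph_str_tup[OF dfn_classmates])
    then show "pfst (psnd (ap g i)) \<epsilon> ap A i"
      unfolding mem_coded_univ classmates_def by (auto simp: mem_B)
  qed (intro dfn_intros)+
qed

end

lemma U_AC_if_chosen:
  fixes I U :: "'a::zf"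
  assumes U: "ultrafilter_over I U"
    and chosen: "\<And>A W. choice_problem I U A W \<Longrightarrow> \<exists>f. func_on f I \<and> U_many I U (\<lambda>i. f \<cdot> i \<epsilon> A \<cdot> i)"
  shows "U_AC I U"
  unfolding U_AC_def
proof (intro allI impI, elim conjE)
  fix A assume A: "func_on A I" and ne: "\<forall>i\<in>elts I. A \<cdot> i \<noteq> empty"
  have "tdf (\<lambda>e. ap A (e 0))" by (intro dfn_intros)
  from small_image[OF this, of I]
  obtain c where c: "\<And>y. y \<epsilon> c \<longleftrightarrow> (\<exists>i. y = ap A i \<and> i \<epsilon> I)"
    unfolding small_def by (auto simp: set_eq_iff)
  obtain d where d: "\<And>x. x \<epsilon> d \<longleftrightarrow> (\<exists>y. y \<epsilon> c \<and> x \<epsilon> y)" using union[of c] by blast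
  \<comment> \<open>The ingredients required of \<open>W\<close>: all elements of the
    \<open>A \<cdot> i\<close>, the indices and the subsets of \<omega>.\<close>
  define b where "b = set_of (elts (set_of (elts d \<union> elts I)) \<union> elts (pow \<omega>))"
  have b: "x \<epsilon> b \<longleftrightarrow> x \<epsilon> d \<or> x \<epsilon> I \<or> elts x \<subseteq> elts \<omega>" for x
    by (simp add: b_def mem_set_of)
  obtain W where W: "\<And>x. x \<epsilon> b \<Longrightarrow> x \<epsilon> W" "\<And>x. x \<epsilon> \<omega> \<Longrightarrow> x \<epsilon> W"
    "\<And>x y. x \<epsilon> W \<Longrightarrow> y \<epsilon> W \<Longrightarrow> \<langle>x, y\<rangle> \<epsilon> W" "\<And>n u. n \<epsilon> \<omega> \<Longrightarrow> u \<epsilon> W \<^bold>^ n \<Longrightarrow> u \<epsilon> W"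
    by (rule ex_pairing_closed[of b]) blast
  have "choice_problem I U A W"
  proof unfold_locales
    show "ultrafilter_over I U" "func_on A I" by (fact U A)+
    show "\<exists>a. a \<epsilon> ap A i" if "i \<epsilon> I" for i
      unfolding app_ap[OF A that, symmetric] using ne that by (auto simp: empty_iff)
    show "a \<epsilon> W" if "i \<epsilon> I" "a \<epsilon> ap A i" for i a
      by (rule W(1)) (use that c d b in blast)
    show "i \<epsilon> W" if "i \<epsilon> I" for i by (rule W(1)) (use that b in blast)
    show "x \<epsilon> W" if "elts x \<subseteq> elts \<omega>" for x by (rule W(1)) (use that b in blast)
    show "\<langle>x, y\<rangle> \<epsilon> W" if "x \<epsilon> W" "y \<epsilon> W" for x y by (rule W(3)[OF that])
  qed
  then show "\<exists>f. func_on f I \<and> U_many I U (\<lambda>i. f \<cdot> i \<epsilon> A \<cdot> i)" by (rule chosen)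
qed

lemma structure_ultrapower:
  assumes "is_language L" "ultrafilter_over I U" "is_structure L (M :: 'a::zf)"
  shows "is_structure L (ultrapower L I U M)"
  unfolding ultrapower_def by (rule ultra_family.structure_Ult[OF const_ultra_family[OF assms]])

lemma ultrapower_sat:
  assumes L: "is_language L" and U: "ultrafilter_over I U" and AC: "U_AC I U"
    and M': "is_structure L M" and p: "is_formula L empty p"
  shows "lang.sat L (ultrapower L I U M) p empty \<longleftrightarrow> lang.sat L (M :: 'a::zf) p empty"
proof -
  interpret ultra_family L I U "lam I (\<lambda>i. M)" by (rule const_ultra_family[OF L U M'])
  obtain i where i: "i \<epsilon> I" using many_ex[of "\<lambda>i. True"] many_all[of "\<lambda>i. True"] by blast
  show ?thesis
    unfolding ultrapower_def using Los_const[OF AC p i] i by (simp add: ap_const)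
qed

lemma (in lang) formula_of_Sigma: "is_Sigma n L X p \<Longrightarrow> is_formula L X p"
  using formula_Sigma_Pi by blast

text \<open>Three cycles through (1) suffice: from (1) to (2) to (4) and back, from (1) to (3) and
  back, and from (1) to (6) to (5) and back.\<close>

theorem theorem1p4:
  fixes I U :: "'a::zf"
  assumes "ultrafilter_over I U"
  shows
    "(U_AC I U \<longleftrightarrow>
        (\<forall>L M. is_language L \<and> is_structure L M \<longrightarrow>
           Sigma_equivalent 2 L (ultrapower L I U M) M)) \<and>
     (U_AC I U \<longleftrightarrow>
        (\<forall>L M. is_language L \<and> is_family L I M \<and>
           (\<forall>i\<in>elts I. \<forall>j\<in>elts I. isomorphic L (M \<cdot> i) (M \<cdot> j)) \<and>
           product_univ I M \<noteq> empty \<longrightarrow>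
           (\<forall>i\<in>elts I. Sigma_equivalent 1 L (ultraproduct L I U M) (M \<cdot> i)))) \<and>
     (U_AC I U \<longleftrightarrow>
        (\<forall>L M N. is_language L \<and> is_structure L M \<and> is_structure L N \<and>
           (\<exists>j. elementary_embedding L M N j) \<and> (\<exists>j'. elementary_embedding L N M j') \<longrightarrow>
           Sigma_equivalent 2 L (ultrapower L I U M) (ultrapower L I U N))) \<and>
     (U_AC I U \<longleftrightarrow>
        (\<forall>L M N. is_language L \<and> is_family L I M \<and> is_family L I N \<and>
           (\<forall>i\<in>elts I. isomorphic L (M \<cdot> i) (N \<cdot> i)) \<and>
           product_univ I M \<noteq> empty \<and> product_univ I N \<noteq> empty \<longrightarrow>
           Sigma_equivalent 1 L (ultraproduct L I U M) (ultraproduct L I U N))) \<and>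
     (U_AC I U \<longleftrightarrow>
        (\<forall>L M N. is_language L \<and> is_family L I M \<and> is_family L I N \<and>
           (\<forall>i\<in>elts I. isomorphic L (M \<cdot> i) (N \<cdot> i)) \<and>
           product_univ I M \<noteq> empty \<and> product_univ I N \<noteq> empty \<longrightarrow>
           isomorphic L (ultraproduct L I U M) (ultraproduct L I U N)))"
    (is "(?P1 \<longleftrightarrow> ?P2) \<and> (_ \<longleftrightarrow> ?P3) \<and> (_ \<longleftrightarrow> ?P4) \<and> (_ \<longleftrightarrow> ?P5) \<and> (_ \<longleftrightarrow> ?P6)")
proof -
  note U = assms
  have 12: ?P2 if AC: ?P1
  proof (intro allI impI, elim conjE)
    fix L M :: 'a assume L: "is_language L" and M: "is_structure L M"
    interpret lang L by unfold_locales (rule L)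
    show "Sigma_equivalent 2 L (ultrapower L I U M) M"
      unfolding Sigma_equivalent_iff[OF structure_ultrapower[OF L U M] M]
      using ultrapower_sat[OF L U AC M] formula_of_Sigma by blast
  qed
  \<comment> \<open>Each ultrapower agrees with its base on the sentences in question, and an
    elementary embedding makes the two bases agree.\<close>
  have 24: ?P4 if P2: ?P2
  proof (intro allI impI, elim conjE exE)
    fix L M N j :: 'a
    assume L: "is_language L" and M: "is_structure L M" and N: "is_structure L N"
      and j: "elementary_embedding L M N j"
    interpret lang L by unfold_locales (rule L)
    note ult = structure_ultrapower[OF L U]
    have eq: "sat (ultrapower L I U K) p empty \<longleftrightarrow> sat K p empty"
      if K: "is_structure L K" and p: "is_Sigma 2 L empty p" for K p
    proof -
      have "Sigma_equivalent 2 L (ultrapower L I U K) K"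
        by (rule P2[THEN spec, THEN spec, THEN mp, OF conjI[OF L K]])
      then show ?thesis unfolding Sigma_equivalent_iff[OF ult[OF K] K] using p by blast
    qed
    show "Sigma_equivalent 2 L (ultrapower L I U M) (ultrapower L I U N)"
      unfolding Sigma_equivalent_iff[OF ult[OF M] ult[OF N]]
      using eq[OF M] eq[OF N] elementary_embedding_sat[OF M N j formula_of_Sigma] by simp
  qed
  have 41: ?P1 if P4: ?P4
  proof (rule U_AC_if_chosen[OF U])
    fix A W assume "choice_problem I U A W"
    then interpret choice_problem I U A W .
    show chosen
      by (rule chosen_of_embeddings, rule P4[rule_format])
        (intro conjI is_language_graph structure_coded_univ structure_full_univ embedding_coded_full embedding_full_coded)
  qed
  have 13: ?P3 if AC: ?P1
  proof (intro allI impI ballI, elim conjE)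
    fix L M i :: 'a
    assume L: "is_language L" and M: "is_family L I M" and ne: "product_univ I M \<noteq> empty"
      and iso: "\<forall>i\<in>elts I. \<forall>j\<in>elts I. isomorphic L (M \<cdot> i) (M \<cdot> j)" and "i \<in> elts I"
    then have i: "i \<epsilon> I" by simp
    interpret ultra_family L I U M by unfold_locales (fact L U M ne)+
    have "sat (Mi j) p empty \<longleftrightarrow> sat (Mi i) p empty"
      if j: "j \<epsilon> I" and p: "is_formula L empty p" for j p
    proof (rule isomorphic_sat[OF structure_M[OF j] structure_M[OF i] _ p])
      show "isomorphic L (Mi j) (Mi i)" unfolding app_M[OF i, symmetric] app_M[OF j, symmetric] using iso i j by simp
    qed
    then show "Sigma_equivalent 1 L Ult (M \<cdot> i)"
      unfolding app_M[OF i] Sigma_equivalent_iff[OF structure_Ult structure_M[OF i]]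
      using Los_const[OF AC _ i] formula_of_Sigma by blast
  qed
  have 31: ?P1 if P3: ?P3
  proof (rule U_AC_if_chosen[OF U])
    fix A W assume "choice_problem I U A W"
    then interpret choice_problem I U A W .
    show chosen
      by (rule chosen_of_isomorphic_family, rule P3[THEN spec, THEN spec, THEN mp])
        (intro conjI ballI is_language_graph family_K product_K isomorphic_K; simp)
  qed
  have 16: ?P6 if AC: ?P1
  proof (intro allI impI, elim conjE)
    fix L M N :: 'a
    assume h: "is_language L" "is_family L I M" "is_family L I N"
      "\<forall>i\<in>elts I. isomorphic L (M \<cdot> i) (N \<cdot> i)" "product_univ I M \<noteq> empty" "product_univ I N \<noteq> empty"
    show "isomorphic L (ultraproduct L I U M) (ultraproduct L I U N)"
      by (rule isomorphic_ultraproducts[OF h(1) U AC h(2,3) _ h(5,6)]) (use h(4) in simp)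
  qed
  have 65: ?P5 if P6: ?P6
  proof (intro allI impI)
    fix L M N :: 'a
    assume h: "is_language L \<and> is_family L I M \<and> is_family L I N \<and>
      (\<forall>i\<in>elts I. isomorphic L (M \<cdot> i) (N \<cdot> i)) \<and> product_univ I M \<noteq> empty \<and> product_univ I N \<noteq> empty"
    then have iso: "isomorphic L (ultraproduct L I U M) (ultraproduct L I U N)"
      by (rule P6[THEN spec, THEN spec, THEN spec, THEN mp])
    interpret M: ultra_family L I U M by unfold_locales (use h U in blast)+
    interpret N: ultra_family L I U N by unfold_locales (use h U in blast)+
    show "Sigma_equivalent 1 L M.Ult N.Ult"
      unfolding M.Sigma_equivalent_iff[OF M.structure_Ult N.structure_Ult]
      using M.isomorphic_sat[OF M.structure_Ult N.structure_Ult iso] M.formula_of_Sigma by blast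
  qed
  have 51: ?P1 if P5: ?P5
  proof (rule U_AC_if_chosen[OF U])
    fix A W assume "choice_problem I U A W"
    then interpret choice_problem I U A W .
    let ?N = "lam I (\<lambda>i. graph_str W (\<noteq>))"
    interpret N: ultra_family graph_lang I U ?N
      by (rule const_ultra_family[OF is_language_graph U structure_graph_str[OF dfn_neq WN]])
    show chosen
      by (rule chosen_of_isomorphic_families, rule P5[THEN spec, THEN spec, THEN spec, THEN mp])
        (intro conjI ballI is_language_graph family_K product_K N.M N.nonempty isomorphic_K_W; simp)
  qed
  show ?thesis
    using 12 24 41 13 31 16 65 51 by blast
qed

end
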